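(* Let $\Lambda=\mathcal K Q/\langle\rho\rangle$ be a string algebra, $\mathfrak b$ a band over $\Lambda$, $n\in\mathbb N=\{1,2,\dots\}$ and $\lambda\in\mathcal K^\times$. Then the band module $B(\mathfrak b,n,\lambda)$ is a brick if and only if $n=1$ and every word in the class $\Phi(\widetilde{\mathsf W}({}^\infty\mathfrak b^\infty))$ of words over the multi-entry inverse automaton $\mathsf M_{\Lambda\delta}$ is a weak brick word over $\mathsf M_{\Lambda\delta}$.
   Context: $\mathcal K$ is an algebraically closed field. **String algebras.** $Q=(Q_0,Q_1,s,t)$ is a finite quiver; a path $\alpha\beta$ requires $t(\alpha)=s(\beta)$. A string algebra is $\mathcal KQ/\langle\rho\rangle$, $\rho$ a finite set of paths of length $\ge 2$, such that: (I) each vertex is the source of at most two arrows and the target of at most two arrows; (II) for each $\alpha\in Q_1$ there is at most one arrow $\gamma$ such that $\alpha\gamma$ is a path not in $\rho$, and at most one arrow $\gamma'$ such that $\gamma'\alpha$ is a path not in $\rho$; (III) there is a bound on the lengths of paths having no subpath in $\rho$. Fix maps $\varsigma,\varepsilon:Q_1\to\{-1,1\}$ with: (a) $\alpha\ne\beta$, $s(\alpha)=s(\beta)$ imply $\varsigma(\alpha)=-\varsigma(\beta)$; (b) $\alpha\ne\beta$, $t(\alpha)=t(\beta)$ imply $\varepsilon(\alpha)=-\varepsilon(\beta)$; (c) $t(\alpha)=s(\beta)$, $\alpha\beta\notin\rho$ imply $\varepsilon(\alpha)=-\varsigma(\beta)$. **Strings.** Each arrow $\alpha$ has a formal inverse $\alpha^{-1}$,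 with $(\alpha^{-1})^{-1}=\alpha$, $s(\alpha^{-1})=t(\alpha)$, $t(\alpha^{-1})=s(\alpha)$, $\varsigma(\alpha^{-1})=\varepsilon(\alpha)$, $\varepsilon(\alpha^{-1})=\varsigma(\alpha)$. Elements of $Q_1\sqcup Q_1^{-1}$ are syllables (those of $Q_1$ direct, those of $Q_1^{-1}$ inverse). A finite string of length $k\ge1$ is a sequence of syllables $\alpha_1\cdots\alpha_k$ with $t(\alpha_i)=s(\alpha_{i+1})$, $\alpha_i\ne\alpha_{i+1}^{-1}$, and neither $\alpha_i\cdots\alpha_{i+j}$ nor $\alpha_{i+j}^{-1}\cdots\alpha_i^{-1}$ in $\rho$ for all $1\le i\le i+j\le k$. For each $v\in Q_0$ there are also two zero-length strings $1_{(v,1)},1_{(v,-1)}$ with source and target $v$, $1_{(v,i)}^{-1}=1_{(v,-i)}$, $\varsigma(1_{(v,i)})=-i$, $\varepsilon(1_{(v,i)})=i$. Set $\varsigma(\alpha_1\cdots\alpha_k)=\varsigma(\alpha_1)$, $\varepsilon(\alpha_1\cdots\alpha_k)=\varepsilon(\alpha_k)$, and similarly for source and target. $\mathfrak x1_{(v,i)}$ is defined (and equals $\mathfrak x$) iff $t(\mathfrak x)=v,\varepsilon(\mathfrak x)=i$; $1_{(v,i)}\mathfrak x$ is defined (and equals $\mathfrak x$) iff $s(\mathfrak x)=v,\varsigma(\mathfrak x)=-i$. Infinite strings are sequences of syllables indexed by $\mathbb N$, by $\mathbb N^{op}$, or by $\mathbb Z$ (the last taken up to shift of the index), all of whose finite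 consecutive subsequences are strings. $\mathfrak{St}(\Lambda)$ is the set of all finite and infinite strings. A (left, right) substring is a consecutive (initial, final) part, written $\sqsubseteq$ ($\sqsubseteq_l,\sqsubseteq_r$). The same notation is used for words over an alphabet. **Bands, band modules, bricks.** A band is a finite string $\mathfrak b$ of positive length with $s(\mathfrak b)=t(\mathfrak b)$, not of the form $\mathfrak u^m$ with $m\ge2$, such that $\mathfrak b^m$ is a string for all $m\ge1$, and whose first syllable is inverse and last syllable is direct. ${}^\infty\mathfrak b^\infty$ is the bi-infinite string $\cdots\mathfrak b\mathfrak b\mathfrak b\cdots$. Modules are viewed as representations of $(Q,\rho)$. For $\mathfrak b=\alpha_1\cdots\alpha_k$, $n\ge1$, $\lambda\in\mathcal K^\times$, the band module $B(\mathfrak b,n,\lambda)$ is $\bigoplus_{i\in\mathbb Z/k}V_i$ with $V_i=\mathcal K^n$ placed at the vertex $t(\alpha_i)$; a syllable $\alpha_i\in Q_1$ makes the arrow $\alpha_i$ act $V_{i-1}\to V_i$, a syllable $\alpha_i=\beta^{-1}$ with $\beta\in Q_1$ makes $\beta$ act $V_i\to V_{i-1}$, in each case by the identity, except that the last (direct) syllable $\alpha_k$ acts by the $n\times n$ Jordan block with eigenvalue $\lambda$; all other components of arrow actions are zero. A brick is a module whose endomorphism algebra is isomorphic to $\mathcal K$. **Multi-entry inverse automaton (MIA).** A tuple $\mathsf M=(\mathsf M_0,\mathsf I,\mathsf e,(-)^{-1},\mathsf A,\mathsf t)$ with $\mathsf M_0$ a finite set of states, $\mathsf I\subseteq\mathsf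 M_0$ the initial states, $\mathsf e:\mathsf M_0\to\mathsf I$, $(-)^{-1}:\mathsf I\to\mathsf I$, $\mathsf A$ a finite alphabet with $\mathsf A^\pm=\mathsf A\sqcup\mathsf A^{-1}$ (formal inverses), and a partial function $\mathsf t:\mathsf M_0\times\mathsf A^\pm\rightharpoonup\mathsf M_0$ such that: (1) $(-)^{-1}$ is an involution without fixed points; (2) $\mathsf e(v)=v$ for $v\in\mathsf I$; (3) if $\mathsf t(v,\mathsf b)$ is defined then $\mathsf t(\mathsf e(v),\mathsf b)$ is defined and $\mathsf e(\mathsf t(v,\mathsf b))=\mathsf e(\mathsf t(\mathsf e(v),\mathsf b))$. $\widetilde{\mathsf t}$ is the extension of $\mathsf t$ to finite words: $\widetilde{\mathsf t}(v,\epsilon)=v$ for the empty word $\epsilon$, $\widetilde{\mathsf t}(v,\mathsf w'\mathsf b)=\mathsf t(\widetilde{\mathsf t}(v,\mathsf w'),\mathsf b)$. **Words over an MIA.** Words are finite, right-infinite, left-infinite or bi-infinite sequences over $\mathsf A^\pm$; the inverse of a word reverses the order and inverts each letter. A right word is $(v,\mathsf w)$ with $v\in\mathsf I$ and $\mathsf w$ finite or right-infinite such that $\widetilde{\mathsf t}(v,\mathsf w')$ is defined for all finite $\mathsf w'\sqsubseteq_l\mathsf w$. A left word is $(\mathsf w,v)$ such that $(v^{-1},\mathsf w^{-1})$ is a right word. A word over $\mathsf M$ is a triple $(\mathsf w^l,v,\mathsf w^r)$ with $v\in\mathsf I$, $(\mathsf w^l,v)$ a left word, $(v,\mathsf w^r)$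 a right word, and $(\mathsf w^l\mathsf w',\mathsf e(\widetilde{\mathsf t}(v,\mathsf w')))$ a left word for each finite $\mathsf w'\sqsubseteq_l\mathsf w^r$. $\mathsf W(\mathsf M)$ is the set of words over $\mathsf M$; a word is finite if $\mathsf w^l$ and $\mathsf w^r$ are finite. The inverse of a word is $(\mathsf w^l,v,\mathsf w^r)^{-1}=((\mathsf w^r)^{-1},v^{-1},(\mathsf w^l)^{-1})$. The relation $\sim$ on $\mathsf W(\mathsf M)$ is the symmetric closure of: $(\mathsf w_1^l,v_1,\mathsf w_1^r)\sim(\mathsf w_2^l,v_2,\mathsf w_2^r)$ if there is a finite word $\overline{\mathsf w}$ with $\mathsf w_1^l=\mathsf w_2^l\overline{\mathsf w}$, $\mathsf w_2^r=\overline{\mathsf w}\mathsf w_1^r$ and $\mathsf e(\widetilde{\mathsf t}(v_2,\overline{\mathsf w}))=v_1$. **Subwords.** $\mathsf w_1=(\mathsf w_1^l,v_1,\mathsf w_1^r)$ is a subword of $\mathsf w_2$, $\mathsf w_1\sqsubseteq\mathsf w_2$, if there is $\mathsf w_3=(\mathsf w_3^l,v_1,\mathsf w_3^r)\sim\mathsf w_2$ with $\mathsf w_1^l\sqsubseteq_r\mathsf w_3^l$ and $\mathsf w_1^r\sqsubseteq_l\mathsf w_3^r$. It is proper, $\mathsf w_1\sqsubset\mathsf w_2$, if moreover $\mathsf w_1\not\sim\mathsf w_2$. It is a factor subword if for some such $\mathsf w_3$ one of the following holds: $\mathsf w_1=\mathsf w_3$; or $\mathsf w_1^l=\mathsf w_3^l$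 and $\mathsf w_1^r\mathsf b\sqsubseteq_l\mathsf w_3^r$ for some $\mathsf b\in\mathsf A$; or $\mathsf w_1^r=\mathsf w_3^r$ and $\mathsf b^{-1}\mathsf w_1^l\sqsubseteq_r\mathsf w_3^l$ for some $\mathsf b\in\mathsf A$; or $\mathsf b^{-1}\mathsf w_1^l\sqsubseteq_r\mathsf w_3^l$ and $\mathsf w_1^r\mathsf b'\sqsubseteq_l\mathsf w_3^r$ for some $\mathsf b,\mathsf b'\in\mathsf A$. An image subword is defined in the same way with $\mathsf b^{-1}$ (left side) replaced by $\mathsf b$, and $\mathsf b$, $\mathsf b'$ (right side) replaced by $\mathsf b^{-1}$, $\mathsf b'^{-1}$. **Weak brick words.** $\mathsf w\in\mathsf W(\mathsf M)$ is a weak brick word if there are no finite word $\overline{\mathsf w}\in\mathsf W(\mathsf M)$ and $\mathsf u\in\{\mathsf w,\mathsf w^{-1}\}$ such that $\overline{\mathsf w}$ is a factor subword of $\mathsf w$, an image subword of $\mathsf u$, and at least one of $\overline{\mathsf w}\sqsubset\mathsf w$, $\overline{\mathsf w}\sqsubset\mathsf u$ holds. **The MIA $\mathsf M_\Lambda$.** Its alphabet is $Q_1$; its initial states are the zero-length strings, with $(-)^{-1}$ given by $1_{(v,i)}^{-1}=1_{(v,-i)}$; its states are the zero-length strings, all syllables in $Q_1\sqcup Q_1^{-1}$, and all strings $\mathfrak y$ that are proper left substrings of some $\mathfrak r$ with $\mathfrak r\in\rho$ or $\mathfrak r^{-1}\in\rho$; $\mathsf t_\Lambda(\mathfrak x,\mathsf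 b)$ is defined iff $\mathfrak x\mathsf b\in\mathfrak{St}(\Lambda)$, and then it is the maximal right substring of $\mathfrak x\mathsf b$ that is a state; $\mathsf e_\Lambda(\mathfrak x)=1_{(t(\mathfrak x),\varepsilon(\mathfrak x))}$. **The class $\widetilde{\mathsf W}(\mathfrak x)$.** For a string $\mathfrak x$, $\widetilde{\mathsf W}(\mathfrak x)$ is the $\sim$-class in $\mathsf W(\mathsf M_\Lambda)$ of all words $(\mathsf w^l,v,\mathsf w^r)$ with $\mathsf w^l\mathsf w^r=\mathfrak x$ (if $\mathfrak x=1_{(u,i)}$ it is the class of $(\epsilon,1_{(u,i)},\epsilon)$). **The MIA $\mathsf M_{\Lambda\delta}$.** Let $\delta:Q_1\to\{0\}$ be the constant map, write $1:=0^{-1}$, and let $\delta^\pm:Q_1\sqcup Q_1^{-1}\to\{0,1\}$ be the induced map ($\delta^\pm(\alpha)=0$, $\delta^\pm(\alpha^{-1})=1$ for $\alpha\in Q_1$). For each state $\mathfrak x$ of $\mathsf M_\Lambda$, $\delta^\pm$ is injective on $\{\mathsf b:\mathsf t_\Lambda(\mathfrak x,\mathsf b)\text{ defined}\}$. $\mathsf M_{\Lambda\delta}$ has the same states, initial states, $\mathsf e$ and $(-)^{-1}$ as $\mathsf M_\Lambda$, alphabet $\{0\}$, and transition function $\mathsf t'(\mathfrak x,\delta^\pm(\mathsf b))=\mathsf t_\Lambda(\mathfrak x,\mathsf b)$ whenever the latter is defined. $\Phi:\mathsf W(\mathsf M_\Lambda)\to\mathsf W(\mathsf M_{\Lambda\delta})$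 sends $(\mathsf w^l,v,\mathsf w^r)$ to the triple obtained by applying $\delta^\pm$ letterwise to $\mathsf w^l$ and $\mathsf w^r$. *)

theory Defs
  imports
    "Graph_Theory.Arc_Walk"
    "Jordan_Normal_Form.Jordan_Normal_Form"
    "Jordan_Normal_Form.VS_Connect"
    "HOL-Algebra.QuotRing"
    "HOL-Library.FuncSet"
    "HOL-Library.Function_Algebras"
    "HOL-Library.Stream"
    "HOL-Library.Sublist"
begin

section \<open>Words over an alphabet with formal inverses\<close>

datatype 'a letter = Dir 'a | Inv 'a

fun linv :: "'a letter \<Rightarrow> 'a letter" where
  "linv (Dir a) = Inv a"
| "linv (Inv a) = Dir a"

fun is_Dir :: "'a letter \<Rightarrow> bool" where
  "is_Dir (Dir a) = True"
| "is_Dir (Inv a) = False"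

definition letters_over :: "'a set \<Rightarrow> 'a letter set" where
  "letters_over A = Dir ` A \<union> Inv ` A"

text \<open>
  \<open>LInf s\<close> is read from right to left: it is the left-infinite word
  \<open>\<dots> (s !! 2) (s !! 1) (s !! 0)\<close>.  Bi-infinite words are to be taken up to a shift of
  the index; this identification is made by \<open>word_eq\<close>.
\<close>
datatype 'b word = Fin "'b list" | RInf "'b stream" | LInf "'b stream" | BiInf "int \<Rightarrow> 'b"

fun word_eq :: "'b word \<Rightarrow> 'b word \<Rightarrow> bool" where
  "word_eq (BiInf f) (BiInf g) \<longleftrightarrow> (\<exists>d. \<forall>i. g i = f (i + d))"
| "word_eq u w \<longleftrightarrow> u = w"

text \<open>Concatenation is partial: nothing can follow a right-infinite word, and nothing can
  precede a left-infinite one.\<close>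
fun wcat :: "'b word \<Rightarrow> 'b word \<Rightarrow> 'b word option" where
  "wcat (Fin u) (Fin w) = Some (Fin (u @ w))"
| "wcat (Fin u) (RInf s) = Some (RInf (u @- s))"
| "wcat (LInf s) (Fin w) = Some (LInf (rev w @- s))"
| "wcat (LInf s) (RInf r) =
     Some (BiInf (\<lambda>i. if i \<ge> 0 then r !! nat i else s !! nat (- i - 1)))"
| "wcat _ _ = None"

definition lsubword :: "'b word \<Rightarrow> 'b word \<Rightarrow> bool" (infix \<open>\<sqsubseteq>\<^sub>l\<close> 50) where
  "u \<sqsubseteq>\<^sub>l w \<longleftrightarrow> u = w \<or> (\<exists>z. wcat u z = Some w)"

definition rsubword :: "'b word \<Rightarrow> 'b word \<Rightarrow> bool" (infix \<open>\<sqsubseteq>\<^sub>r\<close> 50) where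
  "u \<sqsubseteq>\<^sub>r w \<longleftrightarrow> u = w \<or> (\<exists>z. wcat z u = Some w)"

definition finite_factor :: "'b list \<Rightarrow> 'b word \<Rightarrow> bool" where
  "finite_factor u w \<longleftrightarrow>
     (\<exists>x y xu xuy. wcat x (Fin u) = Some xu \<and> wcat xu y = Some xuy \<and> word_eq xuy w)"

definition linv_list :: "'a letter list \<Rightarrow> 'a letter list" where
  "linv_list w = rev (map linv w)"

fun winv :: "'a letter word \<Rightarrow> 'a letter word" where
  "winv (Fin w) = Fin (linv_list w)"
| "winv (RInf s) = LInf (smap linv s)"
| "winv (LInf s) = RInf (smap linv s)"
| "winv (BiInf f) = BiInf (\<lambda>i. linv (f (- i)))"


section \<open>String algebras and strings\<close>

text \<open>Quivers are the directed multigraphs of the library: \<open>verts Q\<close>, \<open>arcs Q\<close>,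
  \<open>tail Q\<close> and \<open>head Q\<close> are \<open>Q\<^sub>0\<close>, \<open>Q\<^sub>1\<close>, source and target, and paths are arc walks.\<close>

locale string_algebra = fin_digraph Q
  for Q :: "('v, 'a) pre_digraph" +
  fixes \<rho> :: "'a list set"
  assumes finite_relations: "finite \<rho>"
    and relations: "r \<in> \<rho> \<Longrightarrow> (\<exists>u v. awalk u r v) \<and> length r \<ge> 2"
    and out_le_2: "v \<in> verts Q \<Longrightarrow> card {\<alpha> \<in> arcs Q. tail Q \<alpha> = v} \<le> 2"
    and in_le_2: "v \<in> verts Q \<Longrightarrow> card {\<alpha> \<in> arcs Q. head Q \<alpha> = v} \<le> 2"
    and next_le_1: "\<alpha> \<in> arcs Q \<Longrightarrow>
      card {\<gamma> \<in> arcs Q. head Q \<alpha> = tail Q \<gamma> \<and> [\<alpha>, \<gamma>] \<notin> \<rho>} \<le> 1"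
    and prev_le_1: "\<alpha> \<in> arcs Q \<Longrightarrow>
      card {\<gamma> \<in> arcs Q. head Q \<gamma> = tail Q \<alpha> \<and> [\<gamma>, \<alpha>] \<notin> \<rho>} \<le> 1"
    and bounded_paths:
      "\<exists>N. \<forall>u p v. awalk u p v \<and> (\<forall>r\<in>\<rho>. \<not> sublist r p) \<longrightarrow> length p \<le> N"

locale signed_string_algebra = string_algebra Q \<rho>
  for Q :: "('v, 'a) pre_digraph" and \<rho> :: "'a list set" +
  fixes \<sigma> \<epsilon> :: "'a \<Rightarrow> int"
  assumes sign_range: "\<alpha> \<in> arcs Q \<Longrightarrow> \<sigma> \<alpha> \<in> {- 1, 1} \<and> \<epsilon> \<alpha> \<in> {- 1, 1}"
    and sign_source: "\<lbrakk>\<alpha> \<in> arcs Q; \<beta> \<in> arcs Q; \<alpha> \<noteq> \<beta>; tail Q \<alpha> = tail Q \<beta>\<rbrakk>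
      \<Longrightarrow> \<sigma> \<alpha> = - \<sigma> \<beta>"
    and sign_target: "\<lbrakk>\<alpha> \<in> arcs Q; \<beta> \<in> arcs Q; \<alpha> \<noteq> \<beta>; head Q \<alpha> = head Q \<beta>\<rbrakk>
      \<Longrightarrow> \<epsilon> \<alpha> = - \<epsilon> \<beta>"
    and sign_path: "\<lbrakk>\<alpha> \<in> arcs Q; \<beta> \<in> arcs Q; head Q \<alpha> = tail Q \<beta>; [\<alpha>, \<beta>] \<notin> \<rho>\<rbrakk>
      \<Longrightarrow> \<epsilon> \<alpha> = - \<sigma> \<beta>"

fun src :: "('v, 'a) pre_digraph \<Rightarrow> 'a letter \<Rightarrow> 'v" where
  "src Q (Dir \<alpha>) = tail Q \<alpha>"
| "src Q (Inv \<alpha>) = head Q \<alpha>"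

fun tgt :: "('v, 'a) pre_digraph \<Rightarrow> 'a letter \<Rightarrow> 'v" where
  "tgt Q (Dir \<alpha>) = head Q \<alpha>"
| "tgt Q (Inv \<alpha>) = tail Q \<alpha>"

fun ssign :: "('a \<Rightarrow> int) \<Rightarrow> ('a \<Rightarrow> int) \<Rightarrow> 'a letter \<Rightarrow> int" where
  "ssign \<sigma> \<epsilon> (Dir \<alpha>) = \<sigma> \<alpha>"
| "ssign \<sigma> \<epsilon> (Inv \<alpha>) = \<epsilon> \<alpha>"

fun tsign :: "('a \<Rightarrow> int) \<Rightarrow> ('a \<Rightarrow> int) \<Rightarrow> 'a letter \<Rightarrow> int" where
  "tsign \<sigma> \<epsilon> (Dir \<alpha>) = \<epsilon> \<alpha>"
| "tsign \<sigma> \<epsilon> (Inv \<alpha>) = \<sigma> \<alpha>"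

definition syllables :: "('v, 'a) pre_digraph \<Rightarrow> 'a letter set" where
  "syllables Q = letters_over (arcs Q)"

text \<open>\<open>Triv v i\<close> is the zero-length string \<open>1\<^bsub>(v,i)\<^esub>\<close>; a string of positive or infinite length
  is given by its word of syllables.\<close>
datatype ('v, 'a) string = Triv 'v int | Syl "'a letter word"

definition finite_string :: "('v, 'a) pre_digraph \<Rightarrow> 'a list set \<Rightarrow> 'a letter list \<Rightarrow> bool" where
  "finite_string Q \<rho> w \<longleftrightarrow>
     w \<noteq> [] \<and> set w \<subseteq> syllables Q \<and>
     (\<forall>i. Suc i < length w \<longrightarrow>
        tgt Q (w ! i) = src Q (w ! Suc i) \<and> w ! i \<noteq> linv (w ! Suc i)) \<and>
     (\<forall>u. sublist u w \<longrightarrow> u \<notin> map Dir ` \<rho> \<and> linv_list u \<notin> map Dir ` \<rho>)"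

definition triv_strings :: "('v, 'a) pre_digraph \<Rightarrow> ('v, 'a) string set" where
  "triv_strings Q = {Triv v i | v i. v \<in> verts Q \<and> i \<in> {- 1, 1}}"

definition strings :: "('v, 'a) pre_digraph \<Rightarrow> 'a list set \<Rightarrow> ('v, 'a) string set" where
  "strings Q \<rho> =
     triv_strings Q \<union> {Syl (Fin w) | w. finite_string Q \<rho> w} \<union>
     {Syl w | w. (\<nexists>u. w = Fin u) \<and>
        (\<forall>u. u \<noteq> [] \<and> finite_factor u w \<longrightarrow> finite_string Q \<rho> u)}"

definition band :: "('v, 'a) pre_digraph \<Rightarrow> 'a list set \<Rightarrow> 'a letter list \<Rightarrow> bool" where
  "band Q \<rho> b \<longleftrightarrow>
     finite_string Q \<rho> b \<and> src Q (hd b) = tgt Q (last b) \<and>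
     (\<nexists>u m. m \<ge> 2 \<and> b = concat (replicate m u)) \<and>
     (\<forall>m\<ge>1. finite_string Q \<rho> (concat (replicate m b))) \<and>
     \<not> is_Dir (hd b) \<and> is_Dir (last b)"

definition bi_power :: "'b list \<Rightarrow> 'b word" where
  "bi_power b = BiInf (\<lambda>i. b ! nat (i mod int (length b)))"


section \<open>Representations, bricks and band modules\<close>

definition linear_map_on :: "('k \<Rightarrow> 'm \<Rightarrow> 'm) \<Rightarrow> 'm set \<Rightarrow> 'm set \<Rightarrow> ('m::plus \<Rightarrow> 'm) \<Rightarrow> bool" where
  "linear_map_on scale U V f \<longleftrightarrow>
     f \<in> U \<rightarrow> V \<and> (\<forall>x\<in>U. \<forall>y\<in>U. f (x + y) = f x + f y) \<and>
     (\<forall>c. \<forall>x\<in>U. f (scale c x) = scale c (f x))"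

text \<open>The vector spaces of a representation are subspaces of one ambient vector space
  \<open>'m\<close> with scalar multiplication \<open>scale\<close>.\<close>
record ('v, 'a, 'm) quiver_rep =
  space :: "'v \<Rightarrow> 'm set"
  act :: "'a \<Rightarrow> 'm \<Rightarrow> 'm"

text \<open>A path \<open>\<alpha>\<beta>\<close> has \<open>t(\<alpha>) = s(\<beta>)\<close>, so \<open>\<alpha>\<close> acts first.\<close>
definition is_quiver_rep ::
  "('k::field \<Rightarrow> 'm::ab_group_add \<Rightarrow> 'm) \<Rightarrow> ('v, 'a) pre_digraph \<Rightarrow> 'a list set \<Rightarrow>
   ('v, 'a, 'm) quiver_rep \<Rightarrow> bool" where
  "is_quiver_rep scale Q \<rho> M \<longleftrightarrow>
     vector_space scale \<and>
     (\<forall>v\<in>verts Q. Modules.module.subspace scale (space M v)) \<and>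
     (\<forall>\<alpha>\<in>arcs Q. linear_map_on scale (space M (tail Q \<alpha>)) (space M (head Q \<alpha>)) (act M \<alpha>)) \<and>
     (\<forall>r\<in>\<rho>. \<forall>x\<in>space M (tail Q (hd r)). fold (act M) r x = 0)"

text \<open>Endomorphisms are extensional families of maps, so that they are determined by their
  values on the spaces of the representation.\<close>
definition rep_endos ::
  "('k \<Rightarrow> 'm::ab_group_add \<Rightarrow> 'm) \<Rightarrow> ('v, 'a) pre_digraph \<Rightarrow> ('v, 'a, 'm) quiver_rep \<Rightarrow>
   ('v \<Rightarrow> 'm \<Rightarrow> 'm) set" where
  "rep_endos scale Q M =
     {f \<in> (\<Pi>\<^sub>E v\<in>verts Q. space M v \<rightarrow>\<^sub>E space M v).
        (\<forall>v\<in>verts Q. linear_map_on scale (space M v) (space M v) (f v)) \<and>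
        (\<forall>\<alpha>\<in>arcs Q. \<forall>x\<in>space M (tail Q \<alpha>).
           f (head Q \<alpha>) (act M \<alpha> x) = act M \<alpha> (f (tail Q \<alpha>) x))}"

definition end_algebra ::
  "('k \<Rightarrow> 'm::ab_group_add \<Rightarrow> 'm) \<Rightarrow> ('v, 'a) pre_digraph \<Rightarrow> ('v, 'a, 'm) quiver_rep \<Rightarrow>
   ('k, 'v \<Rightarrow> 'm \<Rightarrow> 'm) module" where
  "end_algebra scale Q M =
     \<lparr>carrier = rep_endos scale Q M,
      mult = (\<lambda>f g. \<lambda>v\<in>verts Q. \<lambda>x\<in>space M v. f v (g v x)),
      one = (\<lambda>v\<in>verts Q. \<lambda>x\<in>space M v. x),
      zero = (\<lambda>v\<in>verts Q. \<lambda>x\<in>space M v. 0),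
      add = (\<lambda>f g. \<lambda>v\<in>verts Q. \<lambda>x\<in>space M v. f v x + g v x),
      smult = (\<lambda>c f. \<lambda>v\<in>verts Q. \<lambda>x\<in>space M v. scale c (f v x))\<rparr>"

definition brick ::
  "('k::field \<Rightarrow> 'm::ab_group_add \<Rightarrow> 'm) \<Rightarrow> ('v, 'a) pre_digraph \<Rightarrow> 'a list set \<Rightarrow>
   ('v, 'a, 'm) quiver_rep \<Rightarrow> bool" where
  "brick scale Q \<rho> M \<longleftrightarrow>
     is_quiver_rep scale Q \<rho> M \<and>
     (\<exists>\<phi> \<in> ring_iso class_ring (end_algebra scale Q M).
        \<forall>c d. \<phi> (c * d) = c \<odot>\<^bsub>end_algebra scale Q M\<^esub> \<phi> d)"

text \<open>
  With \<open>k = length b\<close>, elements of \<open>\<Oplus>\<^bsub>i\<^esub> V\<^bsub>i\<^esub>\<close> are families \<open>x\<close> whose entry \<open>x i j\<close>, for \<open>i < k\<close>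
  and \<open>j < n\<close>, is the \<open>j\<close>-th coordinate in \<open>V\<^bsub>i\<^esub>\<close>.  Syllables are numbered from \<open>0\<close>, so that
  the syllable \<open>b ! i\<close> joins \<open>V\<^bsub>(i - 1) mod k\<^esub>\<close> to \<open>V\<^bsub>i\<^esub>\<close>, and \<open>V\<^bsub>i\<^esub>\<close> lies at the target of \<open>b ! i\<close>.
\<close>
definition band_scale :: "'k::field \<Rightarrow> (nat \<Rightarrow> nat \<Rightarrow> 'k) \<Rightarrow> nat \<Rightarrow> nat \<Rightarrow> 'k" where
  "band_scale c x = (\<lambda>i j. c * x i j)"

text \<open>The two summands of \<open>act\<close> are the contributions to \<open>V\<^bsub>i\<^esub>\<close> of the syllable \<open>b ! i\<close>, if it is
  direct, and of the syllable after it, if that one is inverse.\<close>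
definition band_module ::
  "('v, 'a) pre_digraph \<Rightarrow> 'a letter list \<Rightarrow> nat \<Rightarrow> 'k::field \<Rightarrow>
   ('v, 'a, nat \<Rightarrow> nat \<Rightarrow> 'k) quiver_rep" where
  "band_module Q b n c =
     (let k = length b; prv = (\<lambda>i. (i + k - 1) mod k); nxt = (\<lambda>i. (i + 1) mod k) in
      \<lparr>space = (\<lambda>v. {x. \<forall>i j. x i j \<noteq> 0 \<longrightarrow> i < k \<and> j < n \<and> tgt Q (b ! i) = v}),
       act = (\<lambda>\<beta> x i j.
         if i < k \<and> j < n then
           (if b ! i = Dir \<beta> then
              (if i = k - 1 then \<Sum>l<n. jordan_block n c $$ (j, l) * x (prv i) l
               else x (prv i) j)
            else 0) +
           (if b ! nxt i = Inv \<beta> then x (nxt i) j else 0)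
         else 0)\<rparr>)"


section \<open>Multi-entry inverse automata\<close>

record ('q, 'b) mia =
  states :: "'q set"
  initial :: "'q set"
  entry :: "'q \<Rightarrow> 'q"
  iinv :: "'q \<Rightarrow> 'q"
  alphabet :: "'b set"
  trans :: "'q \<Rightarrow> 'b letter \<Rightarrow> 'q option"

locale mia =
  fixes M :: "('q, 'b) mia"
  assumes finite_states: "finite (states M)"
    and initial_states: "initial M \<subseteq> states M"
    and entry_closed: "q \<in> states M \<Longrightarrow> entry M q \<in> initial M"
    and iinv_closed: "v \<in> initial M \<Longrightarrow> iinv M v \<in> initial M"
    and finite_alphabet: "finite (alphabet M)"
    and trans_closed: "trans M q c = Some q' \<Longrightarrow>
      q \<in> states M \<and> c \<in> letters_over (alphabet M) \<and> q' \<in> states M"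
    and iinv_involution: "v \<in> initial M \<Longrightarrow> iinv M (iinv M v) = v \<and> iinv M v \<noteq> v"
    and entry_initial: "v \<in> initial M \<Longrightarrow> entry M v = v"
    and trans_entry: "trans M q c = Some q' \<Longrightarrow>
      \<exists>q''. trans M (entry M q) c = Some q'' \<and> entry M q' = entry M q''"

definition run :: "('q, 'b) mia \<Rightarrow> 'q \<Rightarrow> 'b letter list \<Rightarrow> 'q option" where
  "run M v w = foldl (\<lambda>q c. Option.bind q (\<lambda>q. trans M q c)) (Some v) w"

definition right_word :: "('q, 'b) mia \<Rightarrow> 'q \<Rightarrow> 'b letter word \<Rightarrow> bool" where
  "right_word M v w \<longleftrightarrow>
     v \<in> initial M \<and> ((\<exists>u. w = Fin u) \<or> (\<exists>s. w = RInf s)) \<and>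
     (\<forall>u. Fin u \<sqsubseteq>\<^sub>l w \<longrightarrow> run M v u \<noteq> None)"

definition left_word :: "('q, 'b) mia \<Rightarrow> 'b letter word \<Rightarrow> 'q \<Rightarrow> bool" where
  "left_word M w v \<longleftrightarrow> right_word M (iinv M v) (winv w)"

type_synonym ('q, 'b) mia_word = "'b letter word \<times> 'q \<times> 'b letter word"

definition mia_words :: "('q, 'b) mia \<Rightarrow> ('q, 'b) mia_word set" where
  "mia_words M =
     {(wl, v, wr). v \<in> initial M \<and> left_word M wl v \<and> right_word M v wr \<and>
        (\<forall>u. Fin u \<sqsubseteq>\<^sub>l wr \<longrightarrow>
           (\<exists>q wlu. run M v u = Some q \<and> wcat wl (Fin u) = Some wlu \<and>
              left_word M wlu (entry M q)))}"

fun finite_mia_word :: "('q, 'b) mia_word \<Rightarrow> bool" where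
  "finite_mia_word (wl, v, wr) \<longleftrightarrow> (\<exists>u. wl = Fin u) \<and> (\<exists>u. wr = Fin u)"

fun mia_word_inv :: "('q, 'b) mia \<Rightarrow> ('q, 'b) mia_word \<Rightarrow> ('q, 'b) mia_word" where
  "mia_word_inv M (wl, v, wr) = (winv wr, iinv M v, winv wl)"

fun slide :: "('q, 'b) mia \<Rightarrow> ('q, 'b) mia_word \<Rightarrow> ('q, 'b) mia_word \<Rightarrow> bool" where
  "slide M (wl1, v1, wr1) (wl2, v2, wr2) \<longleftrightarrow>
     (\<exists>u. wcat wl2 (Fin u) = Some wl1 \<and> wcat (Fin u) wr1 = Some wr2 \<and>
        map_option (entry M) (run M v2 u) = Some v1)"

definition mia_sim :: "('q, 'b) mia \<Rightarrow> ('q, 'b) mia_word \<Rightarrow> ('q, 'b) mia_word \<Rightarrow> bool" where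
  "mia_sim M x y \<longleftrightarrow> x \<in> mia_words M \<and> y \<in> mia_words M \<and> (slide M x y \<or> slide M y x)"

text \<open>\<open>aligned M x z y\<close>: the word \<open>z \<sim> y\<close> witnesses that \<open>x\<close> is a subword of \<open>y\<close>.\<close>
definition aligned ::
  "('q, 'b) mia \<Rightarrow> ('q, 'b) mia_word \<Rightarrow> ('q, 'b) mia_word \<Rightarrow> ('q, 'b) mia_word \<Rightarrow> bool" where
  "aligned M x z y \<longleftrightarrow>
     x \<in> mia_words M \<and> mia_sim M z y \<and> fst (snd z) = fst (snd x) \<and>
     fst x \<sqsubseteq>\<^sub>r fst z \<and> snd (snd x) \<sqsubseteq>\<^sub>l snd (snd z)"

definition subword :: "('q, 'b) mia \<Rightarrow> ('q, 'b) mia_word \<Rightarrow> ('q, 'b) mia_word \<Rightarrow> bool" where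
  "subword M x y \<longleftrightarrow> (\<exists>z. aligned M x z y)"

definition proper_subword :: "('q, 'b) mia \<Rightarrow> ('q, 'b) mia_word \<Rightarrow> ('q, 'b) mia_word \<Rightarrow> bool" where
  "proper_subword M x y \<longleftrightarrow> subword M x y \<and> \<not> mia_sim M x y"

definition continued_by :: "'b word \<Rightarrow> 'b \<Rightarrow> 'b word \<Rightarrow> bool" where
  "continued_by u c w \<longleftrightarrow> (\<exists>uc. wcat u (Fin [c]) = Some uc \<and> uc \<sqsubseteq>\<^sub>l w)"

definition preceded_by :: "'b \<Rightarrow> 'b word \<Rightarrow> 'b word \<Rightarrow> bool" where
  "preceded_by c u w \<longleftrightarrow> (\<exists>cu. wcat (Fin [c]) u = Some cu \<and> cu \<sqsubseteq>\<^sub>r w)"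

definition factor_subword ::
  "('q, 'b) mia \<Rightarrow> ('q, 'b) mia_word \<Rightarrow> ('q, 'b) mia_word \<Rightarrow> bool" where
  "factor_subword M x y \<longleftrightarrow>
     (\<exists>xl v xr zl zr. x = (xl, v, xr) \<and> aligned M x (zl, v, zr) y \<and>
        (x = (zl, v, zr) \<or>
         xl = zl \<and> (\<exists>a\<in>alphabet M. continued_by xr (Dir a) zr) \<or>
         xr = zr \<and> (\<exists>a\<in>alphabet M. preceded_by (Inv a) xl zl) \<or>
         (\<exists>a\<in>alphabet M. preceded_by (Inv a) xl zl) \<and>
         (\<exists>a\<in>alphabet M. continued_by xr (Dir a) zr)))"

definition image_subword ::
  "('q, 'b) mia \<Rightarrow> ('q, 'b) mia_word \<Rightarrow> ('q, 'b) mia_word \<Rightarrow> bool" where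
  "image_subword M x y \<longleftrightarrow>
     (\<exists>xl v xr zl zr. x = (xl, v, xr) \<and> aligned M x (zl, v, zr) y \<and>
        (x = (zl, v, zr) \<or>
         xl = zl \<and> (\<exists>a\<in>alphabet M. continued_by xr (Inv a) zr) \<or>
         xr = zr \<and> (\<exists>a\<in>alphabet M. preceded_by (Dir a) xl zl) \<or>
         (\<exists>a\<in>alphabet M. preceded_by (Dir a) xl zl) \<and>
         (\<exists>a\<in>alphabet M. continued_by xr (Inv a) zr)))"

definition weak_brick_word :: "('q, 'b) mia \<Rightarrow> ('q, 'b) mia_word \<Rightarrow> bool" where
  "weak_brick_word M w \<longleftrightarrow>
     w \<in> mia_words M \<and>
     \<not> (\<exists>x u. x \<in> mia_words M \<and> finite_mia_word x \<and> u \<in> {w, mia_word_inv M w} \<and>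
          factor_subword M x w \<and> image_subword M x u \<and>
          (proper_subword M x w \<or> proper_subword M x u))"


section \<open>The automata of a string algebra\<close>

definition string_states :: "('v, 'a) pre_digraph \<Rightarrow> 'a list set \<Rightarrow> ('v, 'a) string set" where
  "string_states Q \<rho> =
     triv_strings Q \<union> {Syl (Fin [c]) | c. c \<in> syllables Q} \<union>
     {Syl (Fin y) | y. finite_string Q \<rho> y \<and>
        (\<exists>r\<in>\<rho>. strict_prefix y (map Dir r) \<or> strict_prefix y (linv_list (map Dir r)))}"

text \<open>The composite of a finite string and a syllable, where it is defined as a word.\<close>
fun string_snoc ::
  "('v, 'a) pre_digraph \<Rightarrow> ('a \<Rightarrow> int) \<Rightarrow> ('a \<Rightarrow> int) \<Rightarrow> ('v, 'a) string \<Rightarrow> 'a letter \<Rightarrow>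
   'a letter list option" where
  "string_snoc Q \<sigma> \<epsilon> (Triv v i) c =
     (if src Q c = v \<and> ssign \<sigma> \<epsilon> c = - i then Some [c] else None)"
| "string_snoc Q \<sigma> \<epsilon> (Syl (Fin w)) c = Some (w @ [c])"
| "string_snoc Q \<sigma> \<epsilon> _ c = None"

fun triv_inv :: "('v, 'a) string \<Rightarrow> ('v, 'a) string" where
  "triv_inv (Triv v i) = Triv v (- i)"
| "triv_inv x = x"

fun end_triv ::
  "('v, 'a) pre_digraph \<Rightarrow> ('a \<Rightarrow> int) \<Rightarrow> ('a \<Rightarrow> int) \<Rightarrow> ('v, 'a) string \<Rightarrow> ('v, 'a) string" where
  "end_triv Q \<sigma> \<epsilon> (Triv v i) = Triv v i"
| "end_triv Q \<sigma> \<epsilon> (Syl (Fin w)) = Triv (tgt Q (last w)) (tsign \<sigma> \<epsilon> (last w))"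
| "end_triv Q \<sigma> \<epsilon> x = x"

definition string_trans ::
  "('v, 'a) pre_digraph \<Rightarrow> 'a list set \<Rightarrow> ('a \<Rightarrow> int) \<Rightarrow> ('a \<Rightarrow> int) \<Rightarrow>
   ('v, 'a) string \<Rightarrow> 'a letter \<Rightarrow> ('v, 'a) string option" where
  "string_trans Q \<rho> \<sigma> \<epsilon> x c =
     (case string_snoc Q \<sigma> \<epsilon> x c of
        None \<Rightarrow> None
      | Some w \<Rightarrow>
          if x \<in> string_states Q \<rho> \<and> Syl (Fin w) \<in> (strings Q \<rho> :: ('v, 'a) string set)
          then Some (Syl (Fin (ARG_MAX length u.
                 suffix u w \<and> Syl (Fin u) \<in> (string_states Q \<rho> :: ('v, 'a) string set))))
          else None)"

definition mia_string ::
  "('v, 'a) pre_digraph \<Rightarrow> 'a list set \<Rightarrow> ('a \<Rightarrow> int) \<Rightarrow> ('a \<Rightarrow> int) \<Rightarrow>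
   (('v, 'a) string, 'a) mia" where
  "mia_string Q \<rho> \<sigma> \<epsilon> =
     \<lparr>states = string_states Q \<rho>, initial = triv_strings Q, entry = end_triv Q \<sigma> \<epsilon>,
      iinv = triv_inv, alphabet = arcs Q, trans = string_trans Q \<rho> \<sigma> \<epsilon>\<rparr>"

text \<open>Relabelling along \<open>\<delta>\<close>; meaningful if the induced map \<open>\<delta>\<^sup>\<plusminus>\<close> is injective on the letters
  that can be read at each state.\<close>
definition mia_relabel :: "('a \<Rightarrow> 'b) \<Rightarrow> ('q, 'a) mia \<Rightarrow> 'b set \<Rightarrow> ('q, 'b) mia" where
  "mia_relabel \<delta> M B =
     \<lparr>states = states M, initial = initial M, entry = entry M, iinv = iinv M, alphabet = B,
      trans = (\<lambda>q d.
        if \<exists>c. map_letter \<delta> c = d \<and> trans M q c \<noteq> None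
        then trans M q (THE c. map_letter \<delta> c = d \<and> trans M q c \<noteq> None) else None)\<rparr>"

text \<open>\<open>\<M>\<^bsub>\<Lambda>\<delta>\<^esub>\<close>: the letter \<open>0\<close> is \<open>Dir 0\<close>, and \<open>1\<close> stands for \<open>0\<^sup>-\<^sup>1\<close>, that is \<open>Inv 0\<close>.\<close>
definition mia_string_delta ::
  "('v, 'a) pre_digraph \<Rightarrow> 'a list set \<Rightarrow> ('a \<Rightarrow> int) \<Rightarrow> ('a \<Rightarrow> int) \<Rightarrow>
   (('v, 'a) string, nat) mia" where
  "mia_string_delta Q \<rho> \<sigma> \<epsilon> = mia_relabel (\<lambda>_. 0) (mia_string Q \<rho> \<sigma> \<epsilon>) {0}"

fun relabel_word :: "('a \<Rightarrow> 'b) \<Rightarrow> ('q, 'a) mia_word \<Rightarrow> ('q, 'b) mia_word" where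
  "relabel_word \<delta> (wl, v, wr) =
     (map_word (map_letter \<delta>) wl, v, map_word (map_letter \<delta>) wr)"

definition Phi :: "(('v, 'a) string, 'a) mia_word \<Rightarrow> (('v, 'a) string, nat) mia_word" where
  "Phi = relabel_word (\<lambda>_. 0)"

fun reads_as :: "('q, 'a) mia_word \<Rightarrow> 'a letter word \<Rightarrow> bool" where
  "reads_as (wl, v, wr) x \<longleftrightarrow> (\<exists>y. wcat wl wr = Some y \<and> word_eq y x)"

fun word_class ::
  "('v, 'a) pre_digraph \<Rightarrow> 'a list set \<Rightarrow> ('a \<Rightarrow> int) \<Rightarrow> ('a \<Rightarrow> int) \<Rightarrow>
   ('v, 'a) string \<Rightarrow> (('v, 'a) string, 'a) mia_word set" where
  "word_class Q \<rho> \<sigma> \<epsilon> (Triv u i) =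
     {w. mia_sim (mia_string Q \<rho> \<sigma> \<epsilon>) w (Fin [], Triv u i, Fin [])}"
| "word_class Q \<rho> \<sigma> \<epsilon> (Syl x) =
     {w. \<exists>z \<in> mia_words (mia_string Q \<rho> \<sigma> \<epsilon>).
        reads_as z x \<and> mia_sim (mia_string Q \<rho> \<sigma> \<epsilon>) w z}"

section \<open>Well-definedness of the constructions\<close>

lemma vector_space_band_scale: "vector_space (band_scale :: 'k::field \<Rightarrow> _)"
  by unfold_locales (auto simp: band_scale_def fun_eq_iff algebra_simps)

lemma window_sublist:
  assumes "b \<noteq> []"
  shows "\<exists>m\<ge>1. sublist (map (\<lambda>i. b ! nat ((z + int i) mod int (length b))) [0..<l])
    (concat (replicate m b))"
proof -
  let ?k = "length b"
  define s where "s = nat (z mod int ?k)"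
  have k: "0 < ?k" using assms by simp
  have nth_power: "concat (replicate m b) ! i = b ! (i mod ?k)" if "i < m * ?k" for m i
    using that
  proof (induction m arbitrary: i)
    case (Suc m)
    then show ?case
      by (cases "i < ?k") (auto simp: nth_append le_mod_geq)
  qed simp
  have len: "length (concat (replicate m b)) = m * ?k" for m
    by (induction m) auto
  have idx: "nat ((z + int i) mod int ?k) = (s + i) mod ?k" for i
  proof -
    have "int s = z mod int ?k" using k by (simp add: s_def)
    then have "int ((s + i) mod ?k) = (z + int i) mod int ?k"
      by (simp add: of_nat_mod mod_add_left_eq)
    then show ?thesis by (metis nat_int)
  qed
  have bound: "s + l \<le> Suc (s + l) * ?k"
    using mult_le_mono[of "s + l" "Suc (s + l)" 1 ?k] k by simp
  have "map (\<lambda>i. b ! nat ((z + int i) mod int ?k)) [0..<l]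
      = take l (drop s (concat (replicate (Suc (s + l)) b)))"
    using bound
    by (intro nth_equalityI) (auto simp: len idx nth_power simp del: replicate_Suc)
  then have "sublist (map (\<lambda>i. b ! nat ((z + int i) mod int ?k)) [0..<l])
      (concat (replicate (Suc (s + l)) b))"
    unfolding sublist_def by (metis append_take_drop_id)
  then show ?thesis by (intro exI[of _ "Suc (s + l)"]) simp
qed

context string_algebra
begin

lemma band_module_is_quiver_rep:
  fixes c :: "'k::field"
  assumes band: "band Q \<rho> b"
  shows "is_quiver_rep band_scale Q \<rho> (band_module Q b n c)"
proof -
  define k where "k = length b"
  define L where "L z = b ! nat (z mod int k)" for z :: int
  let ?M = "band_module Q b n c"
  have b: "b \<noteq> []" and bQ: "set b \<subseteq> syllables Q"
    using band by (auto simp: band_def finite_string_def)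
  then have k: "0 < k" by (simp add: k_def)
  have win: "finite_string Q \<rho> (concat (replicate m b))" if "m \<ge> 1" for m
    using band that by (auto simp: band_def)
  have L_sub: "\<exists>w. finite_string Q \<rho> w \<and> sublist (map (\<lambda>i. L (z + int i)) [0..<l]) w" for z l
    using window_sublist[OF b, of z l] win unfolding L_def k_def by blast
  have L_run: "map (\<lambda>i. L (z + int i)) [0..<l] \<notin> map Dir ` \<rho>"
     "linv_list (map (\<lambda>i. L (z + int i)) [0..<l]) \<notin> map Dir ` \<rho>" for z l
    using L_sub[of z l] unfolding finite_string_def by blast+
  have L_step: "tgt Q (L z) = src Q (L (z + 1)) \<and> L z \<noteq> linv (L (z + 1))" for z
  proof -
    obtain w where w: "finite_string Q \<rho> w" "sublist [L z, L (z + 1)] w"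
      using L_sub[of z 2] by (auto simp: numeral_2_eq_2)
    then obtain x y where "w = x @ [L z, L (z + 1)] @ y" by (auto simp: sublist_def)
    with w(1) show ?thesis
      unfolding finite_string_def by (auto dest!: spec[of _ "length x"] simp: nth_append)
  qed
  have L_nat: "b ! i = L (int i)" if "i < k" for i
    using that by (simp add: L_def)
  have prv: "b ! ((i + k - 1) mod k) = L (int i - 1)" for i
  proof -
    have "int ((i + k - 1) mod k) = (int i - 1) mod int k"
      using k by (simp add: of_nat_mod of_nat_diff) (metis add.commute add_diff_eq mod_add_self1)
    then show ?thesis by (metis L_def nat_int)
  qed
  have nxt: "b ! ((i + 1) mod k) = L (int i + 1)" for i
    by (simp add: L_def nat_mod_distrib nat_add_distrib)
  have L_mod: "L z = L z'" if "z mod int k = z' mod int k" for z z'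
    using that by (simp add: L_def)
  have act_support: "(i < k \<and> j < n) \<and>
     (L (int i) = Dir \<beta> \<and> (\<exists>l. x ((i + k - 1) mod k) l \<noteq> 0) \<or>
      L (int i + 1) = Inv \<beta> \<and> x ((i + 1) mod k) j \<noteq> 0)"
    if "act ?M \<beta> x i j \<noteq> 0" for \<beta> x i j
  proof -
    define p where "p = (i + k - 1) mod k"
    define q where "q = (i + 1) mod k"
    have eq: "act ?M \<beta> x i j = (if i < k \<and> j < n then
        (if b ! i = Dir \<beta> then
           (if i = k - 1 then \<Sum>l<n. jordan_block n c $$ (j, l) * x p l else x p j) else 0) +
        (if b ! q = Inv \<beta> then x q j else 0) else 0)"
      by (simp only: band_module_def Let_def k_def p_def q_def quiver_rep.select_convs)
    have "i < k \<and> j < n" using that unfolding eq by presburger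
    moreover have "b ! q = Inv \<beta> \<and> x q j \<noteq> 0 \<or> b ! i = Dir \<beta> \<and> (\<exists>l. x p l \<noteq> 0)"
    proof (rule ccontr)
      assume "\<not> ?thesis"
      then have "b ! q = Inv \<beta> \<longrightarrow> x q j = 0" "b ! i = Dir \<beta> \<longrightarrow> (\<forall>l. x p l = 0)" by blast+
      then have "act ?M \<beta> x i j = 0" unfolding eq by simp
      with that show False by simp
    qed
    ultimately show ?thesis
      using L_nat[of i] nxt[of i] unfolding p_def[symmetric] q_def[symmetric] by metis
  qed
  have act_add: "act ?M \<beta> (x + y) = act ?M \<beta> x + act ?M \<beta> y" for \<beta> x y
    by (auto simp: band_module_def Let_def fun_eq_iff algebra_simps sum.distrib)
  have act_scale: "act ?M \<beta> (band_scale d x) = band_scale d (act ?M \<beta> x)" for \<beta> d x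
    by (auto simp: band_module_def Let_def band_scale_def fun_eq_iff algebra_simps sum_distrib_left)
  have space: "x \<in> space ?M v \<longleftrightarrow> (\<forall>i j. x i j \<noteq> 0 \<longrightarrow> i < k \<and> j < n \<and> tgt Q (L (int i)) = v)" for x v
  proof -
    have "x \<in> space ?M v \<longleftrightarrow> (\<forall>i j. x i j \<noteq> 0 \<longrightarrow> i < k \<and> j < n \<and> tgt Q (b ! i) = v)"
      by (simp add: band_module_def Let_def k_def)
    then show ?thesis using L_nat by metis
  qed
  have act_space: "act ?M \<beta> x \<in> space ?M (head Q \<beta>)" if "x \<in> space ?M (tail Q \<beta>)" for \<beta> x
    unfolding space
  proof (intro allI impI)
    fix i j assume "act ?M \<beta> x i j \<noteq> 0"
    from act_support[OF this] L_step[of "int i"]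
    show "i < k \<and> j < n \<and> tgt Q (L (int i)) = head Q \<beta>" by auto
  qed
  have linear: "linear_map_on band_scale (space ?M (tail Q \<beta>)) (space ?M (head Q \<beta>)) (act ?M \<beta>)"
    for \<beta> using act_add act_scale act_space by (auto simp: linear_map_on_def)
  interpret V: vector_space "band_scale :: 'k \<Rightarrow> _" by (rule vector_space_band_scale)
  have subspace: "V.subspace (space ?M v)" for v
    by (rule V.subspaceI) (auto simp: space band_scale_def, (metis add.right_neutral)+)
  have runs: "\<exists>z. z mod int k = int i \<and>
       ((\<forall>m<length p. L (z - int m) = Dir (rev p ! m)) \<or>
        (\<forall>m<length p. L (z + 1 + int m) = Inv (rev p ! m)))"
    if "fold (act ?M) p x i j \<noteq> 0" "p \<noteq> []" for p x i j
    using that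
  proof (induction p arbitrary: i j rule: rev_induct)
    case (snoc a p)
    let ?y = "fold (act ?M) p x"
    have nz: "act ?M a ?y i j \<noteq> 0" using snoc.prems by simp
    note sup = act_support[OF nz]
    then have i: "i < k" by simp
    show ?case
    proof (cases "p = []")
      case True
      then show ?thesis using sup i by (intro exI[of _ "int i"]) auto
    next
      case False
      from sup consider
        (dir) l where "L (int i) = Dir a" "?y ((i + k - 1) mod k) l \<noteq> 0"
      | (inv) "L (int i + 1) = Inv a" "?y ((i + 1) mod k) j \<noteq> 0" by blast
      then show ?thesis
      proof cases
        case dir
        obtain z where z: "z mod int k = int ((i + k - 1) mod k)"
          "(\<forall>m<length p. L (z - int m) = Dir (rev p ! m)) \<or>
           (\<forall>m<length p. L (z + 1 + int m) = Inv (rev p ! m))"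
          using snoc.IH[OF dir(2) False] by blast
        have "z mod int k = (int i - 1) mod int k"
          using k z(1) by (simp add: of_nat_mod of_nat_diff) (metis add.commute add_diff_eq mod_add_self1)
        then have zi: "(z + 1) mod int k = int i mod int k"
          by (metis diff_add_cancel mod_add_left_eq)
        then have "L (z + 1) = Dir a" using dir(1) L_mod by metis
        moreover from this have "\<not> (\<forall>m<length p. L (z + 1 + int m) = Inv (rev p ! m))"
          using False by (auto dest!: spec[of _ 0])
        ultimately have "\<forall>m<length (p @ [a]). L (z + 1 - int m) = Dir (rev (p @ [a]) ! m)"
          using z(2) by (auto simp: nth_Cons split: nat.split) 
        then show ?thesis using zi i by (intro exI[of _ "z + 1"]) auto
      next
        case inv
        obtain z where z: "z mod int k = int ((i + 1) mod k)"
          "(\<forall>m<length p. L (z - int m) = Dir (rev p ! m)) \<or>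
           (\<forall>m<length p. L (z + 1 + int m) = Inv (rev p ! m))"
          using snoc.IH[OF inv(2) False] by blast
        have zi: "z mod int k = (int i + 1) mod int k"
          using z(1) by (simp add: of_nat_mod add.commute)
        then have "L z = Inv a" using inv(1) L_mod by metis
        moreover from this have "\<not> (\<forall>m<length p. L (z - int m) = Dir (rev p ! m))"
          using False by (auto dest!: spec[of _ 0])
        ultimately have "\<forall>m<length (p @ [a]). L (z - 1 + 1 + int m) = Inv (rev (p @ [a]) ! m)"
          using z(2) by (auto simp: nth_Cons algebra_simps split: nat.split)
        moreover have "(z - 1) mod int k = int i"
          using zi i by (metis add_diff_cancel_right' mod_diff_left_eq mod_pos_pos_trivial of_nat_0_le_iff of_nat_less_iff)
        ultimately show ?thesis by (intro exI[of _ "z - 1"]) auto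
      qed
    qed
  qed simp
  have "fold (act ?M) r x = 0" if r: "r \<in> \<rho>" for r x
  proof (rule ccontr)
    assume "fold (act ?M) r x \<noteq> 0"
    then obtain i j where nz: "fold (act ?M) r x i j \<noteq> 0" by (auto simp: fun_eq_iff)
    have "r \<noteq> []" using relations[OF r] by auto
    from runs[OF nz this] obtain z where
      "(\<forall>m<length r. L (z - int m) = Dir (rev r ! m)) \<or>
       (\<forall>m<length r. L (z + 1 + int m) = Inv (rev r ! m))" by blast
    then show False
    proof
      assume *: "\<forall>m<length r. L (z - int m) = Dir (rev r ! m)"
      have "map (\<lambda>m. L (z - int (length r) + 1 + int m)) [0..<length r] = map Dir r"
      proof (rule nth_equalityI)
        fix m assume "m < length (map (\<lambda>m. L (z - int (length r) + 1 + int m)) [0..<length r])"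
        then show "map (\<lambda>m. L (z - int (length r) + 1 + int m)) [0..<length r] ! m = map Dir r ! m"
          using *[rule_format, of "length r - Suc m"] by (auto simp: rev_nth of_nat_diff algebra_simps)
      qed simp
      with L_run(1)[of "z - int (length r) + 1" "length r"] r show False by auto
    next
      assume *: "\<forall>m<length r. L (z + 1 + int m) = Inv (rev r ! m)"
      have "map (\<lambda>m. L (z + 1 + int m)) [0..<length r] = map Inv (rev r)"
        using * by (intro nth_equalityI) auto
      then have "linv_list (map (\<lambda>m. L (z + 1 + int m)) [0..<length r]) = map Dir r"
        by (simp add: linv_list_def rev_map)
      with L_run(2)[of "z + 1" "length r"] r show False by auto
    qed
  qed
  with linear subspace vector_space_band_scale show ?thesis by (auto simp: is_quiver_rep_def)
qed

end

context signed_string_algebra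
begin

lemma syllable_ends:
  assumes "c \<in> syllables Q"
  shows "src Q c \<in> verts Q" "tgt Q c \<in> verts Q"
    "ssign \<sigma> \<epsilon> c \<in> {- 1, 1}" "tsign \<sigma> \<epsilon> c \<in> {- 1, 1}"
proof -
  obtain \<alpha> where "\<alpha> \<in> arcs Q" "c = Dir \<alpha> \<or> c = Inv \<alpha>"
    using assms by (auto simp: syllables_def letters_over_def)
  with sign_range[of \<alpha>] show "src Q c \<in> verts Q" "tgt Q c \<in> verts Q"
    "ssign \<sigma> \<epsilon> c \<in> {- 1, 1}" "tsign \<sigma> \<epsilon> c \<in> {- 1, 1}"
    by (auto simp del: insert_iff)
qed

lemma relation_length: "r \<in> \<rho> \<Longrightarrow> length r \<ge> 2"
  using relations by blast

lemma finite_string_syllable: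
  assumes "c \<in> syllables Q"
  shows "finite_string Q \<rho> [c]"
proof -
  have "u \<notin> map Dir ` \<rho> \<and> linv_list u \<notin> map Dir ` \<rho>" if "sublist u [c]" for u
  proof -
    have "length u \<le> 1" using sublist_length_le[OF that] by simp
    then show ?thesis
      using relation_length by (fastforce simp: linv_list_def dest: arg_cong[of _ _ length])
  qed
  with assms show ?thesis by (auto simp: finite_string_def)
qed

lemma in_strings_Fin [simp]: "Syl (Fin w) \<in> strings Q \<rho> \<longleftrightarrow> finite_string Q \<rho> w"
  by (auto simp: strings_def triv_strings_def)

lemma finite_string_snocD:
  assumes "finite_string Q \<rho> (w @ [c])" "w \<noteq> []"
  shows "src Q c = tgt Q (last w)" "ssign \<sigma> \<epsilon> c = - tsign \<sigma> \<epsilon> (last w)"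
proof -
  obtain w' d where w: "w = w' @ [d]" using assms(2) by (metis rev_exhaust)
  have syl: "c \<in> syllables Q" "d \<in> syllables Q"
    using assms w by (auto simp: finite_string_def)
  have dc: "tgt Q d = src Q c" "d \<noteq> linv c"
    using assms(1) unfolding finite_string_def w
    by (auto dest!: spec[of _ "length w'"] simp: nth_append)
  have "sublist [d, c] (w @ [c])"
    unfolding w by (metis append.assoc append_Cons append_Nil sublist_appendI append_Nil2)
  then have "[d, c] \<notin> map Dir ` \<rho>" "linv_list [d, c] \<notin> map Dir ` \<rho>"
    using assms(1) by (auto simp: finite_string_def)
  then have not_rel: "d = Dir \<alpha> \<and> c = Dir \<beta> \<Longrightarrow> [\<alpha>, \<beta>] \<notin> \<rho>"
    "d = Inv \<alpha> \<and> c = Inv \<beta> \<Longrightarrow> [\<beta>, \<alpha>] \<notin> \<rho>" for \<alpha> \<beta>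
    by (force simp: linv_list_def)+
  show "src Q c = tgt Q (last w)" using dc by (simp add: w)
  have arcs: "Dir \<alpha> \<in> syllables Q \<longleftrightarrow> \<alpha> \<in> arcs Q" "Inv \<alpha> \<in> syllables Q \<longleftrightarrow> \<alpha> \<in> arcs Q" for \<alpha>
    by (auto simp: syllables_def letters_over_def)
  have "ssign \<sigma> \<epsilon> c = - tsign \<sigma> \<epsilon> d"
  proof (cases d)
    case d: (Dir \<alpha>)
    show ?thesis
    proof (cases c)
      case (Dir \<beta>)
      then show ?thesis using d dc syl not_rel(1)[of \<alpha> \<beta>] sign_path[of \<alpha> \<beta>] by (simp add: arcs)
    next
      case (Inv \<beta>)
      then show ?thesis using d dc syl sign_target[of \<beta> \<alpha>] by (auto simp: arcs)
    qed
  next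
    case d: (Inv \<alpha>)
    show ?thesis
    proof (cases c)
      case (Dir \<beta>)
      then show ?thesis using d dc syl sign_source[of \<beta> \<alpha>] by (auto simp: arcs)
    next
      case (Inv \<beta>)
      then show ?thesis using d dc syl not_rel(2)[of \<alpha> \<beta>] sign_path[of \<beta> \<alpha>] by (simp add: arcs)
    qed
  qed
  then show "ssign \<sigma> \<epsilon> c = - tsign \<sigma> \<epsilon> (last w)" by (simp add: w)
qed

lemma state_cases:
  assumes "x \<in> string_states Q \<rho>"
  obtains (triv) v i where "x = Triv v i" "v \<in> verts Q" "i \<in> {- 1, 1}"
  | (syl) w where "x = Syl (Fin w)" "finite_string Q \<rho> w"
  using assms finite_string_syllable
  by (auto simp: string_states_def triv_strings_def)

lemma end_triv_state:
  assumes "x \<in> string_states Q \<rho>"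
  shows "end_triv Q \<sigma> \<epsilon> x \<in> triv_strings Q"
  using assms
proof (cases rule: state_cases)
  case (syl w)
  then have "last w \<in> syllables Q" by (auto simp: finite_string_def)
  with syl syllable_ends[OF this] show ?thesis by (auto simp: triv_strings_def)
qed (auto simp: triv_strings_def)

lemma finite_string_states: "finite (string_states Q \<rho>)"
proof -
  have "finite (syllables Q)" by (simp add: syllables_def letters_over_def)
  moreover have "triv_strings Q = (\<lambda>(v, i). Triv v i) ` (verts Q \<times> {- 1, 1})"
    by (auto simp: triv_strings_def)
  moreover have "{Syl (Fin y) | y. finite_string Q \<rho> y \<and>
        (\<exists>r\<in>\<rho>. strict_prefix y (map Dir r) \<or> strict_prefix y (linv_list (map Dir r)))}
     \<subseteq> (\<lambda>y. Syl (Fin y)) `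
        (\<Union>r\<in>\<rho>. set (prefixes (map Dir r)) \<union> set (prefixes (linv_list (map Dir r))))"
    by (fastforce simp: strict_prefix_def)
  then have "finite {Syl (Fin y) :: ('v, 'a) string | y. finite_string Q \<rho> y \<and>
        (\<exists>r\<in>\<rho>. strict_prefix y (map Dir r) \<or> strict_prefix y (linv_list (map Dir r)))}"
    by (rule finite_subset) (simp add: finite_relations)
  ultimately show ?thesis by (simp add: string_states_def setcompr_eq_image)
qed

lemma string_trans_Some:
  assumes "string_trans Q \<rho> \<sigma> \<epsilon> x c = Some y"
  shows "x \<in> string_states Q \<rho>" "c \<in> syllables Q" "y \<in> string_states Q \<rho>"
    "end_triv Q \<sigma> \<epsilon> x = Triv (src Q c) (- ssign \<sigma> \<epsilon> c)"
    "end_triv Q \<sigma> \<epsilon> y = Triv (tgt Q c) (tsign \<sigma> \<epsilon> c)"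
proof -
  obtain w where w: "string_snoc Q \<sigma> \<epsilon> x c = Some w" "x \<in> string_states Q \<rho>"
    "finite_string Q \<rho> w"
    and y: "y = Syl (Fin (ARG_MAX length u.
                 suffix u w \<and> Syl (Fin u) \<in> (string_states Q \<rho> :: ('v, 'a) string set)))"
    using assms by (auto simp: string_trans_def split: option.splits if_splits)
  have last: "w \<noteq> []" "last w = c"
    using w(1) by (auto elim!: string_snoc.elims split: if_splits)
  then have c: "c \<in> syllables Q" using w by (auto simp: finite_string_def)
  let ?P = "\<lambda>u. suffix u w \<and> Syl (Fin u) \<in> (string_states Q \<rho> :: ('v, 'a) string set)"
  have "?P [c]"
    using last c append_butlast_last_id[of w, symmetric]
    by (auto simp: string_states_def suffix_def)
  then have "?P (arg_max length ?P)"
    by (rule arg_max_natI[where b = "Suc (length w)"])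
       (simp add: less_Suc_eq_le suffix_length_le)
  then obtain u where u: "y = Syl (Fin u)" "?P u" unfolding y by blast
  then have "u \<noteq> []"
    by (auto elim!: state_cases simp: finite_string_def)
  then have "last u = c" using u last by (auto simp: suffix_def)
  then show "end_triv Q \<sigma> \<epsilon> y = Triv (tgt Q c) (tsign \<sigma> \<epsilon> c)" using u by simp
  show "x \<in> string_states Q \<rho>" "c \<in> syllables Q" "y \<in> string_states Q \<rho>"
    using w c u by auto
  show "end_triv Q \<sigma> \<epsilon> x = Triv (src Q c) (- ssign \<sigma> \<epsilon> c)"
    using w(2)
  proof (cases rule: state_cases)
    case (triv v i)
    then show ?thesis using w by (auto split: if_splits)
  next
    case (syl w')
    then have "w = w' @ [c]" "w' \<noteq> []" using w by (auto simp: finite_string_def)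
    with syl w finite_string_snocD[of w' c] show ?thesis by auto
  qed
qed

lemma string_trans_Triv:
  assumes "c \<in> syllables Q"
  shows "\<exists>y. string_trans Q \<rho> \<sigma> \<epsilon> (Triv (src Q c) (- ssign \<sigma> \<epsilon> c)) c = Some y"
  using assms finite_string_syllable[OF assms] syllable_ends[OF assms]
  by (auto simp: string_trans_def string_states_def triv_strings_def)

theorem mia_mia_string: "mia (mia_string Q \<rho> \<sigma> \<epsilon>)"
proof
  fix q c q' assume "trans (mia_string Q \<rho> \<sigma> \<epsilon>) q c = Some q'"
  then have *: "string_trans Q \<rho> \<sigma> \<epsilon> q c = Some q'" by (simp add: mia_string_def)
  note q = string_trans_Some[OF *]
  then show "q \<in> states (mia_string Q \<rho> \<sigma> \<epsilon>) \<and>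
      c \<in> letters_over (alphabet (mia_string Q \<rho> \<sigma> \<epsilon>)) \<and> q' \<in> states (mia_string Q \<rho> \<sigma> \<epsilon>)"
    by (simp add: mia_string_def syllables_def)
  obtain q'' where "string_trans Q \<rho> \<sigma> \<epsilon> (end_triv Q \<sigma> \<epsilon> q) c = Some q''"
    using string_trans_Triv q by metis
  with string_trans_Some(5)[OF this] q
  show "\<exists>q''. trans (mia_string Q \<rho> \<sigma> \<epsilon>) (entry (mia_string Q \<rho> \<sigma> \<epsilon>) q) c = Some q'' \<and>
      entry (mia_string Q \<rho> \<sigma> \<epsilon>) q' = entry (mia_string Q \<rho> \<sigma> \<epsilon>) q''"
    by (simp add: mia_string_def)
qed (use finite_string_states end_triv_state in
  \<open>auto simp: mia_string_def triv_strings_def string_states_def\<close>)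

lemma delta_inj:
  "inj_on (map_letter (\<lambda>_. 0 :: nat)) {c. trans (mia_string Q \<rho> \<sigma> \<epsilon>) x c \<noteq> None}"
proof (rule inj_onI, clarsimp simp: mia_string_def)
  fix c d y z
  assume eq: "map_letter (\<lambda>_. 0 :: nat) c = map_letter (\<lambda>_. 0) d"
    and "string_trans Q \<rho> \<sigma> \<epsilon> x c = Some y" "string_trans Q \<rho> \<sigma> \<epsilon> x d = Some z"
  note cd = string_trans_Some[OF this(2)] string_trans_Some[OF this(3)]
  then have "src Q c = src Q d" "ssign \<sigma> \<epsilon> c = ssign \<sigma> \<epsilon> d" by auto
  moreover have "ssign \<sigma> \<epsilon> c \<noteq> 0" using syllable_ends(3)[OF cd(2)] by auto
  moreover have arcs:
    "Dir \<alpha> \<in> syllables Q \<longleftrightarrow> \<alpha> \<in> arcs Q" "Inv \<alpha> \<in> syllables Q \<longleftrightarrow> \<alpha> \<in> arcs Q" for \<alpha>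
    by (auto simp: syllables_def letters_over_def)
  ultimately show "c = d"
  proof (cases c)
    case c: (Dir \<alpha>)
    then obtain \<beta> where "d = Dir \<beta>" using eq by (cases d) auto
    with c cd(2,7) sign_source[of \<alpha> \<beta>] \<open>src Q c = src Q d\<close> \<open>ssign \<sigma> \<epsilon> c = ssign \<sigma> \<epsilon> d\<close>
      \<open>ssign \<sigma> \<epsilon> c \<noteq> 0\<close>
    show ?thesis by (auto simp: arcs)
  next
    case c: (Inv \<alpha>)
    then obtain \<beta> where "d = Inv \<beta>" using eq by (cases d) auto
    with c cd(2,7) sign_target[of \<alpha> \<beta>] \<open>src Q c = src Q d\<close> \<open>ssign \<sigma> \<epsilon> c = ssign \<sigma> \<epsilon> d\<close>
      \<open>ssign \<sigma> \<epsilon> c \<noteq> 0\<close>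
    show ?thesis by (auto simp: arcs)
  qed
qed

lemma trans_delta:
  assumes "trans (mia_string Q \<rho> \<sigma> \<epsilon>) q c = Some q'"
  shows "trans (mia_string_delta Q \<rho> \<sigma> \<epsilon>) q (map_letter (\<lambda>_. 0) c) = Some q'"
proof -
  have "(THE c'. map_letter (\<lambda>_. 0 :: nat) c' = map_letter (\<lambda>_. 0) c \<and>
      trans (mia_string Q \<rho> \<sigma> \<epsilon>) q c' \<noteq> None) = c"
    using assms delta_inj[of q] by (intro the_equality) (auto dest: inj_onD)
  with assms show ?thesis by (auto simp: mia_string_delta_def mia_relabel_def)
qed

lemma trans_deltaD:
  assumes "trans (mia_string_delta Q \<rho> \<sigma> \<epsilon>) q d = Some q'"
  obtains c where "d = map_letter (\<lambda>_. 0) c" "trans (mia_string Q \<rho> \<sigma> \<epsilon>) q c = Some q'"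
proof -
  obtain c q'' where c: "map_letter (\<lambda>_. 0) c = d" "trans (mia_string Q \<rho> \<sigma> \<epsilon>) q c = Some q''"
    using assms by (auto simp: mia_string_delta_def mia_relabel_def split: if_splits)
  with trans_delta[OF c(2)] assms that show ?thesis by auto
qed

theorem mia_mia_string_delta: "mia (mia_string_delta Q \<rho> \<sigma> \<epsilon>)"
proof -
  interpret L: mia "mia_string Q \<rho> \<sigma> \<epsilon>" by (rule mia_mia_string)
  let ?D = "mia_string_delta Q \<rho> \<sigma> \<epsilon>"
  have eqs: "states ?D = states (mia_string Q \<rho> \<sigma> \<epsilon>)" "initial ?D = initial (mia_string Q \<rho> \<sigma> \<epsilon>)"
    "entry ?D = entry (mia_string Q \<rho> \<sigma> \<epsilon>)" "iinv ?D = iinv (mia_string Q \<rho> \<sigma> \<epsilon>)"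
    "alphabet ?D = {0}"
    by (simp_all add: mia_string_delta_def mia_relabel_def)
  show ?thesis
  proof
    fix q d q' assume "trans ?D q d = Some q'"
    then obtain c where c: "d = map_letter (\<lambda>_. 0) c" "trans (mia_string Q \<rho> \<sigma> \<epsilon>) q c = Some q'"
      by (rule trans_deltaD)
    then show "q \<in> states ?D \<and> d \<in> letters_over (alphabet ?D) \<and> q' \<in> states ?D"
      using L.trans_closed by (cases c) (auto simp: eqs letters_over_def)
    show "\<exists>q''. trans ?D (entry ?D q) d = Some q'' \<and> entry ?D q' = entry ?D q''"
      using L.trans_entry[OF c(2)] trans_delta c(1) by (auto simp: eqs)
  qed (use L.finite_states L.initial_states L.entry_closed L.iinv_closed L.iinv_involution
      L.entry_initial in \<open>auto simp: eqs\<close>)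
qed

end

end

theory Submission
  imports Defs
begin

text \<open>
  Let \<open>L\<close> be the bi-infinite string of the band and \<open>k\<close> its period.  For \<open>n = 1\<close> the band module
  is spanned by vectors \<open>bvec z\<close>, one for each integer \<open>z\<close>, subject to
  \<open>bvec (z + k) = c bvec z\<close>; the letter \<open>L z\<close> joins \<open>bvec (z - 1)\<close> to \<open>bvec z\<close>, and arrows move these
  vectors along the letters of \<open>L\<close>.  An endomorphism is thus a matrix \<open>G z y\<close> indexed by pairs of
  integers, and commuting with the arrows is a local condition on it.

  Two positions \<open>y\<close> and \<open>z\<close> of \<open>L\<close> at the same vertex can be compared side by side, either in the
  same or in opposite orientation; the signs \<open>\<sigma>\<close> and \<open>\<epsilon>\<close> say in which one, and they make the two
  letters leaving on corresponding sides equal as soon as both are direct or both are inverse.  A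
  nonzero entry \<open>G z y\<close> is passed on along equal letters, and the only difference that stops it is
  an arrow leaving \<open>y\<close> opposite an arrow entering \<open>z\<close> (\<open>intertwines_step\<close>).  Hence it comes either
  from a finite substring that is a factor substring around \<open>y\<close> and an image substring around \<open>z\<close>
  (\<open>admissible_pair\<close>), or from a match that is unbounded on one side and therefore, by
  periodicity, complete.  A complete match in the same orientation is a shift of \<open>L\<close>, by a multiple
  of \<open>k\<close> because \<open>b\<close> is not a proper power, and such entries make up a scalar; one in opposite
  orientation would force \<open>L\<close> to turn back at the centre of a reflection.  So without admissible
  pairs the module is a brick.  Conversely, an admissible pair gives the endomorphism that projects
  to the factor string and embeds it as an image string; it kills some basis vector, since the
  string is shorter than the band, and so is not a scalar.  For \<open>n \<ge> 2\<close> the nilpotent part of the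
  Jordan block is an endomorphism that is not a scalar.

  On the side of the automaton, the words of the class are the cuts of \<open>L\<close> at all its positions.  An
  initial state and the directions of the letters determine the letters themselves, forwards and
  backwards, again by the signs.  Forgetting the names of the letters therefore loses nothing: a
  finite factor subword that is also an image subword is exactly an admissible pair between \<open>L\<close>
  and \<open>L\<close> or its inverse, and it is automatically proper (\<open>weak_brick_word_cut_iff\<close>).
\<close>

section \<open>Bi-infinite strings\<close>

lemma linv_linv [simp]: "linv (linv c) = c"
  by (cases c) auto

lemma linv_neq [simp]: "linv c \<noteq> c" "c \<noteq> linv c"
  by (cases c; simp)+

lemma linv_eq_iff: "linv c = d \<longleftrightarrow> c = linv d"
  by auto

lemma is_Dir_linv [simp]: "is_Dir (linv c) \<longleftrightarrow> \<not> is_Dir c"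
  by (cases c) auto

lemma linv_list_linv_list [simp]: "linv_list (linv_list u) = u"
  by (simp add: linv_list_def rev_map comp_def)

lemma length_linv_list [simp]: "length (linv_list u) = length u"
  by (simp add: linv_list_def)

lemma linv_list_append: "linv_list (u @ w) = linv_list w @ linv_list u"
  by (simp add: linv_list_def)

lemma sublist_linv_list: "sublist u (linv_list w) \<Longrightarrow> sublist (linv_list u) w"
  unfolding sublist_def by (metis append.assoc linv_list_append linv_list_linv_list)

definition window :: "(int \<Rightarrow> 'b) \<Rightarrow> int \<Rightarrow> nat \<Rightarrow> 'b list" where
  "window L z n = map (\<lambda>i. L (z + int i)) [0..<n]"

lemma length_window [simp]: "length (window L z n) = n"
  by (simp add: window_def)

lemma nth_window [simp]: "i < n \<Longrightarrow> window L z n ! i = L (z + int i)"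
  by (simp add: window_def)

lemma window_Suc: "window L z (Suc n) = window L z n @ [L (z + int n)]"
  by (simp add: window_def)

lemma window_Suc_left: "window L z (Suc n) = L z # window L (z + 1) n"
  by (intro nth_equalityI) (auto simp: nth_Cons algebra_simps split: nat.split)

text \<open>The reflection fixes the position between the letters \<open>0\<close> and \<open>1\<close>, so that the position
  following letter \<open>z\<close> becomes the position following letter \<open>- z\<close>.\<close>
definition reflect :: "(int \<Rightarrow> 'a letter) \<Rightarrow> int \<Rightarrow> 'a letter" where
  "reflect L z = linv (L (1 - z))"

lemma window_reflect: "window (reflect L) z n = linv_list (window L (2 - z - int n) n)"
  by (intro nth_equalityI)
    (auto simp: linv_list_def rev_nth reflect_def of_nat_diff algebra_simps)

context string_algebra
begin

lemma finite_string_sublist: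
  assumes "finite_string Q \<rho> w" "sublist u w" "u \<noteq> []"
  shows "finite_string Q \<rho> u"
proof -
  obtain x y where w: "w = x @ u @ y" using assms(2) by (auto simp: sublist_def)
  have "tgt Q (u ! i) = src Q (u ! Suc i) \<and> u ! i \<noteq> linv (u ! Suc i)" if "Suc i < length u" for i
  proof -
    have "tgt Q (w ! (length x + i)) = src Q (w ! Suc (length x + i)) \<and>
        w ! (length x + i) \<noteq> linv (w ! Suc (length x + i))"
    proof -
      have "Suc (length x + i) < length w" using that by (simp add: w)
      then show ?thesis using assms(1) unfolding finite_string_def by blast
    qed
    moreover have "w ! (length x + i) = u ! i" "w ! Suc (length x + i) = u ! Suc i"
      using that unfolding w by (simp_all add: nth_append)
    ultimately show ?thesis by simp
  qed
  moreover have "set u \<subseteq> syllables Q" using assms(1) by (auto simp: finite_string_def w)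
  moreover have "v \<notin> map Dir ` \<rho> \<and> linv_list v \<notin> map Dir ` \<rho>" if "sublist v u" for v
    using assms(1) sublist_order.order_trans[OF that assms(2)] unfolding finite_string_def by blast
  ultimately show ?thesis using assms(3) unfolding finite_string_def by blast
qed

lemma finite_string_linv_list:
  assumes "finite_string Q \<rho> w"
  shows "finite_string Q \<rho> (linv_list w)"
proof -
  have swap: "tgt Q c = src Q d \<longleftrightarrow> tgt Q (linv d) = src Q (linv c)" for c d
    by (cases c; cases d) auto
  have step: "tgt Q (linv_list w ! i) = src Q (linv_list w ! Suc i) \<and>
      linv_list w ! i \<noteq> linv (linv_list w ! Suc i)" if "Suc i < length w" for i
  proof -
    let ?j = "length w - Suc (Suc i)"
    have "tgt Q (w ! ?j) = src Q (w ! Suc ?j)" "w ! ?j \<noteq> linv (w ! Suc ?j)"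
      using assms that unfolding finite_string_def by auto
    moreover have "Suc ?j = length w - Suc i" using that by simp
    ultimately have 1: "tgt Q (linv (w ! (length w - Suc i))) = src Q (linv (w ! ?j))"
      and 2: "linv (w ! (length w - Suc i)) \<noteq> w ! ?j"
      using swap by metis+
    have "linv_list w ! i = linv (w ! (length w - Suc i))" "linv_list w ! Suc i = linv (w ! ?j)"
      using that by (auto simp: linv_list_def rev_nth)
    with 1 2 show ?thesis by simp
  qed
  have set: "set (linv_list w) \<subseteq> syllables Q"
  proof
    fix c assume "c \<in> set (linv_list w)"
    then obtain d where "d \<in> syllables Q" "c = linv d"
      using assms by (auto simp: linv_list_def finite_string_def)
    then show "c \<in> syllables Q" by (auto simp: syllables_def letters_over_def)
  qed
  have "u \<notin> map Dir ` \<rho> \<and> linv_list u \<notin> map Dir ` \<rho>" if "sublist u (linv_list w)" for u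
    using assms sublist_linv_list[OF that] linv_list_linv_list[of u] unfolding finite_string_def by metis
  with step set assms show ?thesis
    unfolding finite_string_def by (metis length_linv_list length_0_conv)
qed

definition bi_infinite_string :: "(int \<Rightarrow> 'a letter) \<Rightarrow> bool" where
  "bi_infinite_string L \<longleftrightarrow> (\<forall>z n. 0 < n \<longrightarrow> finite_string Q \<rho> (window L z n))"

lemma bi_infinite_string_reflect: "bi_infinite_string L \<Longrightarrow> bi_infinite_string (reflect L)"
  by (simp add: bi_infinite_string_def window_reflect finite_string_linv_list)

lemma bi_infinite_string_no_backtrack:
  assumes "bi_infinite_string L"
  shows "L z \<noteq> linv (L (z + 1))"
proof -
  have "finite_string Q \<rho> (window L z 2)" using assms by (simp add: bi_infinite_string_def)
  then have "Suc 0 < 2 \<longrightarrow> window L z 2 ! 0 \<noteq> linv (window L z 2 ! Suc 0)"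
    unfolding finite_string_def length_window by blast
  then show ?thesis by simp
qed

lemma bi_infinite_string_syllable:
  assumes "bi_infinite_string L"
  shows "L z \<in> syllables Q"
proof -
  have "finite_string Q \<rho> (window L z 1)" using assms by (simp add: bi_infinite_string_def)
  then show ?thesis by (simp add: finite_string_def window_def)
qed

lemma bi_infinite_string_of_band:
  assumes "band Q \<rho> b"
  shows "bi_infinite_string (\<lambda>z. b ! nat (z mod int (length b)))"
  unfolding bi_infinite_string_def
proof (intro allI impI)
  fix z :: int and n :: nat assume "0 < n"
  have "b \<noteq> []" using assms by (auto simp: band_def finite_string_def)
  then obtain m where "m \<ge> 1" "sublist (window (\<lambda>z. b ! nat (z mod int (length b))) z n)
      (concat (replicate m b))"
    using window_sublist[of b z n] by (auto simp: window_def)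
  moreover from this have "finite_string Q \<rho> (concat (replicate m b))"
    using assms by (auto simp: band_def)
  moreover have "window (\<lambda>z. b ! nat (z mod int (length b))) z n \<noteq> []"
    using \<open>0 < n\<close> by (simp add: window_def)
  ultimately show "finite_string Q \<rho> (window (\<lambda>z. b ! nat (z mod int (length b))) z n)"
    using finite_string_sublist by blast
qed

end

context signed_string_algebra
begin

lemma Dir_in_syllables [simp]: "Dir \<alpha> \<in> syllables Q \<longleftrightarrow> \<alpha> \<in> arcs Q"
  and Inv_in_syllables [simp]: "Inv \<alpha> \<in> syllables Q \<longleftrightarrow> \<alpha> \<in> arcs Q"
  by (auto simp: syllables_def letters_over_def)

lemma linv_in_syllables [simp]: "linv c \<in> syllables Q \<longleftrightarrow> c \<in> syllables Q"
  by (cases c) auto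

text \<open>Initial states on both sides of a letter: a string can be continued by \<open>c\<close> only at
  \<open>before c\<close>, and it is at \<open>after c\<close> when it has just read \<open>c\<close>.\<close>
definition before :: "'a letter \<Rightarrow> ('v, 'a) string" where
  "before c = Triv (src Q c) (- ssign \<sigma> \<epsilon> c)"

definition after :: "'a letter \<Rightarrow> ('v, 'a) string" where
  "after c = Triv (tgt Q c) (tsign \<sigma> \<epsilon> c)"

lemma before_linv: "before (linv c) = triv_inv (after c)"
  and after_linv: "after (linv c) = triv_inv (before c)"
  by (cases c; simp add: before_def after_def)+

lemma before_in_triv_strings: "c \<in> syllables Q \<Longrightarrow> before c \<in> triv_strings Q"
  using syllable_ends[of c] by (auto simp: before_def triv_strings_def)

text \<open>Two letters of the same kind that start at the same vertex with the same sign coincide: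
  this is the way in which the signs determine a letter from its direction alone.\<close>
lemma letter_eqI_before:
  assumes "c \<in> syllables Q" "d \<in> syllables Q" "is_Dir c \<longleftrightarrow> is_Dir d" "before c = before d"
  shows "c = d"
proof -
  have "ssign \<sigma> \<epsilon> c \<noteq> 0" using syllable_ends(3)[OF assms(1)] by auto
  then show ?thesis
  proof (cases c)
    case c: (Dir \<alpha>)
    then obtain \<beta> where "d = Dir \<beta>" using assms by (cases d) auto
    with c assms sign_source[of \<alpha> \<beta>] \<open>ssign \<sigma> \<epsilon> c \<noteq> 0\<close> show ?thesis
      by (auto simp: before_def)
  next
    case c: (Inv \<alpha>)
    then obtain \<beta> where "d = Inv \<beta>" using assms by (cases d) auto
    with c assms sign_target[of \<alpha> \<beta>] \<open>ssign \<sigma> \<epsilon> c \<noteq> 0\<close> show ?thesis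
      by (auto simp: before_def)
  qed
qed

lemma letter_eqI_after:
  assumes "c \<in> syllables Q" "d \<in> syllables Q" "is_Dir c \<longleftrightarrow> is_Dir d" "after c = after d"
  shows "c = d"
  using letter_eqI_before[of "linv c" "linv d"] assms by (simp add: before_linv linv_eq_iff)

text \<open>The sign conditions are made for this: the two letters at a position of a string lie on
  opposite sides of it, so that the position has a well-defined zero-length string.\<close>
lemma after_eq_before_next:
  assumes "bi_infinite_string L"
  shows "after (L z) = before (L (z + 1))"
proof -
  have "finite_string Q \<rho> (window L z 2)" using assms by (simp add: bi_infinite_string_def)
  then have "finite_string Q \<rho> ([L z] @ [L (z + 1)])" by (simp add: window_def numeral_2_eq_2)
  from finite_string_snocD[OF this] show ?thesis by (simp add: before_def after_def)
qed

text \<open>A factor substring of \<open>L\<close> (all arrows at its two ends point out of it) that is also an image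
  substring of \<open>L'\<close> (all arrows at its ends point into it).  The substring may have length zero,
  and then the condition on \<open>before\<close> says that it is the same zero-length string.\<close>
definition admissible_pair :: "(int \<Rightarrow> 'a letter) \<Rightarrow> (int \<Rightarrow> 'a letter) \<Rightarrow> bool" where
  "admissible_pair L L' \<longleftrightarrow>
     (\<exists>y z m. before (L y) = before (L' z) \<and> (\<forall>t<m. L (y + int t) = L' (z + int t)) \<and>
        \<not> is_Dir (L (y - 1)) \<and> is_Dir (L (y + int m)) \<and>
        is_Dir (L' (z - 1)) \<and> \<not> is_Dir (L' (z + int m)))"

end

section \<open>Words that read a bi-infinite string\<close>

lemma stream_eq_iff: "s = r \<longleftrightarrow> (\<forall>n. s !! n = r !! n)"
  by (metis ext stream_smap_nats)

definition right_ray :: "(int \<Rightarrow> 'b) \<Rightarrow> int \<Rightarrow> 'b stream" where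
  "right_ray L p = smap (\<lambda>n. L (p + int n)) nats"

definition left_ray :: "(int \<Rightarrow> 'b) \<Rightarrow> int \<Rightarrow> 'b stream" where
  "left_ray L p = smap (\<lambda>n. L (p - 1 - int n)) nats"

lemma snth_right_ray [simp]: "right_ray L p !! n = L (p + int n)"
  and snth_left_ray [simp]: "left_ray L p !! n = L (p - 1 - int n)"
  by (simp_all add: right_ray_def left_ray_def)

lemma stake_right_ray [simp]: "stake n (right_ray L p) = window L p n"
  by (intro nth_equalityI) auto

lemma rev_stake_left_ray [simp]: "rev (stake n (left_ray L p)) = window L (p - int n) n"
  by (intro nth_equalityI) (auto simp: rev_nth of_nat_diff algebra_simps)

lemma smap_linv_left_ray: "smap linv (left_ray L p) = right_ray (reflect L) (2 - p)"
  and smap_linv_right_ray: "smap linv (right_ray L p) = left_ray (reflect L) (2 - p)"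
  by (auto simp: stream_eq_iff reflect_def algebra_simps)

lemma shift_right_ray: "window L p n @- right_ray L (p + int n) = right_ray L p"
  by (auto simp: stream_eq_iff shift_snth of_nat_diff)

lemma shift_left_ray: "rev (window L p n) @- left_ray L p = left_ray L (p + int n)"
  by (auto simp: stream_eq_iff shift_snth rev_nth of_nat_diff algebra_simps)

lemma map_shift_right_ray:
    "map f (window L p n) @- smap f (right_ray L (p + int n)) = smap f (right_ray L p)"
  and map_shift_left_ray:
    "map f (rev (window L p n)) @- smap f (left_ray L p) = smap f (left_ray L (p + int n))"
  by (simp_all only: smap_shift[symmetric] shift_right_ray shift_left_ray)

lemma sdrop_right_ray: "sdrop n (right_ray L p) = right_ray L (p + int n)"
  and sdrop_left_ray: "sdrop n (left_ray L p) = left_ray L (p - int n)"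
  by (auto simp: stream_eq_iff sdrop_snth algebra_simps)

lemma shift_eq_iff: "u @- s = r \<longleftrightarrow> u = stake (length u) r \<and> s = sdrop (length u) r"
  by (auto simp: stake_shift sdrop_shift) (metis stake_sdrop)

lemma lsubword_Fin_RInf: "Fin u \<sqsubseteq>\<^sub>l RInf s \<longleftrightarrow> u = stake (length u) s"
proof
  assume "Fin u \<sqsubseteq>\<^sub>l RInf s"
  then obtain z where "wcat (Fin u) z = Some (RInf s)" by (auto simp: lsubword_def)
  then show "u = stake (length u) s" by (cases z) (auto simp: shift_eq_iff)
next
  assume "u = stake (length u) s"
  then have "wcat (Fin u) (RInf (sdrop (length u) s)) = Some (RInf s)"
    by (simp add: shift_eq_iff)
  then show "Fin u \<sqsubseteq>\<^sub>l RInf s" unfolding lsubword_def by blast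
qed

lemma lsubword_Fin_Fin: "Fin u \<sqsubseteq>\<^sub>l Fin w \<longleftrightarrow> prefix u w"
proof
  assume *: "Fin u \<sqsubseteq>\<^sub>l Fin w"
  then have "u = w \<or> (\<exists>z. wcat (Fin u) z = Some (Fin w))" by (auto simp: lsubword_def)
  then show "prefix u w"
  proof
    assume "\<exists>z. wcat (Fin u) z = Some (Fin w)"
    then obtain z where "wcat (Fin u) z = Some (Fin w)" by blast
    then show ?thesis by (cases z) auto
  qed auto
next
  assume "prefix u w"
  then obtain z where "wcat (Fin u) (Fin z) = Some (Fin w)" by (auto simp: prefix_def)
  then show "Fin u \<sqsubseteq>\<^sub>l Fin w" unfolding lsubword_def by blast
qed

lemma rsubword_Fin_LInf: "Fin u \<sqsubseteq>\<^sub>r LInf s \<longleftrightarrow> u = rev (stake (length u) s)"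
proof
  assume "Fin u \<sqsubseteq>\<^sub>r LInf s"
  then obtain z where "wcat z (Fin u) = Some (LInf s)" by (auto simp: rsubword_def)
  then show "u = rev (stake (length u) s)"
    by (cases z) (auto simp: shift_eq_iff rev_swap)
next
  assume "u = rev (stake (length u) s)"
  then have "wcat (LInf (sdrop (length u) s)) (Fin u) = Some (LInf s)"
    by (simp add: shift_eq_iff rev_swap)
  then show "Fin u \<sqsubseteq>\<^sub>r LInf s" unfolding rsubword_def by blast
qed

lemma rsubword_Nil: "Fin [] \<sqsubseteq>\<^sub>r LInf s"
  by (simp add: rsubword_Fin_LInf)

lemma run_Nil [simp]: "run N v [] = Some v"
  by (simp add: run_def)

lemma run_snoc [simp]: "run N v (u @ [c]) = Option.bind (run N v u) (\<lambda>q. trans N q c)"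
  by (simp add: run_def)

lemma is_Dir_map_letter [simp]: "is_Dir (map_letter f c) \<longleftrightarrow> is_Dir c"
  by (cases c) auto

lemma prefix_window: "prefix u (map f (window L z n)) \<Longrightarrow> \<exists>m. u = map f (window L z m)"
proof -
  assume u: "prefix u (map f (window L z n))"
  then have "length u \<le> n" using prefix_length_le by fastforce
  moreover obtain v where v: "map f (window L z n) = u @ v" using u by (auto simp: prefix_def)
  have "u ! i = map f (window L z n) ! i" if "i < length u" for i
    unfolding v using that by (simp add: nth_append)
  ultimately have "u = map f (window L z (length u))" by (intro nth_equalityI) auto
  then show ?thesis by blast
qed

context signed_string_algebra
begin

text \<open>The maximal right substring that is a state is not empty, since single syllables are
  states.\<close>
lemma string_trans_suffix:
  assumes "string_trans Q \<rho> \<sigma> \<epsilon> x c = Some y" "string_snoc Q \<sigma> \<epsilon> x c = Some w"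
  obtains u where "y = Syl (Fin u)" "suffix u w" "u \<noteq> []"
proof -
  let ?P = "\<lambda>u. suffix u w \<and> Syl (Fin u) \<in> (string_states Q \<rho> :: ('v, 'a) string set)"
  have y: "y = Syl (Fin (arg_max length ?P))" "finite_string Q \<rho> w"
    using assms by (auto simp: string_trans_def split: if_splits)
  have "w \<noteq> []" "last w \<in> syllables Q" using y(2) by (auto simp: finite_string_def)
  then have "?P [last w]"
    by (auto simp: string_states_def suffix_def intro: append_butlast_last_id[symmetric])
  then have "?P (arg_max length ?P)"
    by (rule arg_max_natI[where b = "Suc (length w)"])
       (simp add: less_Suc_eq_le suffix_length_le)
  moreover from this have "arg_max length ?P \<noteq> []"
    by (auto elim!: state_cases simp: finite_string_def)
  ultimately show thesis using that y by blast
qed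

end

text \<open>Both automata of a string algebra have the same states and transitions, up to the names \<open>f\<close>
  of the letters.  The names keep directions and formal inverses, as do both the identity and the
  constant map \<open>\<delta>\<close>; together with the states, directions determine the letters.\<close>
locale labelled_string_automaton = signed_string_algebra Q \<rho> \<sigma> \<epsilon>
  for Q :: "('v, 'a) pre_digraph" and \<rho> :: "'a list set" and \<sigma> \<epsilon> :: "'a \<Rightarrow> int" +
  fixes f :: "'a letter \<Rightarrow> 'c letter" and N :: "(('v, 'a) string, 'c) mia"
  assumes trans_iff: "trans N q d = Some q' \<longleftrightarrow>
      (\<exists>c. f c = d \<and> string_trans Q \<rho> \<sigma> \<epsilon> q c = Some q')"
    and initial_N [simp]: "initial N = triv_strings Q"
    and entry_N [simp]: "entry N = end_triv Q \<sigma> \<epsilon>"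
    and iinv_N [simp]: "iinv N = triv_inv"
    and f_linv: "f (linv c) = linv (f c)"
    and is_Dir_f [simp]: "is_Dir (f c) \<longleftrightarrow> is_Dir c"
    and f_alphabet: "c \<in> syllables Q \<Longrightarrow> f c \<in> letters_over (alphabet N)"
begin

lemma end_triv_before [simp]: "end_triv Q \<sigma> \<epsilon> (before c) = before c"
  by (simp add: before_def)

lemma run_window:
  assumes "bi_infinite_string L"
  obtains q where "run N (before (L p)) (map f (window L p n)) = Some q"
    "end_triv Q \<sigma> \<epsilon> q = before (L (p + int n))"
proof -
  \<comment> \<open>The state reached after \<open>n > 0\<close> letters is only some nonempty suffix of what has been read;
    that is enough for its extension by one more letter to be a string again.\<close>
  have "\<exists>q. run N (before (L p)) (map f (window L p n)) = Some q \<and> q \<in> string_states Q \<rho> \<and>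
    (n = 0 \<and> q = before (L p) \<or> (\<exists>y. q = Syl (Fin y) \<and> suffix y (window L p n) \<and> y \<noteq> []))"
  proof (induction n)
    case 0
    have "before (L p) \<in> string_states Q \<rho>"
      using before_in_triv_strings[OF bi_infinite_string_syllable[OF assms]]
      by (simp add: string_states_def)
    then show ?case by (simp add: window_def)
  next
    case (Suc n)
    let ?c = "L (p + int n)"
    from Suc obtain q where q: "run N (before (L p)) (map f (window L p n)) = Some q"
      "q \<in> string_states Q \<rho>"
      "n = 0 \<and> q = before (L p) \<or> (\<exists>y. q = Syl (Fin y) \<and> suffix y (window L p n) \<and> y \<noteq> [])"
      by blast
    have "\<exists>w. string_snoc Q \<sigma> \<epsilon> q ?c = Some w \<and> suffix w (window L p (Suc n)) \<and> w \<noteq> []"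
      using q(3) by (auto simp: before_def window_Suc)
    then obtain w where w: "string_snoc Q \<sigma> \<epsilon> q ?c = Some w" "suffix w (window L p (Suc n))"
      "w \<noteq> []" by blast
    have "finite_string Q \<rho> (window L p (Suc n))"
      using assms by (simp add: bi_infinite_string_def)
    then have "finite_string Q \<rho> w"
      using w finite_string_sublist suffix_imp_sublist by blast
    with w q(2) obtain q' where q': "string_trans Q \<rho> \<sigma> \<epsilon> q ?c = Some q'"
      by (simp add: string_trans_def)
    obtain u where "q' = Syl (Fin u)" "suffix u w" "u \<noteq> []"
      using string_trans_suffix[OF q' w(1)] by blast
    moreover have "trans N q (f ?c) = Some q'" using q' trans_iff by blast
    ultimately show ?case
      using q(1) w(2) string_trans_Some(3)[OF q'] suffix_order.order_trans
      by (auto simp: window_Suc)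
  qed
  then obtain q where q: "run N (before (L p)) (map f (window L p n)) = Some q"
    "n = 0 \<and> q = before (L p) \<or> (\<exists>y. q = Syl (Fin y) \<and> suffix y (window L p n) \<and> y \<noteq> [])"
    by blast
  moreover have "end_triv Q \<sigma> \<epsilon> q = before (L (p + int n))"
  proof (cases n)
    case 0
    then show ?thesis using q(2) by (auto simp: window_def)
  next
    case (Suc m)
    then obtain y where y: "q = Syl (Fin y)" "suffix y (window L p n)" "y \<noteq> []" using q by blast
    then have "last y = L (p + int m)"
      by (auto simp: suffix_def Suc window_Suc) (metis last_appendR last_snoc)
    then show ?thesis
      using y after_eq_before_next[OF assms, of "p + int m"]
      by (simp add: after_def Suc algebra_simps)
  qed
  ultimately show thesis using that by blast
qed

text \<open>Runs are deterministic backwards as well, because the letters that end in a given initial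
  state are told apart by their directions.\<close>
lemma run_window_start:
  assumes "bi_infinite_string L"
  shows "\<lbrakk>run N v (map f (window L p n)) = Some q; end_triv Q \<sigma> \<epsilon> q = before (L (p + int n));
    v \<in> triv_strings Q\<rbrakk> \<Longrightarrow> v = before (L p)"
proof (induction n arbitrary: q)
  case 0
  then show ?case by (auto simp: window_def triv_strings_def)
next
  case (Suc n)
  let ?c = "L (p + int n)"
  obtain q1 where q1: "run N v (map f (window L p n)) = Some q1" "trans N q1 (f ?c) = Some q"
    using Suc.prems by (auto simp: window_Suc bind_eq_Some_conv)
  obtain d where d: "f d = f ?c" "string_trans Q \<rho> \<sigma> \<epsilon> q1 d = Some q"
    using q1(2) trans_iff by blast
  have "after ?c = before (L (p + int (Suc n)))"
    using after_eq_before_next[OF assms, of "p + int n"] by (simp add: algebra_simps)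
  then have "after d = after ?c"
    using string_trans_Some(5)[OF d(2)] Suc.prems(2) by (simp add: after_def)
  moreover have "is_Dir d \<longleftrightarrow> is_Dir ?c" using d(1) is_Dir_f by metis
  ultimately have "d = ?c"
    using letter_eqI_after string_trans_Some(2)[OF d(2)] bi_infinite_string_syllable[OF assms]
    by blast
  then have "end_triv Q \<sigma> \<epsilon> q1 = before ?c"
    using string_trans_Some(4)[OF d(2)] by (simp add: before_def)
  then show ?case using Suc.IH q1(1) Suc.prems(3) by blast
qed

text \<open>Each letter, once its direction has identified it, fixes the initial state before the next.\<close>
lemma f_window_eqD:
  assumes L: "bi_infinite_string L" "bi_infinite_string L'" "before (L y) = before (L' z)"
    and eq: "map f (window L y n) = map f (window L' z n)"
  shows "t < n \<Longrightarrow> L (y + int t) = L' (z + int t)"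
proof -
  have letter: "L (y + int t) = L' (z + int t)"
    if "t < n" "before (L (y + int t)) = before (L' (z + int t))" for t
  proof (rule letter_eqI_before)
    have "map f (window L y n) ! t = map f (window L' z n) ! t" using eq by simp
    then have "f (L (y + int t)) = f (L' (z + int t))" using that by simp
    then show "is_Dir (L (y + int t)) \<longleftrightarrow> is_Dir (L' (z + int t))" using is_Dir_f by metis
  qed (use L that bi_infinite_string_syllable in auto)
  have "t < n \<longrightarrow> before (L (y + int t)) = before (L' (z + int t))" for t
  proof (induction t)
    case (Suc t)
    have "before (L (y + int (Suc t))) = before (L' (z + int (Suc t)))" if "Suc t < n"
      using letter[of t] Suc that after_eq_before_next[OF L(1), of "y + int t"]
        after_eq_before_next[OF L(2), of "z + int t"]
      by (simp add: algebra_simps)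
    then show ?case by blast
  qed (use L in simp)
  then show "t < n \<Longrightarrow> L (y + int t) = L' (z + int t)" using letter by blast
qed

lemma before_reflect:
  assumes "bi_infinite_string L"
  shows "before (reflect L (2 - p)) = triv_inv (before (L p))"
  using after_eq_before_next[OF assms, of "p - 1"] by (simp add: reflect_def before_linv)

lemma linv_list_f_window:
  "linv_list (map f (window L (p - int n) n)) = map f (window (reflect L) (2 - p) n)"
  by (simp add: window_reflect linv_list_def rev_map comp_def f_linv)

lemma f_window_left_eqD:
  assumes L: "bi_infinite_string L" "bi_infinite_string L'" "before (L y) = before (L' z)"
    and eq: "map f (window L (y - int n) n) = map f (window L' (z - int n) n)"
    and t: "t < n"
  shows "L (y - 1 - int t) = L' (z - 1 - int t)"
proof -
  have "reflect L (2 - y + int t) = reflect L' (2 - z + int t)"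
  proof (rule f_window_eqD[OF _ _ _ _ t])
    show "map f (window (reflect L) (2 - y) n) = map f (window (reflect L') (2 - z) n)"
      using eq by (simp flip: linv_list_f_window)
  qed (use L bi_infinite_string_reflect before_reflect in auto)
  then show ?thesis by (simp add: reflect_def algebra_simps linv_eq_iff)
qed

lemma right_word_window:
  assumes "bi_infinite_string L" "before (L p) = v"
  shows "right_word N v (Fin (map f (window L p n)))"
proof -
  have "run N v u \<noteq> None" if prefix: "prefix u (map f (window L p n))" for u
  proof -
    obtain m where u: "u = map f (window L p m)" using prefix_window[OF prefix] by blast
    show ?thesis by (rule run_window[OF assms(1), of p m]) (simp add: u flip: assms(2))
  qed
  then show ?thesis
    using before_in_triv_strings[OF bi_infinite_string_syllable[OF assms(1), of p]]
    unfolding right_word_def lsubword_Fin_Fin by (simp add: assms(2))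
qed

lemma right_word_ray:
  assumes "bi_infinite_string L" "before (L p) = v"
  shows "right_word N v (RInf (smap f (right_ray L p)))"
proof -
  have "run N v u \<noteq> None" if "u = stake (length u) (smap f (right_ray L p))" for u
  proof -
    have u: "u = map f (window L p (length u))" using that by simp
    show ?thesis
      by (rule run_window[OF assms(1), of p "length u"]) (subst u, simp flip: assms(2))
  qed
  then show ?thesis
    using before_in_triv_strings[OF bi_infinite_string_syllable[OF assms(1), of p]]
    unfolding right_word_def lsubword_Fin_RInf by (simp add: assms(2))
qed

lemma left_word_window:
  assumes "bi_infinite_string L"
  shows "left_word N (Fin (map f (window L (p - int n) n))) (before (L p))"
  unfolding left_word_def winv.simps linv_list_f_window iinv_N
  using assms bi_infinite_string_reflect before_reflect by (intro right_word_window) auto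

lemma smap_linv_f: "smap linv (smap f s) = smap f (smap linv s)"
  by (simp add: stream_eq_iff f_linv)

lemma left_word_ray:
  assumes "bi_infinite_string L"
  shows "left_word N (LInf (smap f (left_ray L p))) (before (L p))"
  unfolding left_word_def winv.simps iinv_N smap_linv_f smap_linv_left_ray
  using assms bi_infinite_string_reflect before_reflect by (intro right_word_ray) auto

definition cut :: "(int \<Rightarrow> 'a letter) \<Rightarrow> int \<Rightarrow> (('v, 'a) string, 'c) mia_word" where
  "cut L p = (LInf (smap f (left_ray L p)), before (L p), RInf (smap f (right_ray L p)))"

lemma cut_in_words:
  assumes "bi_infinite_string L"
  shows "cut L p \<in> mia_words N"
proof -
  have "\<exists>q wlu. run N (before (L p)) u = Some q \<and>
      wcat (LInf (smap f (left_ray L p))) (Fin u) = Some wlu \<and> left_word N wlu (entry N q)"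
    if "u = stake (length u) (smap f (right_ray L p))" for u
  proof -
    define n where "n = length u"
    have u: "u = map f (window L p n)" using that by (simp add: n_def)
    obtain q where q: "run N (before (L p)) u = Some q"
      "end_triv Q \<sigma> \<epsilon> q = before (L (p + int n))"
      using run_window[OF assms, of p n] u by blast
    have "rev u @- smap f (left_ray L p) = smap f (left_ray L (p + int n))"
      by (simp add: u rev_map map_shift_left_ray)
    then show ?thesis using q left_word_ray[OF assms] by simp
  qed
  then show ?thesis
    using left_word_ray[OF assms] right_word_ray[OF assms refl] before_in_triv_strings
      bi_infinite_string_syllable[OF assms]
    by (simp add: mia_words_def cut_def lsubword_Fin_RInf)
qed

lemma window_in_words:
  assumes "bi_infinite_string L"
  shows "(Fin [], before (L p), Fin (map f (window L p n))) \<in> mia_words N"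
proof -
  have "\<exists>q wlu. run N (before (L p)) u = Some q \<and> wcat (Fin []) (Fin u) = Some wlu \<and>
      left_word N wlu (entry N q)" if prefix: "prefix u (map f (window L p n))" for u
  proof -
    obtain m where u: "u = map f (window L p m)" using prefix_window[OF prefix] by blast
    obtain q where "run N (before (L p)) u = Some q" "end_triv Q \<sigma> \<epsilon> q = before (L (p + int m))"
      unfolding u by (rule run_window[OF assms, of p m])
    then show ?thesis using left_word_window[OF assms, of "p + int m" m] by (simp add: u)
  qed
  moreover have "left_word N (Fin []) (before (L p))"
    using left_word_window[OF assms, of p 0] by (simp add: window_def)
  ultimately show ?thesis
    using right_word_window[OF assms refl] before_in_triv_strings
      bi_infinite_string_syllable[OF assms]
    by (simp add: mia_words_def lsubword_Fin_Fin)
qed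

lemma slide_cut:
  assumes "bi_infinite_string L"
  shows "slide N (cut L (p + int n)) (cut L p)"
proof -
  obtain q where "run N (before (L p)) (map f (window L p n)) = Some q"
    "end_triv Q \<sigma> \<epsilon> q = before (L (p + int n))"
    using run_window[OF assms] by blast
  then show ?thesis
    by (auto simp: cut_def rev_map map_shift_left_ray map_shift_right_ray
        intro!: exI[of _ "map f (window L p n)"])
qed

lemma sim_cut:
  assumes "bi_infinite_string L"
  shows "mia_sim N (cut L q) (cut L p)"
proof (cases "p \<le> q")
  case True
  then show ?thesis
    using slide_cut[OF assms, of p "nat (q - p)"] cut_in_words[OF assms] by (simp add: mia_sim_def)
next
  case False
  then show ?thesis
    using slide_cut[OF assms, of q "nat (p - q)"] cut_in_words[OF assms] by (simp add: mia_sim_def)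
qed

text \<open>Moving the cut to the left is the delicate case: there the equivalence only says that the new
  initial state runs into the old one, and that determines it by \<open>run_window_start\<close>.\<close>
lemma sim_cutD:
  assumes L: "bi_infinite_string L" and sim: "mia_sim N w (cut L p)"
  shows "\<exists>q. w = cut L q"
proof -
  obtain wl v wr where w: "w = (wl, v, wr)" by (cases w)
  have v: "v \<in> triv_strings Q" using sim by (auto simp: mia_sim_def mia_words_def w)
  from sim consider "slide N w (cut L p)" | "slide N (cut L p) w" by (auto simp: mia_sim_def)
  then show ?thesis
  proof cases
    case 1
    then obtain u where u: "wcat (LInf (smap f (left_ray L p))) (Fin u) = Some wl"
      "wcat (Fin u) wr = Some (RInf (smap f (right_ray L p)))"
      "map_option (end_triv Q \<sigma> \<epsilon>) (run N (before (L p)) u) = Some v"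
      by (auto simp: w cut_def)
    obtain r where r: "wr = RInf r" "u @- r = smap f (right_ray L p)"
      using u(2) by (cases wr) auto
    define n where "n = length u"
    have un: "u = map f (window L p n)" and rn: "r = smap f (right_ray L (p + int n))"
      using r(2) unfolding shift_eq_iff by (auto simp: n_def sdrop_smap sdrop_right_ray)
    have "v = before (L (p + int n))"
      by (rule run_window[OF L, of p n]) (use u(3) in \<open>simp add: un\<close>)
    moreover have "wl = LInf (smap f (left_ray L (p + int n)))"
      using u(1) by (simp add: un rev_map map_shift_left_ray)
    ultimately show ?thesis by (auto simp: w r rn cut_def)
  next
    case 2
    then obtain u where u: "wcat wl (Fin u) = Some (LInf (smap f (left_ray L p)))"
      "wcat (Fin u) (RInf (smap f (right_ray L p))) = Some wr"
      "map_option (end_triv Q \<sigma> \<epsilon>) (run N v u) = Some (before (L p))"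
      by (auto simp: w cut_def)
    obtain l where l: "wl = LInf l" "rev u @- l = smap f (left_ray L p)"
      using u(1) by (cases wl) auto
    define n where "n = length u"
    have un: "u = map f (window L (p - int n) n)" and ln: "l = smap f (left_ray L (p - int n))"
      using l(2) unfolding shift_eq_iff
      by (auto simp: n_def sdrop_smap sdrop_left_ray rev_swap rev_map)
    obtain q where "run N v u = Some q" "end_triv Q \<sigma> \<epsilon> q = before (L p)" using u(3) by auto
    then have "v = before (L (p - int n))"
      using v run_window_start[OF L, of v "p - int n" n q] by (simp add: un)
    moreover have "wr = RInf (smap f (right_ray L (p - int n)))"
      using u(2) map_shift_right_ray[of f L "p - int n" n] by (simp add: un)
    ultimately show ?thesis by (auto simp: w l ln cut_def)
  qed
qed

lemma inv_cut:
  assumes "bi_infinite_string L"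
  shows "mia_word_inv N (cut L p) = cut (reflect L) (2 - p)"
  by (simp add: cut_def smap_linv_f smap_linv_left_ray smap_linv_right_ray before_reflect[OF assms])

lemma preceded_by_left_ray:
  "preceded_by d (Fin u) (LInf (smap f (left_ray L p))) \<longleftrightarrow>
     u = map f (window L (p - int (length u)) (length u)) \<and> d = f (L (p - int (length u) - 1))"
proof -
  have "preceded_by d (Fin u) (LInf (smap f (left_ray L p))) \<longleftrightarrow>
      d # u = map f (window L (p - int (Suc (length u))) (Suc (length u)))"
    by (simp add: preceded_by_def rsubword_Fin_LInf rev_map del: stake.simps)
  also have "\<dots> \<longleftrightarrow> d # u = f (L (p - int (length u) - 1)) #
      map f (window L (p - int (length u)) (length u))"
    by (simp only: window_Suc_left) (simp add: algebra_simps)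
  finally show ?thesis by auto
qed

lemma continued_by_right_ray:
  "continued_by (Fin u) d (RInf (smap f (right_ray L p))) \<longleftrightarrow>
     u = map f (window L p (length u)) \<and> d = f (L (p + int (length u)))"
  by (simp add: continued_by_def lsubword_Fin_RInf window_Suc del: stake.simps)

lemma preceded_by_kind:
  assumes "bi_infinite_string L"
  shows "(\<exists>a\<in>alphabet N. preceded_by (Inv a) (Fin u) (LInf (smap f (left_ray L p)))) \<longleftrightarrow>
      u = map f (window L (p - int (length u)) (length u)) \<and> \<not> is_Dir (L (p - int (length u) - 1))"
    and "(\<exists>a\<in>alphabet N. preceded_by (Dir a) (Fin u) (LInf (smap f (left_ray L p)))) \<longleftrightarrow>
      u = map f (window L (p - int (length u)) (length u)) \<and> is_Dir (L (p - int (length u) - 1))"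
proof -
  let ?c = "L (p - int (length u) - 1)"
  have "f ?c \<in> letters_over (alphabet N)"
    using f_alphabet bi_infinite_string_syllable[OF assms] by blast
  then have "(\<exists>a\<in>alphabet N. Inv a = f ?c) \<longleftrightarrow> \<not> is_Dir (f ?c)"
    "(\<exists>a\<in>alphabet N. Dir a = f ?c) \<longleftrightarrow> is_Dir (f ?c)"
    by (cases "f ?c"; auto simp: letters_over_def simp del: is_Dir_f)+
  then show "(\<exists>a\<in>alphabet N. preceded_by (Inv a) (Fin u) (LInf (smap f (left_ray L p)))) \<longleftrightarrow>
      u = map f (window L (p - int (length u)) (length u)) \<and> \<not> is_Dir ?c"
    "(\<exists>a\<in>alphabet N. preceded_by (Dir a) (Fin u) (LInf (smap f (left_ray L p)))) \<longleftrightarrow>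
      u = map f (window L (p - int (length u)) (length u)) \<and> is_Dir ?c"
    unfolding preceded_by_left_ray by auto
qed

lemma continued_by_kind:
  assumes "bi_infinite_string L"
  shows "(\<exists>a\<in>alphabet N. continued_by (Fin u) (Inv a) (RInf (smap f (right_ray L p)))) \<longleftrightarrow>
      u = map f (window L p (length u)) \<and> \<not> is_Dir (L (p + int (length u)))"
    and "(\<exists>a\<in>alphabet N. continued_by (Fin u) (Dir a) (RInf (smap f (right_ray L p)))) \<longleftrightarrow>
      u = map f (window L p (length u)) \<and> is_Dir (L (p + int (length u)))"
proof -
  let ?c = "L (p + int (length u))"
  have "f ?c \<in> letters_over (alphabet N)"
    using f_alphabet bi_infinite_string_syllable[OF assms] by blast
  then have "(\<exists>a\<in>alphabet N. Inv a = f ?c) \<longleftrightarrow> \<not> is_Dir (f ?c)"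
    "(\<exists>a\<in>alphabet N. Dir a = f ?c) \<longleftrightarrow> is_Dir (f ?c)"
    by (cases "f ?c"; auto simp: letters_over_def simp del: is_Dir_f)+
  then show "(\<exists>a\<in>alphabet N. continued_by (Fin u) (Inv a) (RInf (smap f (right_ray L p)))) \<longleftrightarrow>
      u = map f (window L p (length u)) \<and> \<not> is_Dir ?c"
    "(\<exists>a\<in>alphabet N. continued_by (Fin u) (Dir a) (RInf (smap f (right_ray L p)))) \<longleftrightarrow>
      u = map f (window L p (length u)) \<and> is_Dir ?c"
    unfolding continued_by_right_ray by auto
qed

end

section \<open>Weak brick words and pairs of substrings\<close>

context labelled_string_automaton
begin

lemma aligned_cutD:
  assumes L: "bi_infinite_string L" and al: "aligned N (xl, v, xr) (zl, v, zr) (cut L p)"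
  obtains q where "v = before (L q)" "zl = LInf (smap f (left_ray L q))"
    "zr = RInf (smap f (right_ray L q))"
proof -
  have "mia_sim N (zl, v, zr) (cut L p)" using al by (simp add: aligned_def)
  then obtain q where "(zl, v, zr) = cut L q" using sim_cutD[OF L] by blast
  with that show thesis by (simp add: cut_def)
qed

lemma factor_subword_cutD:
  assumes L: "bi_infinite_string L" and "factor_subword N x (cut L p)" "finite_mia_word x"
  obtains q m n where "x = (Fin (map f (window L (q - int m) m)), before (L q), Fin (map f (window L q n)))"
    "\<not> is_Dir (L (q - int m - 1))" "is_Dir (L (q + int n))"
proof -
  obtain xl v xr where x: "x = (Fin xl, v, Fin xr)" using assms(3) by (cases x) auto
  obtain zl zr where al: "aligned N x (zl, v, zr) (cut L p)" and
    *: "x = (zl, v, zr) \<or>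
         Fin xl = zl \<and> (\<exists>a\<in>alphabet N. continued_by (Fin xr) (Dir a) zr) \<or>
         Fin xr = zr \<and> (\<exists>a\<in>alphabet N. preceded_by (Inv a) (Fin xl) zl) \<or>
         (\<exists>a\<in>alphabet N. preceded_by (Inv a) (Fin xl) zl) \<and>
         (\<exists>a\<in>alphabet N. continued_by (Fin xr) (Dir a) zr)"
    using assms(2) unfolding factor_subword_def x prod.inject by blast
  obtain q where q: "v = before (L q)" "zl = LInf (smap f (left_ray L q))"
    "zr = RInf (smap f (right_ray L q))"
    using aligned_cutD[OF L] al unfolding x by blast
  have "(\<exists>a\<in>alphabet N. preceded_by (Inv a) (Fin xl) zl) \<and>
         (\<exists>a\<in>alphabet N. continued_by (Fin xr) (Dir a) zr)"
    using * by (auto simp: x q)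
  then have "xl = map f (window L (q - int (length xl)) (length xl))"
    "\<not> is_Dir (L (q - int (length xl) - 1))"
    "xr = map f (window L q (length xr))" "is_Dir (L (q + int (length xr)))"
    unfolding q preceded_by_kind[OF L] continued_by_kind[OF L] by auto
  then show thesis using that[of q "length xl" "length xr"] x q(1) by simp
qed

lemma image_subword_cutD:
  assumes L: "bi_infinite_string L" and "image_subword N x (cut L p)" "finite_mia_word x"
  obtains q m n where "x = (Fin (map f (window L (q - int m) m)), before (L q), Fin (map f (window L q n)))"
    "is_Dir (L (q - int m - 1))" "\<not> is_Dir (L (q + int n))"
proof -
  obtain xl v xr where x: "x = (Fin xl, v, Fin xr)" using assms(3) by (cases x) auto
  obtain zl zr where al: "aligned N x (zl, v, zr) (cut L p)" and
    *: "x = (zl, v, zr) \<or>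
         Fin xl = zl \<and> (\<exists>a\<in>alphabet N. continued_by (Fin xr) (Inv a) zr) \<or>
         Fin xr = zr \<and> (\<exists>a\<in>alphabet N. preceded_by (Dir a) (Fin xl) zl) \<or>
         (\<exists>a\<in>alphabet N. preceded_by (Dir a) (Fin xl) zl) \<and>
         (\<exists>a\<in>alphabet N. continued_by (Fin xr) (Inv a) zr)"
    using assms(2) unfolding image_subword_def x prod.inject by blast
  obtain q where q: "v = before (L q)" "zl = LInf (smap f (left_ray L q))"
    "zr = RInf (smap f (right_ray L q))"
    using aligned_cutD[OF L] al unfolding x by blast
  have "(\<exists>a\<in>alphabet N. preceded_by (Dir a) (Fin xl) zl) \<and>
         (\<exists>a\<in>alphabet N. continued_by (Fin xr) (Inv a) zr)"
    using * by (auto simp: x q)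
  then have "xl = map f (window L (q - int (length xl)) (length xl))"
    "is_Dir (L (q - int (length xl) - 1))"
    "xr = map f (window L q (length xr))" "\<not> is_Dir (L (q + int (length xr)))"
    unfolding q preceded_by_kind[OF L] continued_by_kind[OF L] by auto
  then show thesis using that[of q "length xl" "length xr"] x q(1) by simp
qed

lemma admissible_pairI:
  assumes L: "bi_infinite_string L" "bi_infinite_string L'"
    and x: "factor_subword N x (cut L p)" "image_subword N x (cut L' p')" "finite_mia_word x"
  shows "admissible_pair L L'"
proof -
  obtain q m n where q:
    "x = (Fin (map f (window L (q - int m) m)), before (L q), Fin (map f (window L q n)))"
    "\<not> is_Dir (L (q - int m - 1))" "is_Dir (L (q + int n))"
    using factor_subword_cutD[OF L(1) x(1,3)] by blast
  obtain q' m' n' where q':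
    "x = (Fin (map f (window L' (q' - int m') m')), before (L' q'), Fin (map f (window L' q' n')))"
    "is_Dir (L' (q' - int m' - 1))" "\<not> is_Dir (L' (q' + int n'))"
    using image_subword_cutD[OF L(2) x(2,3)] by blast
  have eq: "before (L q) = before (L' q')"
    "map f (window L (q - int m) m) = map f (window L' (q' - int m') m')"
    "map f (window L q n) = map f (window L' q' n')"
    using q(1) q'(1) by simp_all
  then have mn: "m' = m" "n' = n" using length_map length_window by metis+
  have right: "L (q + int t) = L' (q' + int t)" if "t < n" for t
    using f_window_eqD[OF L eq(1) _ that] eq(3) by (simp add: mn)
  have left: "L (q - 1 - int t) = L' (q' - 1 - int t)" if "t < m" for t
    using f_window_left_eqD[OF L eq(1) _ that] eq(2) by (simp add: mn)
  have letters: "L (q - int m + int t) = L' (q' - int m + int t)" if "t < m + n" for t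
  proof (cases "t < m")
    case True
    then show ?thesis using left[of "m - 1 - t"] by (simp add: of_nat_diff algebra_simps)
  next
    case False
    then show ?thesis using right[of "t - m"] that by (simp add: of_nat_diff algebra_simps)
  qed
  have "before (L (q - int m)) = before (L' (q' - int m))"
    using eq(1) letters[of 0] by (cases "m = 0") auto
  moreover have "q - int m + int (m + n) = q + int n" "q' - int m + int (m + n) = q' + int n"
    by simp_all
  ultimately show ?thesis
    using q q' letters unfolding admissible_pair_def mn by metis
qed

lemma aligned_window:
  assumes "bi_infinite_string L"
  shows "aligned N (Fin [], before (L y), Fin (map f (window L y n))) (cut L y) (cut L p)"
  using window_in_words[OF assms] sim_cut[OF assms]
  by (simp add: aligned_def cut_def rsubword_Nil lsubword_Fin_RInf)

lemma factor_subword_window: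
  assumes "bi_infinite_string L" "\<not> is_Dir (L (y - 1))" "is_Dir (L (y + int n))"
  shows "factor_subword N (Fin [], before (L y), Fin (map f (window L y n))) (cut L p)"
proof -
  have "\<exists>a\<in>alphabet N. preceded_by (Inv a) (Fin []) (LInf (smap f (left_ray L y)))"
    using assms(2) by (subst preceded_by_kind[OF assms(1)]) (simp add: window_def)
  moreover have "\<exists>a\<in>alphabet N.
      continued_by (Fin (map f (window L y n))) (Dir a) (RInf (smap f (right_ray L y)))"
    using assms(3) by (subst continued_by_kind[OF assms(1)]) simp
  ultimately show ?thesis
    using aligned_window[OF assms(1), of y n p] unfolding factor_subword_def cut_def by blast
qed

lemma image_subword_window:
  assumes "bi_infinite_string L" "is_Dir (L (y - 1))" "\<not> is_Dir (L (y + int n))"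
  shows "image_subword N (Fin [], before (L y), Fin (map f (window L y n))) (cut L p)"
proof -
  have "\<exists>a\<in>alphabet N. preceded_by (Dir a) (Fin []) (LInf (smap f (left_ray L y)))"
    using assms(2) by (subst preceded_by_kind[OF assms(1)]) (simp add: window_def)
  moreover have "\<exists>a\<in>alphabet N.
      continued_by (Fin (map f (window L y n))) (Inv a) (RInf (smap f (right_ray L y)))"
    using assms(3) by (subst continued_by_kind[OF assms(1)]) simp
  ultimately show ?thesis
    using aligned_window[OF assms(1), of y n p] unfolding image_subword_def cut_def by blast
qed

text \<open>Every finite subword of an infinite word is proper, and a finite word cannot exhaust one
  side of it, so that only the last of the four kinds of factor and image subwords occurs.\<close>
theorem weak_brick_word_cut_iff:
  assumes L: "bi_infinite_string L"
  shows "weak_brick_word N (cut L p) \<longleftrightarrow>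
    \<not> admissible_pair L L \<and> \<not> admissible_pair L (reflect L)"
proof -
  have Lr: "bi_infinite_string (reflect L)" by (rule bi_infinite_string_reflect[OF L])
  note inv = inv_cut[OF L, of p]
  have forward: "admissible_pair L L \<or> admissible_pair L (reflect L)"
    if "u \<in> {cut L p, mia_word_inv N (cut L p)}" "finite_mia_word x"
      "factor_subword N x (cut L p)" "image_subword N x u" for x u
    using that admissible_pairI[OF L L] admissible_pairI[OF L Lr] unfolding inv by blast
  have backward: "\<exists>x. x \<in> mia_words N \<and> finite_mia_word x \<and> factor_subword N x (cut L p) \<and>
      image_subword N x (cut L' p') \<and> proper_subword N x (cut L p)"
    if L': "bi_infinite_string L'" and "admissible_pair L L'" for L' p'
  proof -
    obtain y z m where *: "before (L y) = before (L' z)" "\<forall>t<m. L (y + int t) = L' (z + int t)"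
      "\<not> is_Dir (L (y - 1))" "is_Dir (L (y + int m))"
      "is_Dir (L' (z - 1))" "\<not> is_Dir (L' (z + int m))"
      using \<open>admissible_pair L L'\<close> unfolding admissible_pair_def by blast
    let ?x = "(Fin [], before (L y), Fin (map f (window L y m)))"
    have "?x = (Fin [], before (L' z), Fin (map f (window L' z m)))"
      using *(1,2) by (auto simp: window_def)
    then have "image_subword N ?x (cut L' p')" using image_subword_window[OF L' *(5,6)] by simp
    moreover have "subword N ?x (cut L p)" using aligned_window[OF L] unfolding subword_def by blast
    moreover have "\<not> mia_sim N ?x (cut L p)" by (auto simp: mia_sim_def cut_def)
    ultimately show ?thesis
      using factor_subword_window[OF L *(3,4)] window_in_words[OF L]
      unfolding proper_subword_def by (intro exI[of _ ?x]) simp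
  qed
  have "\<not> weak_brick_word N (cut L p) \<longleftrightarrow> admissible_pair L L \<or> admissible_pair L (reflect L)"
  proof
    assume "\<not> weak_brick_word N (cut L p)"
    then obtain x u where "u \<in> {cut L p, mia_word_inv N (cut L p)}" "finite_mia_word x"
      "factor_subword N x (cut L p)" "image_subword N x u"
      unfolding weak_brick_word_def using cut_in_words[OF L] by blast
    then show "admissible_pair L L \<or> admissible_pair L (reflect L)" by (rule forward)
  next
    assume "admissible_pair L L \<or> admissible_pair L (reflect L)"
    then show "\<not> weak_brick_word N (cut L p)"
      using backward[OF L, of p] backward[OF Lr, of "2 - p"]
      unfolding weak_brick_word_def inv by blast
  qed
  then show ?thesis by blast
qed

end

context signed_string_algebra
begin

lemma labelled_mia_string:
  "labelled_string_automaton Q \<rho> \<sigma> \<epsilon> id (mia_string Q \<rho> \<sigma> \<epsilon>)"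
  by unfold_locales (auto simp: mia_string_def syllables_def)

lemma labelled_mia_string_delta:
  "labelled_string_automaton Q \<rho> \<sigma> \<epsilon> (map_letter (\<lambda>_. 0)) (mia_string_delta Q \<rho> \<sigma> \<epsilon>)"
proof unfold_locales
  fix q d q'
  show "trans (mia_string_delta Q \<rho> \<sigma> \<epsilon>) q d = Some q' \<longleftrightarrow>
      (\<exists>c. map_letter (\<lambda>_. 0) c = d \<and> string_trans Q \<rho> \<sigma> \<epsilon> q c = Some q')"
    using trans_delta[of q _ q'] trans_deltaD[of q d q']
    by (auto simp: mia_string_def)
next
  fix c :: "'a letter"
  show "map_letter (\<lambda>_. 0 :: nat) (linv c) = linv (map_letter (\<lambda>_. 0) c)" by (cases c) auto
  show "map_letter (\<lambda>_. 0) c \<in> letters_over (alphabet (mia_string_delta Q \<rho> \<sigma> \<epsilon>))"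
    by (cases c) (auto simp: mia_string_delta_def mia_relabel_def letters_over_def)
qed (simp_all add: mia_string_delta_def mia_relabel_def mia_string_def)

text \<open>The first letter after the cut determines the initial state, so that every word reading \<open>L\<close>
  is a cut of \<open>L\<close>; by \<open>weak_brick_word_cut_iff\<close> the place of the cut does not matter.\<close>
theorem class_weak_brick_iff:
  assumes L: "bi_infinite_string L"
  shows "(\<forall>w \<in> Phi ` word_class Q \<rho> \<sigma> \<epsilon> (Syl (BiInf L)).
      weak_brick_word (mia_string_delta Q \<rho> \<sigma> \<epsilon>) w) \<longleftrightarrow>
    \<not> admissible_pair L L \<and> \<not> admissible_pair L (reflect L)"
proof -
  interpret S: labelled_string_automaton Q \<rho> \<sigma> \<epsilon> id "mia_string Q \<rho> \<sigma> \<epsilon>"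
    by (rule labelled_mia_string)
  interpret D: labelled_string_automaton Q \<rho> \<sigma> \<epsilon> "map_letter (\<lambda>_. 0)" "mia_string_delta Q \<rho> \<sigma> \<epsilon>"
    by (rule labelled_mia_string_delta)
  have Phi_cut: "Phi (S.cut L p) = D.cut L p" for p
    by (simp add: Phi_def S.cut_def D.cut_def stream.map_id)
  have cut: "\<exists>p. z = S.cut L p"
    if z: "z \<in> mia_words (mia_string Q \<rho> \<sigma> \<epsilon>)" "reads_as z (BiInf L)" for z
  proof -
    obtain wl v wr where zw: "z = (wl, v, wr)" by (cases z)
    obtain y where y: "wcat wl wr = Some y" "word_eq y (BiInf L)" using z(2) by (auto simp: zw)
    then obtain g where g: "y = BiInf g" by (cases y) auto
    obtain s r where sr: "wl = LInf s" "wr = RInf r"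
      "g = (\<lambda>i. if i \<ge> 0 then r !! nat i else s !! nat (- i - 1))"
      using y(1) g by (cases wl; cases wr) auto
    obtain d where d: "L i = g (i + d)" for i using y(2) g by auto
    have "r !! n = L (- d + int n)" "s !! n = L (- d - 1 - int n)" for n
      by (simp_all add: d sr(3))
    then have rays: "r = right_ray L (- d)" "s = left_ray L (- d)"
      by (auto simp: stream_eq_iff)
    have v: "v \<in> triv_strings Q" and rw: "right_word (mia_string Q \<rho> \<sigma> \<epsilon>) v (RInf r)"
      using z(1) by (auto simp: mia_words_def zw sr)
    have "Fin [L (- d)] \<sqsubseteq>\<^sub>l RInf r" by (simp add: lsubword_Fin_RInf rays window_def)
    then have "run (mia_string Q \<rho> \<sigma> \<epsilon>) v ([] @ [L (- d)]) \<noteq> None"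
      using rw unfolding right_word_def by simp
    then obtain q where "string_trans Q \<rho> \<sigma> \<epsilon> v (L (- d)) = Some q"
      unfolding run_snoc by (auto simp: mia_string_def)
    then have "end_triv Q \<sigma> \<epsilon> v = before (L (- d))"
      by (simp add: string_trans_Some(4) before_def)
    then have "v = before (L (- d))" using v by (auto simp: triv_strings_def)
    then show ?thesis by (auto simp: zw sr rays S.cut_def stream.map_id)
  qed
  have sub: "Phi ` word_class Q \<rho> \<sigma> \<epsilon> (Syl (BiInf L)) \<subseteq> range (D.cut L)"
  proof
    fix w assume "w \<in> Phi ` word_class Q \<rho> \<sigma> \<epsilon> (Syl (BiInf L))"
    then obtain w' z where w: "w = Phi w'" "z \<in> mia_words (mia_string Q \<rho> \<sigma> \<epsilon>)"
      "reads_as z (BiInf L)" "mia_sim (mia_string Q \<rho> \<sigma> \<epsilon>) w' z" by auto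
    then obtain p where "z = S.cut L p" using cut by blast
    then obtain q where "w' = S.cut L q" using w(4) S.sim_cutD[OF L] by blast
    then show "w \<in> range (D.cut L)" using w(1) Phi_cut by simp
  qed
  have mem: "D.cut L 0 \<in> Phi ` word_class Q \<rho> \<sigma> \<epsilon> (Syl (BiInf L))"
  proof -
    have "reads_as (S.cut L 0) (BiInf L)"
      by (auto simp: S.cut_def stream.map_id intro!: exI[of _ 0])
    then have "S.cut L 0 \<in> word_class Q \<rho> \<sigma> \<epsilon> (Syl (BiInf L))"
      using S.cut_in_words[OF L] S.sim_cut[OF L] by auto
    then show ?thesis using Phi_cut by (metis imageI)
  qed
  note iff = D.weak_brick_word_cut_iff[OF L]
  show ?thesis
  proof
    assume "\<forall>w \<in> Phi ` word_class Q \<rho> \<sigma> \<epsilon> (Syl (BiInf L)).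
      weak_brick_word (mia_string_delta Q \<rho> \<sigma> \<epsilon>) w"
    from bspec[OF this mem] show "\<not> admissible_pair L L \<and> \<not> admissible_pair L (reflect L)"
      by (rule iffD1[OF iff])
  next
    assume no_pair: "\<not> admissible_pair L L \<and> \<not> admissible_pair L (reflect L)"
    show "\<forall>w \<in> Phi ` word_class Q \<rho> \<sigma> \<epsilon> (Syl (BiInf L)).
      weak_brick_word (mia_string_delta Q \<rho> \<sigma> \<epsilon>) w"
    proof
      fix w assume "w \<in> Phi ` word_class Q \<rho> \<sigma> \<epsilon> (Syl (BiInf L))"
      then obtain p where "w = D.cut L p" using sub by blast
      then show "weak_brick_word (mia_string_delta Q \<rho> \<sigma> \<epsilon>) w"
        using iff[of p] no_pair by simp
    qed
  qed
qed

end

section \<open>Bricks\<close>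

text \<open>An algebra isomorphism from the ground field sends \<open>d = d \<cdot> 1\<close> to \<open>d\<close> times the identity.  So a
  nonzero representation is a brick precisely if its endomorphisms are the scalars.\<close>
lemma brickD:
  assumes "brick scale Q \<rho> M" "f \<in> rep_endos scale Q M"
  shows "\<exists>d. \<forall>v\<in>verts Q. \<forall>x\<in>space M v. f v x = scale d x"
proof -
  let ?E = "end_algebra scale Q M"
  obtain \<phi> where iso: "\<phi> \<in> ring_iso class_ring ?E" and
    scal: "\<And>c d. \<phi> (c * d) = c \<odot>\<^bsub>?E\<^esub> \<phi> d"
    using assms(1) by (auto simp: brick_def)
  have one: "\<phi> 1 = one ?E"
    using iso by (auto simp: ring_iso_def ring_hom_def class_ring_simps)
  have "f \<in> \<phi> ` UNIV"
    using iso assms(2) by (auto simp: ring_iso_def bij_betw_def end_algebra_def class_ring_simps)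
  then obtain d where "f = \<phi> d" by blast
  then have "f = d \<odot>\<^bsub>?E\<^esub> one ?E" using scal[of d 1] one by simp
  then show ?thesis by (intro exI[of _ d]) (simp add: end_algebra_def)
qed

lemma brickI:
  fixes scale :: "'k::field \<Rightarrow> 'm::ab_group_add \<Rightarrow> 'm"
  assumes rep: "is_quiver_rep scale Q \<rho> M"
    and tail_head: "\<And>\<alpha>. \<alpha> \<in> arcs Q \<Longrightarrow> tail Q \<alpha> \<in> verts Q \<and> head Q \<alpha> \<in> verts Q"
    and scalar: "\<And>f. f \<in> rep_endos scale Q M \<Longrightarrow>
      \<exists>d. \<forall>v\<in>verts Q. \<forall>x\<in>space M v. f v x = scale d x"
    and nonzero: "v \<in> verts Q" "x \<in> space M v" "x \<noteq> 0"
  shows "brick scale Q \<rho> M"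
proof -
  interpret vector_space scale using rep by (simp add: is_quiver_rep_def)
  let ?E = "end_algebra scale Q M"
  define \<phi> where "\<phi> d = (\<lambda>v\<in>verts Q. \<lambda>x\<in>space M v. scale d x)" for d
  have sub: "subspace (space M v)" if "v \<in> verts Q" for v
    using rep that by (simp add: is_quiver_rep_def)
  have act_scale: "act M \<alpha> (scale d x) = scale d (act M \<alpha> x)"
    and act_in: "act M \<alpha> x \<in> space M (head Q \<alpha>)"
    if "\<alpha> \<in> arcs Q" "x \<in> space M (tail Q \<alpha>)" for \<alpha> d x
    using rep that by (auto simp: is_quiver_rep_def linear_map_on_def)
  have in_endos: "\<phi> d \<in> rep_endos scale Q M" for d
    using sub act_scale act_in tail_head
    by (auto simp: rep_endos_def \<phi>_def linear_map_on_def subspace_add subspace_scale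
        scale_right_distrib scale_left_commute)
  have eqI: "\<phi> d = f" if "f \<in> rep_endos scale Q M" "\<forall>v\<in>verts Q. \<forall>x\<in>space M v. f v x = scale d x"
    for d f
  proof
    fix v show "\<phi> d v = f v"
    proof (cases "v \<in> verts Q")
      case True
      then have "f v \<in> space M v \<rightarrow>\<^sub>E space M v" using that(1) by (auto simp: rep_endos_def)
      then show ?thesis using that(2) True by (auto simp: \<phi>_def fun_eq_iff PiE_def extensional_def)
    next
      case False
      then show ?thesis using that(1) by (auto simp: rep_endos_def \<phi>_def PiE_def extensional_def)
    qed
  qed
  have "inj \<phi>"
  proof (rule injI)
    fix d e assume "\<phi> d = \<phi> e"
    then have "\<phi> d v x = \<phi> e v x" by simp
    then show "d = e" using nonzero by (simp add: \<phi>_def)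
  qed
  moreover have "range \<phi> = rep_endos scale Q M"
  proof
    show "rep_endos scale Q M \<subseteq> range \<phi>"
    proof
      fix f assume f: "f \<in> rep_endos scale Q M"
      then obtain d where "\<forall>v\<in>verts Q. \<forall>x\<in>space M v. f v x = scale d x" using scalar by blast
      from eqI[OF f this] show "f \<in> range \<phi>" by blast
    qed
  qed (use in_endos in blast)
  ultimately have "bij_betw \<phi> (carrier class_ring) (carrier ?E)"
    by (simp add: bij_betw_def end_algebra_def class_ring_simps)
  moreover have "\<phi> \<in> ring_hom class_ring ?E"
  proof (rule ring_hom_memI)
    fix d e
    show "\<phi> (d \<otimes>\<^bsub>class_ring\<^esub> e) = \<phi> d \<otimes>\<^bsub>?E\<^esub> \<phi> e"
      using sub by (auto simp: \<phi>_def end_algebra_def class_ring_simps fun_eq_iff restrict_def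
          subspace_scale)
    show "\<phi> (d \<oplus>\<^bsub>class_ring\<^esub> e) = \<phi> d \<oplus>\<^bsub>?E\<^esub> \<phi> e"
      by (auto simp: \<phi>_def end_algebra_def class_ring_simps fun_eq_iff restrict_def
          scale_left_distrib)
  qed (use in_endos in \<open>auto simp: \<phi>_def end_algebra_def class_ring_simps fun_eq_iff restrict_def\<close>)
  moreover have "\<phi> (d * e) = d \<odot>\<^bsub>?E\<^esub> \<phi> e" for d e
    by (auto simp: \<phi>_def end_algebra_def fun_eq_iff restrict_def)
  ultimately show ?thesis using rep by (auto simp: brick_def ring_iso_def)
qed

section \<open>Matrices of endomorphisms\<close>

context signed_string_algebra
begin

text \<open>The matrix equation of a homomorphism between two modules with bases indexed by \<open>\<int>\<close>, where
  the basis vectors \<open>y - 1\<close> and \<open>y\<close> are joined by the letter \<open>L y\<close>, and likewise for \<open>L'\<close>; here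
  \<open>G z y\<close> is the coefficient at the basis vector \<open>z\<close> of the image of the basis vector \<open>y\<close>.\<close>
definition intertwines ::
  "(int \<Rightarrow> 'a letter) \<Rightarrow> (int \<Rightarrow> 'a letter) \<Rightarrow> (int \<Rightarrow> int \<Rightarrow> 'k::field) \<Rightarrow> bool" where
  "intertwines L L' G \<longleftrightarrow> (\<forall>y z. \<forall>\<beta>\<in>arcs Q. tgt Q (L y) = tail Q \<beta> \<longrightarrow>
     (if L (y + 1) = Dir \<beta> then G z (y + 1) else 0) + (if L y = Inv \<beta> then G z (y - 1) else 0) =
     (if L' z = Dir \<beta> then G (z - 1) y else 0) + (if L' (z + 1) = Inv \<beta> then G (z + 1) y else 0))"

lemma tgt_reflect:
  assumes "bi_infinite_string L"
  shows "tgt Q (reflect L y) = tgt Q (L (- y))"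
proof -
  have "tgt Q (linv c) = src Q c" for c by (cases c) auto
  then have "tgt Q (reflect L y) = src Q (L (- y + 1))" by (simp add: reflect_def algebra_simps)
  then show ?thesis
    using after_eq_before_next[OF assms, of "- y"] by (simp add: after_def before_def)
qed

lemma after_reflect:
  assumes "bi_infinite_string L"
  shows "after (reflect L (- z)) = triv_inv (after (L z))"
  using after_eq_before_next[OF assms, of z] by (simp add: reflect_def after_linv algebra_simps)

lemma intertwines_reflect:
  assumes "bi_infinite_string L" "intertwines L L' G"
  shows "intertwines (reflect L) (reflect L') (\<lambda>z y. G (- z) (- y))"
proof -
  have "reflect K z = Dir \<beta> \<longleftrightarrow> K (1 - z) = Inv \<beta>" "reflect K z = Inv \<beta> \<longleftrightarrow> K (1 - z) = Dir \<beta>"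
    for K z \<beta>
    by (auto simp: reflect_def linv_eq_iff)
  note reflect_eq = this
  show ?thesis
    unfolding intertwines_def
  proof (intro allI ballI impI)
    fix y z :: int and \<beta> assume "\<beta> \<in> arcs Q" "tgt Q (reflect L y) = tail Q \<beta>"
    then have eq: "(if L (- y + 1) = Dir \<beta> then G (- z) (- y + 1) else 0) +
        (if L (- y) = Inv \<beta> then G (- z) (- y - 1) else 0) =
        (if L' (- z) = Dir \<beta> then G (- z - 1) (- y) else 0) +
        (if L' (- z + 1) = Inv \<beta> then G (- z + 1) (- y) else 0)"
      using assms(2) unfolding intertwines_def tgt_reflect[OF assms(1)] by blast
    have shift: "1 - (u + 1) = - u" "- (u + 1) = - u - 1" "- (u - 1) = - u + 1"
      for u :: int by simp_all
    show "(if reflect L (y + 1) = Dir \<beta> then G (- z) (- (y + 1)) else 0) +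
        (if reflect L y = Inv \<beta> then G (- z) (- (y - 1)) else 0) =
        (if reflect L' z = Dir \<beta> then G (- (z - 1)) (- y) else 0) +
        (if reflect L' (z + 1) = Inv \<beta> then G (- (z + 1)) (- y) else 0)"
      unfolding reflect_eq shift using eq by (simp add: add.commute)
  qed
qed

text \<open>A nonzero coefficient is passed on along equal letters.  At the first difference the arrow at
  \<open>y\<close> must leave \<open>y\<close>: an arrow entering \<open>y\<close> but not \<open>z\<close> would force the coefficient to vanish.\<close>
lemma intertwines_step:
  assumes L: "bi_infinite_string L" and L': "bi_infinite_string L'"
    and G: "intertwines L L' G" and same: "after (L y) = after (L' z)"
  shows "L (y + 1) = L' (z + 1) \<Longrightarrow> G (z + 1) (y + 1) = G z y"
    and "\<lbrakk>G z y \<noteq> 0; L (y + 1) \<noteq> L' (z + 1)\<rbrakk> \<Longrightarrow> is_Dir (L (y + 1)) \<and> \<not> is_Dir (L' (z + 1))"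
proof -
  have syl: "L (y + 1) \<in> syllables Q" "L' (z + 1) \<in> syllables Q"
    using bi_infinite_string_syllable L L' by auto
  have start: "before (L (y + 1)) = before (L' (z + 1))"
    using same after_eq_before_next L L' by metis
  have reduced: "L y \<noteq> linv (L (y + 1))" "L (y + 1) \<noteq> linv (L (2 + y))"
    "L' z \<noteq> linv (L' (z + 1))" "L' (z + 1) \<noteq> linv (L' (2 + z))"
    using bi_infinite_string_no_backtrack[OF L, of y] bi_infinite_string_no_backtrack[OF L, of "y + 1"]
      bi_infinite_string_no_backtrack[OF L', of z] bi_infinite_string_no_backtrack[OF L', of "z + 1"]
    by (simp_all add: algebra_simps)
  have tgt: "tgt Q (L y) = src Q (L (y + 1))"
    using after_eq_before_next[OF L, of y] by (simp add: after_def before_def)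
  note eq = G[unfolded intertwines_def, rule_format]
  show "G (z + 1) (y + 1) = G z y" if "L (y + 1) = L' (z + 1)"
  proof (cases "L (y + 1)")
    case (Dir \<beta>)
    then have "L' (z + 1) = Dir \<beta>" "\<beta> \<in> arcs Q" "L y \<noteq> Inv \<beta>" "L' (2 + z) \<noteq> Inv \<beta>"
      "tgt Q (L y) = tail Q \<beta>"
      using that syl reduced tgt by auto
    then show ?thesis using eq[of \<beta> y "z + 1"] Dir by simp
  next
    case (Inv \<beta>)
    then have "L' (z + 1) = Inv \<beta>" "\<beta> \<in> arcs Q" "L' z \<noteq> Dir \<beta>" "L (2 + y) \<noteq> Dir \<beta>"
      using that syl reduced by auto
    then show ?thesis using eq[of \<beta> "y + 1" z] Inv by simp
  qed
  show "is_Dir (L (y + 1)) \<and> \<not> is_Dir (L' (z + 1))" if nz: "G z y \<noteq> 0" and ne: "L (y + 1) \<noteq> L' (z + 1)"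
  proof (rule ccontr)
    assume "\<not> ?thesis"
    moreover have "is_Dir (L (y + 1)) \<noteq> is_Dir (L' (z + 1))"
      using letter_eqI_before[OF syl _ start] ne by blast
    ultimately obtain \<beta> \<gamma> where \<beta>: "L (y + 1) = Inv \<beta>" and \<gamma>: "L' (z + 1) = Dir \<gamma>"
      by (cases "L (y + 1)"; cases "L' (z + 1)") auto
    have "L' z \<noteq> Dir \<beta>"
    proof
      assume "L' z = Dir \<beta>"
      then have "tsign \<sigma> \<epsilon> (Dir \<beta>) = - ssign \<sigma> \<epsilon> (Inv \<beta>)"
        using start \<beta> after_eq_before_next[OF L', of z] by (simp add: after_def before_def)
      moreover have "\<epsilon> \<beta> \<noteq> 0" using syl(1) \<beta> sign_range[of \<beta>] by auto
      ultimately show False by simp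
    qed
    moreover have "\<beta> \<in> arcs Q" "L (2 + y) \<noteq> Dir \<beta>" using \<beta> syl reduced by auto
    ultimately have "G z y = 0" using eq[of \<beta> "y + 1" z] \<beta> \<gamma> by simp
    with nz show False by simp
  qed
qed

lemma intertwines_right:
  assumes L: "bi_infinite_string L" and L': "bi_infinite_string L'"
    and G: "intertwines L L' G" and same: "after (L y) = after (L' z)" and nz: "G z y \<noteq> 0"
  shows "(\<forall>t. L (y + 1 + int t) = L' (z + 1 + int t)) \<or>
    (\<exists>m. (\<forall>t<m. L (y + 1 + int t) = L' (z + 1 + int t)) \<and>
       is_Dir (L (y + 1 + int m)) \<and> \<not> is_Dir (L' (z + 1 + int m)))"
proof (cases "\<forall>t. L (y + 1 + int t) = L' (z + 1 + int t)")
  case False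
  define m where "m = (LEAST t. L (y + 1 + int t) \<noteq> L' (z + 1 + int t))"
  have m: "L (y + 1 + int m) \<noteq> L' (z + 1 + int m)"
    unfolding m_def using False by (metis (mono_tags, lifting) LeastI_ex)
  have less: "L (y + 1 + int t) = L' (z + 1 + int t)" if "t < m" for t
    using not_less_Least that unfolding m_def by blast
  have "t \<le> m \<Longrightarrow> G (z + int t) (y + int t) = G z y \<and> after (L (y + int t)) = after (L' (z + int t))"
    for t
  proof (induction t)
    case (Suc t)
    then show ?case
      using less[of t] intertwines_step(1)[OF L L' G, of "y + int t" "z + int t"]
      by (simp add: algebra_simps)
  qed (use same in simp)
  from this[of m] show ?thesis
    using intertwines_step(2)[OF L L' G, of "y + int m" "z + int m"] m less nz
    by (intro disjI2 exI[of _ m]) (auto simp: algebra_simps)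
qed simp

lemma intertwines_left:
  assumes L: "bi_infinite_string L" and L': "bi_infinite_string L'"
    and G: "intertwines L L' G" and same: "after (L y) = after (L' z)" and nz: "G z y \<noteq> 0"
  shows "(\<forall>t. L (y - int t) = L' (z - int t)) \<or>
    (\<exists>m. (\<forall>t<m. L (y - int t) = L' (z - int t)) \<and>
       \<not> is_Dir (L (y - int m)) \<and> is_Dir (L' (z - int m)))"
proof -
  have "after (reflect L (- y)) = after (reflect L' (- z))"
    using L L' same by (simp add: after_reflect)
  from intertwines_right[OF bi_infinite_string_reflect[OF L] bi_infinite_string_reflect[OF L']
      intertwines_reflect[OF L G] this]
  show ?thesis using nz by (simp add: reflect_def linv_eq_iff)
qed

text \<open>If the propagation stopped in both directions, the letters in between would form a factor
  substring around \<open>y\<close> and an image substring around \<open>z\<close>.\<close>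
lemma intertwines_zero_or_match:
  assumes L: "bi_infinite_string L" and L': "bi_infinite_string L'"
    and G: "intertwines L L' G" and same: "after (L y) = after (L' z)" and nz: "G z y \<noteq> 0"
    and no_pair: "\<not> admissible_pair L L'"
  shows "(\<forall>t. L (y + 1 + int t) = L' (z + 1 + int t)) \<or> (\<forall>t. L (y - int t) = L' (z - int t))"
proof (rule ccontr)
  assume not: "\<not> ?thesis"
  obtain m where m: "\<forall>t<m. L (y + 1 + int t) = L' (z + 1 + int t)"
    "is_Dir (L (y + 1 + int m))" "\<not> is_Dir (L' (z + 1 + int m))"
    using intertwines_right[OF L L' G same nz] not by blast
  obtain n where n: "\<forall>t<n. L (y - int t) = L' (z - int t)"
    "\<not> is_Dir (L (y - int n))" "is_Dir (L' (z - int n))"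
    using intertwines_left[OF L L' G same nz] not by blast
  have "L (y - int n + 1 + int t) = L' (z - int n + 1 + int t)" if "t < n + m" for t
  proof (cases "t < n")
    case True
    then show ?thesis using n(1)[rule_format, of "n - 1 - t"] by (simp add: of_nat_diff algebra_simps)
  next
    case False
    then show ?thesis using m(1)[rule_format, of "t - n"] that by (simp add: of_nat_diff algebra_simps)
  qed
  moreover have "before (L (y - int n + 1)) = before (L' (z - int n + 1))"
  proof (cases n)
    case 0
    then show ?thesis using same after_eq_before_next L L' by simp
  next
    case (Suc n')
    then show ?thesis using n(1)[rule_format, of n'] by (simp add: algebra_simps)
  qed
  ultimately have "admissible_pair L L'"
    unfolding admissible_pair_def
    using m n by (intro exI[of _ "y - int n + 1"] exI[of _ "z - int n + 1"] exI[of _ "n + m"])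
      (simp add: algebra_simps)
  with no_pair show False ..
qed

end

section \<open>The band module over the bi-infinite string\<close>

locale string_band = signed_string_algebra Q \<rho> \<sigma> \<epsilon>
  for Q :: "('v, 'a) pre_digraph" and \<rho> :: "'a list set" and \<sigma> \<epsilon> :: "'a \<Rightarrow> int" +
  fixes b :: "'a letter list" and c :: "'k::field"
  assumes band_b: "band Q \<rho> b" and c_nonzero: "c \<noteq> 0"
begin

abbreviation k :: int where "k \<equiv> int (length b)"

definition line :: "int \<Rightarrow> 'a letter" where
  "line z = b ! nat (z mod k)"

definition \<B> :: "('v, 'a, nat \<Rightarrow> nat \<Rightarrow> 'k) quiver_rep" where
  "\<B> = band_module Q b 1 c"

lemma bi_power_b: "bi_power b = BiInf line"
  by (simp add: bi_power_def line_def fun_eq_iff)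

lemma bi_infinite_line: "bi_infinite_string line"
  unfolding line_def using bi_infinite_string_of_band[OF band_b] .

lemma length_b: "2 \<le> length b"
proof -
  have "b \<noteq> []" "\<not> is_Dir (hd b)" "is_Dir (last b)"
    using band_b by (auto simp: band_def finite_string_def)
  then show ?thesis by (cases b; cases "tl b") auto
qed

lemma b_nonempty: "b \<noteq> []" and k_pos: "0 < k"
  using length_b by auto

lemma mod_k: "0 \<le> z mod k" "z mod k < k"
  using k_pos by auto

lemma line_nth: "i < length b \<Longrightarrow> line (int i) = b ! i"
  by (simp add: line_def)

lemma line_mod: "z mod k = z' mod k \<Longrightarrow> line z = line z'"
  by (simp add: line_def)

lemma line_last: "z mod k = k - 1 \<Longrightarrow> is_Dir (line z)"
  using band_b length_b by (auto simp: line_def band_def finite_string_def last_conv_nth nat_diff_distrib)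

text \<open>Unrolling the band turns the module into one with basis vectors \<open>bvec z\<close>, for \<open>z \<in> \<int>\<close>,
  subject to \<open>bvec (z + k) = c bvec z\<close>, on which every arrow acts by \<open>bvec (z - 1) \<mapsto> bvec z\<close> or
  \<open>bvec z \<mapsto> bvec (z - 1)\<close>: the eigenvalue of the last syllable is absorbed by the
  identification.  The functional \<open>coord _ z\<close> reads off the coefficient of \<open>bvec z\<close>.\<close>
definition bvec :: "int \<Rightarrow> nat \<Rightarrow> nat \<Rightarrow> 'k" where
  "bvec z = (\<lambda>i j. if j = 0 \<and> int i = z mod k then c powi ((z + 1) div k) else 0)"

definition coord :: "(nat \<Rightarrow> nat \<Rightarrow> 'k) \<Rightarrow> int \<Rightarrow> 'k" where
  "coord x z = c powi (- ((z + 1) div k)) * x (nat (z mod k)) 0"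

lemma coord_add: "coord (x + y) z = coord x z + coord y z"
  and coord_scale: "coord (band_scale d x) z = d * coord x z"
  and coord_zero [simp]: "coord 0 z = 0"
  by (simp_all add: coord_def band_scale_def algebra_simps)

lemma coord_sum: "coord (\<Sum>t\<in>A. g t) z = (\<Sum>t\<in>A. coord (g t) z)"
  by (induction A rule: infinite_finite_induct)
    (simp_all only: sum.infinite sum.empty sum.insert coord_add coord_zero not_False_eq_True)

lemma space_iff:
  "x \<in> space \<B> v \<longleftrightarrow> (\<forall>i j. x i j \<noteq> 0 \<longrightarrow> i < length b \<and> j = 0 \<and> tgt Q (line (int i)) = v)"
  by (simp add: \<B>_def band_module_def Let_def) (metis line_nth)

lemma act_apply: "act \<B> \<beta> x i j = (if i < length b \<and> j = 0 then
    (if b ! i = Dir \<beta> then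
       (if i = length b - 1 then c else 1) * x ((i + length b - 1) mod length b) 0 else 0) +
    (if b ! ((i + 1) mod length b) = Inv \<beta> then x ((i + 1) mod length b) 0 else 0) else 0)"
  by (simp add: \<B>_def band_module_def Let_def jordan_block_def)

lemma act_add: "act \<B> \<beta> (x + y) = act \<B> \<beta> x + act \<B> \<beta> y"
  and act_scale: "act \<B> \<beta> (band_scale d x) = band_scale d (act \<B> \<beta> x)"
  and act_zero: "act \<B> \<beta> 0 = 0"
  unfolding fun_eq_iff plus_fun_def zero_fun_def band_scale_def act_apply
  by (simp_all add: algebra_simps)

lemma act_sum: "act \<B> \<beta> (\<Sum>t\<in>A. g t) = (\<Sum>t\<in>A. act \<B> \<beta> (g t))"
  by (induction A rule: infinite_finite_induct)
    (simp_all only: sum.infinite sum.empty sum.insert act_add act_zero not_False_eq_True)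

lemma is_rep: "is_quiver_rep band_scale Q \<rho> \<B>"
  unfolding \<B>_def by (rule band_module_is_quiver_rep[OF band_b])

lemma act_in_space:
  "\<beta> \<in> arcs Q \<Longrightarrow> x \<in> space \<B> (tail Q \<beta>) \<Longrightarrow> act \<B> \<beta> x \<in> space \<B> (head Q \<beta>)"
  using is_rep by (auto simp: is_quiver_rep_def linear_map_on_def)

lemma div_mod_unique:
  assumes "i < length b" "z = k * q + int i"
  shows "z div k = q" "z mod k = int i"
  using int_div_pos_eq[of z k q "int i"] int_mod_pos_eq[of z k q "int i"] assms by simp_all

lemma coord_eq:
  assumes "i < length b" "z = k * q + int i"
  shows "coord x z = c powi (- (q + (if i = length b - 1 then 1 else 0))) * x i 0"
proof -
  have "(z + 1) div k = q + (if i = length b - 1 then 1 else 0)"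
  proof (cases "i = length b - 1")
    case True
    have "z + 1 = k * (q + 1) + int 0"
      using True assms(2) length_b by (simp add: algebra_simps of_nat_diff)
    then show ?thesis using div_mod_unique(1)[of 0 "z + 1" "q + 1"] True b_nonempty by simp
  next
    case False
    then have "z + 1 = k * q + int (i + 1)" "i + 1 < length b" using assms by simp_all
    then show ?thesis using div_mod_unique(1)[of "i + 1" "z + 1" q] False by simp
  qed
  then show ?thesis using div_mod_unique(2)[OF assms] by (simp add: coord_def)
qed

lemma coord_act: "coord (act \<B> \<beta> x) z =
    (if line z = Dir \<beta> then coord x (z - 1) else 0) +
    (if line (z + 1) = Inv \<beta> then coord x (z + 1) else 0)"
proof -
  define q i where "q = z div k" and "i = nat (z mod k)"
  have i: "i < length b" and z: "z = k * q + int i"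
    using mod_k[of z] by (simp_all add: q_def i_def nat_less_iff)
  have line: "line z = b ! i" using div_mod_unique[OF i z] by (simp add: line_def)
  have prev: "coord x (z - 1) = c powi (- q) * x ((i + length b - 1) mod length b) 0"
  proof (cases i)
    case 0
    then have "z - 1 = k * (q - 1) + int (length b - 1)"
      using z length_b by (simp add: algebra_simps of_nat_diff)
    from coord_eq[OF _ this] show ?thesis using length_b 0 by simp
  next
    case (Suc i')
    then have "z - 1 = k * q + int i'" using z by simp
    from coord_eq[OF _ this] show ?thesis using i Suc by (auto simp: mod_if)
  qed
  have line_next: "line (z + 1) = b ! ((i + 1) mod length b)"
  proof -
    have "(z + 1) mod k = int ((i + 1) mod length b)"
      using mod_mult_self1[of "int i + 1" q k] by (simp add: z of_nat_mod algebra_simps)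
    then show ?thesis by (simp add: line_def)
  qed
  have "next": "coord x (z + 1) =
      c powi (- (q + (if i = length b - 1 then 1 else 0))) * x ((i + 1) mod length b) 0"
    if "line (z + 1) = Inv \<beta>"
  proof (cases "i = length b - 1")
    case True
    then have "z + 1 = k * (q + 1) + int 0" using z length_b by (simp add: algebra_simps of_nat_diff)
    moreover have "(i + 1) mod length b = 0" using True b_nonempty by simp
    ultimately show ?thesis using coord_eq[of 0 "z + 1" "q + 1" x] length_b b_nonempty True by simp
  next
    case False
    then have z1: "z + 1 = k * q + int (i + 1)" and i1: "i + 1 < length b" using z i by simp_all
    \<comment> \<open>The scalar sits at the last syllable, which is direct and hence not the one followed here.\<close>
    have "i + 1 \<noteq> length b - 1"
    proof
      assume "i + 1 = length b - 1"
      then have "(z + 1) mod k = k - 1" using div_mod_unique(2)[OF i1 z1] i1 by (simp add: of_nat_diff)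
      from line_last[OF this] that show False by simp
    qed
    then show ?thesis using coord_eq[OF i1 z1] False i1 by simp
  qed
  have cancel: "c powi (- (q + 1)) * (c * w) = c powi (- q) * w" for w
    using c_nonzero power_int_add_1[of c "- (q + 1)"] by (simp flip: mult.assoc)
  have act: "act \<B> \<beta> x i 0 =
      (if line z = Dir \<beta> then
         (if i = length b - 1 then c else 1) * x ((i + length b - 1) mod length b) 0 else 0) +
      (if line (z + 1) = Inv \<beta> then x ((i + 1) mod length b) 0 else 0)"
    using i by (simp add: act_apply line line_next)
  show ?thesis
    unfolding coord_eq[OF i z] act prev
    using "next" cancel by (auto simp: distrib_left)
qed

lemma coord_inj:
  assumes "\<And>i j. x i j \<noteq> 0 \<Longrightarrow> i < length b \<and> j = 0" "\<And>i j. y i j \<noteq> 0 \<Longrightarrow> i < length b \<and> j = 0"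
    and "\<And>z. coord x z = coord y z"
  shows "x = y"
proof (intro ext)
  fix i j show "x i j = y i j"
  proof (cases "i < length b \<and> j = 0")
    case True
    then show ?thesis
      using assms(3)[of "int i"] coord_eq[of i "int i" 0] c_nonzero by simp
  next
    case False
    then show ?thesis using assms(1,2) by metis
  qed
qed

text \<open>The dual form of \<open>bvec (z + k) = c bvec z\<close>.\<close>
lemma coord_shift:
  assumes "z mod k = y mod k"
  shows "coord x z = c powi ((y - z) div k) * coord x y"
proof -
  obtain d where d: "y = z + k * d"
    using assms by (metis add.commute mod_eqE mult.commute)
  have "(y + 1) div k = (z + 1) div k + d"
    using div_mult_self1[of k "z + 1" d] k_pos by (simp add: d algebra_simps)
  then show ?thesis
    using assms b_nonempty c_nonzero
    by (simp add: coord_def d power_int_add[symmetric])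
qed

lemma coord_bvec: "coord (bvec y) z = (if z mod k = y mod k then c powi ((y - z) div k) else 0)"
proof -
  have "coord (bvec y) y = 1"
    using mod_k c_nonzero by (simp add: coord_def bvec_def power_int_add[symmetric])
  then show ?thesis
    using coord_shift[of z y "bvec y"] mod_k by (auto simp: coord_def bvec_def)
qed

lemma bvec_nonzero: "bvec y \<noteq> 0"
proof
  assume "bvec y = 0"
  then have "coord (bvec y) y = 0" by simp
  then show False by (simp add: coord_bvec)
qed

lemma bvec_support: "bvec y i j \<noteq> 0 \<Longrightarrow> i < length b \<and> j = 0"
  using mod_k(2)[of y] by (simp add: bvec_def split: if_splits)

lemma bvec_in_space: "bvec y \<in> space \<B> (tgt Q (line y))"
proof -
  have "line (int i) = line y" if "bvec y i j \<noteq> 0" for i j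
    using that by (intro line_mod) (auto simp: bvec_def split: if_splits)
  then show ?thesis using bvec_support unfolding space_iff by metis
qed

lemma act_support: "act \<B> \<beta> x i j \<noteq> 0 \<Longrightarrow> i < length b \<and> j = 0"
  unfolding act_apply by presburger

lemma act_bvec: "act \<B> \<beta> (bvec y) =
    (if line (y + 1) = Dir \<beta> then bvec (y + 1) else 0) +
    (if line y = Inv \<beta> then bvec (y - 1) else 0)"
proof (rule coord_inj[OF act_support])
  fix i j
  assume "((if line (y + 1) = Dir \<beta> then bvec (y + 1) else 0) +
    (if line y = Inv \<beta> then bvec (y - 1) else 0)) i j \<noteq> 0"
  then show "i < length b \<and> j = 0"
    using bvec_support[of "y + 1" i j] bvec_support[of "y - 1" i j]
    by (cases "bvec (y + 1) i j = 0"; cases "bvec (y - 1) i j = 0") (auto split: if_splits)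
next
  fix z
  have dir: "z mod k = (y + 1) mod k \<longleftrightarrow> (z - 1) mod k = y mod k"
    and inv: "z mod k = (y - 1) mod k \<longleftrightarrow> (z + 1) mod k = y mod k"
    by (simp_all add: mod_eq_dvd_iff algebra_simps)
  have shift: "y + 1 - z = y - (z - 1)" "y - 1 - z = y - (z + 1)" by simp_all
  have "(if line z = Dir \<beta> then coord (bvec y) (z - 1) else 0) =
      (if line (y + 1) = Dir \<beta> then coord (bvec (y + 1)) z else 0)"
    unfolding coord_bvec shift using dir line_mod[of z "y + 1"] by auto
  moreover have "(if line (z + 1) = Inv \<beta> then coord (bvec y) (z + 1) else 0) =
      (if line y = Inv \<beta> then coord (bvec (y - 1)) z else 0)"
    unfolding coord_bvec shift using inv line_mod[of "z + 1" y] by auto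
  ultimately show "coord (act \<B> \<beta> (bvec y)) z = coord ((if line (y + 1) = Dir \<beta> then bvec (y + 1) else 0) +
    (if line y = Inv \<beta> then bvec (y - 1) else 0)) z"
    unfolding coord_act coord_add by simp
qed

lemma coord_nonzero_tgt: "x \<in> space \<B> v \<Longrightarrow> coord x z \<noteq> 0 \<Longrightarrow> tgt Q (line z) = v"
  using mod_k[of z] line_mod[of "z mod k" z] unfolding coord_def space_iff
  by (metis int_nat_eq mod_mod_trivial mult_zero_right)

end

section \<open>Endomorphisms of the band module\<close>

lemma linear_map_on_sum:
  fixes scale :: "'k::field \<Rightarrow> 'm::ab_group_add \<Rightarrow> 'm"
  assumes "vector_space scale" "Modules.module.subspace scale U" "linear_map_on scale U W f"
    and "finite S" "\<And>i. i \<in> S \<Longrightarrow> h i \<in> U"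
  shows "f (\<Sum>i\<in>S. scale (a i) (h i)) = (\<Sum>i\<in>S. scale (a i) (f (h i)))"
proof -
  interpret vector_space scale by fact
  have add: "f (x + y) = f x + f y" if "x \<in> U" "y \<in> U" for x y
    using assms(3) that by (simp add: linear_map_on_def)
  have scal: "f (scale d x) = scale d (f x)" if "x \<in> U" for d x
    using assms(3) that by (simp add: linear_map_on_def)
  have zero: "f 0 = 0" using add[of 0 0] subspace_0[OF assms(2)] by simp
  show ?thesis
    using assms(4,5)
  proof (induction S rule: finite_induct)
    case (insert i S)
    have "scale (a i) (h i) \<in> U" using subspace_scale[OF assms(2)] insert.prems by simp
    moreover have "(\<Sum>i\<in>S. scale (a i) (h i)) \<in> U"
      using insert.prems by (intro subspace_sum[OF assms(2)] subspace_scale[OF assms(2)]) auto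
    ultimately show ?case using insert add scal by simp
  qed (simp add: zero)
qed

text \<open>The nilpotent part of the Jordan block, applied to all the spaces \<open>V\<^bsub>i\<^esub>\<close> at once, is an
  endomorphism.\<close>
lemma (in string_algebra) band_module_not_brick:
  fixes c :: "'k::field"
  assumes band: "band Q \<rho> b" and n: "n \<ge> 2"
  shows "\<not> brick band_scale Q \<rho> (band_module Q b n c)"
proof
  let ?M = "band_module Q b n c"
  assume brick: "brick band_scale Q \<rho> ?M"
  have b: "b \<noteq> []" "set b \<subseteq> syllables Q" using band by (auto simp: band_def finite_string_def)
  define N where "N x = (\<lambda>i j. x i (Suc j))" for x :: "nat \<Rightarrow> nat \<Rightarrow> 'k"
  have space: "x \<in> space ?M v \<longleftrightarrow> (\<forall>i j. x i j \<noteq> 0 \<longrightarrow> i < length b \<and> j < n \<and> tgt Q (b ! i) = v)"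
    for x v by (simp add: band_module_def Let_def)
  have jordan: "(\<Sum>l<n. jordan_block n c $$ (j, l) * x l) =
      c * x j + (if Suc j < n then x (Suc j) else 0)" if "j < n" for j and x :: "nat \<Rightarrow> 'k"
  proof -
    have "(\<Sum>l<n. jordan_block n c $$ (j, l) * x l) =
        (\<Sum>l<n. (if l = j then c * x l else 0) + (if l = Suc j then x l else 0))"
      using that by (intro sum.cong) (auto simp: jordan_block_def)
    then show ?thesis using that by (simp add: sum.distrib)
  qed
  have act: "act ?M \<beta> x i j = (if i < length b \<and> j < n then
      (if b ! i = Dir \<beta> then
         (if i = length b - 1
          then c * x ((i + length b - 1) mod length b) j +
            (if Suc j < n then x ((i + length b - 1) mod length b) (Suc j) else 0)
          else x ((i + length b - 1) mod length b) j) else 0) +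
      (if b ! ((i + 1) mod length b) = Inv \<beta> then x ((i + 1) mod length b) j else 0) else 0)"
    for \<beta> x i j
    by (simp add: band_module_def Let_def jordan del: jordan_block_index)
  have act_in: "act ?M \<alpha> x \<in> space ?M (head Q \<alpha>)"
    if "\<alpha> \<in> arcs Q" "x \<in> space ?M (tail Q \<alpha>)" for \<alpha> x
    using band_module_is_quiver_rep[OF band, of n c] that
    unfolding is_quiver_rep_def linear_map_on_def by blast
  have N_in: "N x \<in> space ?M v" if "x \<in> space ?M v" for x v
    using that unfolding space N_def by (meson Suc_lessD)
  have act_N: "act ?M \<alpha> (N x) = N (act ?M \<alpha> x)" if "x \<in> space ?M v" for \<alpha> v x
  proof (intro ext)
    fix i j
    have zero: "x i j = 0" if "n \<le> j" for i j
      using \<open>x \<in> space ?M v\<close> that unfolding space by (meson leD)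
    show "act ?M \<alpha> (N x) i j = N (act ?M \<alpha> x) i j"
    proof (cases "i < length b \<and> Suc j < n")
      case True
      then show ?thesis using zero by (simp add: N_def act)
    next
      case False
      then consider "\<not> i < length b" | "n \<le> Suc j" by linarith
      then show ?thesis
      proof cases
        case 2
        then show ?thesis using zero by (simp add: N_def act)
      qed (simp add: N_def act)
    qed
  qed
  define f where "f = (\<lambda>v\<in>verts Q. \<lambda>x\<in>space ?M v. N x)"
  have N_add: "N (x + y) = N x + N y" and N_scale: "N (band_scale d x) = band_scale d (N x)" for x y d
    by (auto simp: N_def band_scale_def fun_eq_iff)
  have sub: "x + y \<in> space ?M v" "band_scale d x \<in> space ?M v"
    if "x \<in> space ?M v" "y \<in> space ?M v" for x y v d
    using that unfolding space by (auto simp: band_scale_def) (metis add.right_neutral)+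
  have "f \<in> rep_endos band_scale Q ?M"
    unfolding rep_endos_def
    using N_in act_N act_in sub
    by (auto simp: f_def linear_map_on_def N_add N_scale)
  from brickD[OF brick this] obtain d where
    d: "\<forall>v\<in>verts Q. \<forall>x\<in>space ?M v. f v x = band_scale d x" by blast
  define e :: "nat \<Rightarrow> nat \<Rightarrow> 'k" where "e = (\<lambda>i j. if i = 0 \<and> j = 1 then 1 else 0)"
  let ?v = "tgt Q (b ! 0)"
  have "e \<in> space ?M ?v" using b n by (auto simp: space e_def split: if_splits)
  moreover have "?v \<in> verts Q"
    using b nth_mem[of 0 b] by (cases "b ! 0") (auto simp: syllables_def letters_over_def)
  ultimately have "N e = band_scale d e" using d by (simp add: f_def)
  then have "N e 0 0 = band_scale d e 0 0" by simp
  then show False by (simp add: N_def e_def band_scale_def)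
qed

context string_band
begin

lemma space_subspace: "v \<in> verts Q \<Longrightarrow> Modules.module.subspace band_scale (space \<B> v)"
  using is_rep by (simp add: is_quiver_rep_def)

lemma tgt_line_verts: "tgt Q (line z) \<in> verts Q"
  using syllable_ends bi_infinite_string_syllable[OF bi_infinite_line] by blast

lemma periodic_match:
  assumes period: "\<And>z z'. z mod k = z' mod k \<Longrightarrow> L' z = L' z'"
    and match: "\<And>t. t < length b \<Longrightarrow> line (y + int t) = L' (z + int t)"
  shows "line (y + x) = L' (z + x)"
proof -
  define t where "t = nat (x mod k)"
  have t: "t < length b" "int t = x mod k" using mod_k[of x] by (auto simp: t_def)
  have "line (y + x) = line (y + int t)" by (intro line_mod) (simp add: t mod_add_right_eq)
  moreover have "L' (z + x) = L' (z + int t)" by (intro period) (simp add: t mod_add_right_eq)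
  ultimately show ?thesis using match[OF t(1)] by metis
qed

text \<open>Passing to the factor string and then embedding it as an image string is an endomorphism.  The
  string is shorter than the band, so that the endomorphism kills some \<open>bvec\<close> and is not scalar.
  The family \<open>V\<close> is \<open>bvec\<close> read forwards or backwards.\<close>
lemma admissible_pair_not_brick:
  assumes pair: "admissible_pair line L'"
    and L': "bi_infinite_string L'"
    and period: "\<And>z z'. z mod k = z' mod k \<Longrightarrow> L' z = L' z'"
    and act_V: "\<And>\<beta> z. act \<B> \<beta> (V z) =
      (if L' (z + 1) = Dir \<beta> then V (z + 1) else 0) + (if L' z = Inv \<beta> then V (z - 1) else 0)"
    and V_in: "\<And>z. V z \<in> space \<B> (tgt Q (L' z))"
    and V_nonzero: "\<And>z. V z \<noteq> 0"
  shows "\<not> brick band_scale Q \<rho> \<B>"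
proof
  assume brick: "brick band_scale Q \<rho> \<B>"
  interpret VS: vector_space "band_scale :: 'k \<Rightarrow> _" by (rule vector_space_band_scale)
  note bi_infinite_line [simp]
  obtain y z m where start: "before (line y) = before (L' z)"
    and match: "\<And>t. t < m \<Longrightarrow> line (y + int t) = L' (z + int t)"
    and ends: "\<not> is_Dir (line (y - 1))" "is_Dir (line (y + int m))"
      "is_Dir (L' (z - 1))" "\<not> is_Dir (L' (z + int m))"
    using pair unfolding admissible_pair_def by blast
  \<comment> \<open>A match over a whole period would continue over both ends; one letter less, and the letter
    before the factor string would be the letter after it.\<close>
  have short: "int m + 1 < k"
  proof (rule ccontr)
    assume "\<not> ?thesis"
    then consider "length b \<le> m" | "int m = k - 1" by linarith
    then show False
    proof cases
      case 1
      then have "line (y + int t) = L' (z + int t)" if "t < length b" for t using match that by simp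
      from periodic_match[of L' y z "- 1", OF period this] show False using ends by simp
    next
      case 2
      then have "line (y + int m) = line (y - 1)" by (intro line_mod) (simp add: mod_eq_dvd_iff)
      then show False using ends by simp
    qed
  qed
  define X where "X x t = coord x (y - 1 + int t)" for x t
  define W where "W t = V (z - 1 + int t)" for t
  define g where "g x = (\<Sum>t<Suc m. band_scale (X x t) (W t))" for x
  \<comment> \<open>Both sides are the sum \<open>D + I\<close> over the direct and the inverse letters inside the string: at
    its ends, arrows only leave the factor string and only enter the image string.\<close>
  have g_act: "act \<B> \<beta> (g x) = g (act \<B> \<beta> x)" for \<beta> x
  proof -
    define D where "D = (\<Sum>t<m. if line (y + int t) = Dir \<beta> then band_scale (X x t) (W (Suc t)) else 0)"
    define I where "I = (\<Sum>t<m. if line (y + int t) = Inv \<beta> then band_scale (X x (Suc t)) (W t) else 0)"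
    have if_scale: "band_scale a (if P then w else 0) = (if P then band_scale a w else 0)"
      "band_scale (if P then a else 0) w = (if P then band_scale a w else 0)"
      for a :: 'k and P w by (simp_all only: VS.scale_zero_right VS.scale_zero_left if_distrib split: if_split) simp_all
    have act_W: "act \<B> \<beta> (W t) = (if L' (z + int t) = Dir \<beta> then W (Suc t) else 0) +
        (if L' (z - 1 + int t) = Inv \<beta> then V (z - 1 + int t - 1) else 0)" for t
      unfolding W_def act_V by (simp add: algebra_simps)
    have "act \<B> \<beta> (g x) = (\<Sum>t<Suc m. if L' (z + int t) = Dir \<beta> then band_scale (X x t) (W (Suc t)) else 0) +
        (\<Sum>t<Suc m. if L' (z - 1 + int t) = Inv \<beta> then band_scale (X x t) (V (z - 1 + int t - 1)) else 0)"
      unfolding g_def act_sum act_scale act_W VS.scale_right_distrib if_scale sum.distrib ..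
    also have "(\<Sum>t<Suc m. if L' (z + int t) = Dir \<beta> then band_scale (X x t) (W (Suc t)) else 0) = D"
      using ends(4) match by (auto simp: D_def simp del: of_nat_Suc intro!: sum.cong)
    also have "(\<Sum>t<Suc m. if L' (z - 1 + int t) = Inv \<beta> then band_scale (X x t) (V (z - 1 + int t - 1)) else 0) = I"
      unfolding sum.lessThan_Suc_shift
      using ends(3) match by (auto simp: I_def W_def algebra_simps intro!: sum.cong)
    finally have lhs: "act \<B> \<beta> (g x) = D + I" .
    have X_act: "X (act \<B> \<beta> x) t = (if line (y - 1 + int t) = Dir \<beta> then coord x (y - 1 + int t - 1) else 0) +
        (if line (y + int t) = Inv \<beta> then X x (Suc t) else 0)" for t
      unfolding X_def coord_act by (simp add: algebra_simps)
    have "g (act \<B> \<beta> x) = (\<Sum>t<Suc m. if line (y - 1 + int t) = Dir \<beta> then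
          band_scale (coord x (y - 1 + int t - 1)) (W t) else 0) +
        (\<Sum>t<Suc m. if line (y + int t) = Inv \<beta> then band_scale (X x (Suc t)) (W t) else 0)"
      unfolding g_def X_act VS.scale_left_distrib if_scale sum.distrib ..
    also have "(\<Sum>t<Suc m. if line (y - 1 + int t) = Dir \<beta> then
          band_scale (coord x (y - 1 + int t - 1)) (W t) else 0) = D"
      unfolding sum.lessThan_Suc_shift
      using ends(1) by (auto simp: D_def X_def algebra_simps intro!: sum.cong)
    also have "(\<Sum>t<Suc m. if line (y + int t) = Inv \<beta> then band_scale (X x (Suc t)) (W t) else 0) = I"
      using ends(2) by (auto simp: I_def simp del: of_nat_Suc intro!: sum.cong)
    finally show ?thesis unfolding lhs by (rule sym)
  qed
  have tgt_eq: "tgt Q (line (y - 1 + int t)) = tgt Q (L' (z - 1 + int t))" if "t \<le> m" for t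
  proof (cases t)
    case 0
    then show ?thesis
      using start after_eq_before_next[of line "y - 1"] after_eq_before_next[OF L', of "z - 1"]
      by (simp add: after_def before_def)
  next
    case (Suc t')
    then show ?thesis using match[of t'] that by simp
  qed
  have g_in: "g x \<in> space \<B> v" if "v \<in> verts Q" "x \<in> space \<B> v" for v x
    unfolding g_def
  proof (rule VS.subspace_sum[OF space_subspace[OF that(1)]])
    fix t assume "t \<in> {..<Suc m}"
    then have t: "t \<le> m" by auto
    show "band_scale (X x t) (W t) \<in> space \<B> v"
    proof (cases "X x t = 0")
      case True
      then show ?thesis using VS.subspace_0[OF space_subspace[OF that(1)]] by (simp only: VS.scale_zero_left)
    next
      case False
      then have "tgt Q (line (y - 1 + int t)) = v"
        using coord_nonzero_tgt[OF that(2)] by (simp add: X_def)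
      then have "W t \<in> space \<B> v" using V_in[of "z - 1 + int t"] tgt_eq[OF t] by (simp add: W_def)
      then show ?thesis by (rule VS.subspace_scale[OF space_subspace[OF that(1)]])
    qed
  qed
  have g_add: "g (x + x') = g x + g x'" for x x'
    unfolding g_def X_def coord_add VS.scale_left_distrib sum.distrib ..
  have g_scale: "g (band_scale d x) = band_scale d (g x)" for d x
    unfolding g_def X_def coord_scale VS.scale_sum_right VS.scale_scale ..
  define f where "f = (\<lambda>v\<in>verts Q. \<lambda>x\<in>space \<B> v. g x)"
  have closed: "x + x' \<in> space \<B> v" "band_scale d x \<in> space \<B> v"
    if "v \<in> verts Q" "x \<in> space \<B> v" "x' \<in> space \<B> v" for v x x' d
    using that VS.subspace_add[OF space_subspace] VS.subspace_scale[OF space_subspace] by blast+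
  have "linear_map_on band_scale (space \<B> v) (space \<B> v) (f v)" if "v \<in> verts Q" for v
    unfolding linear_map_on_def f_def using that closed g_in
    by (simp add: g_add g_scale)
  moreover have "f (head Q \<alpha>) (act \<B> \<alpha> x) = act \<B> \<alpha> (f (tail Q \<alpha>) x)"
    if "\<alpha> \<in> arcs Q" "x \<in> space \<B> (tail Q \<alpha>)" for \<alpha> x
    using that act_in_space by (simp add: f_def g_act)
  moreover have "f \<in> (\<Pi>\<^sub>E v\<in>verts Q. space \<B> v \<rightarrow>\<^sub>E space \<B> v)"
    using g_in by (auto simp: f_def)
  ultimately have "f \<in> rep_endos band_scale Q \<B>" by (simp add: rep_endos_def)
  from brickD[OF brick this] obtain d where
    "\<forall>v\<in>verts Q. \<forall>x\<in>space \<B> v. f v x = band_scale d x" by blast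
  then have d: "g (bvec u) = band_scale d (bvec u)" for u
    using tgt_line_verts[of u] bvec_in_space[of u] by (simp add: f_def)
  have X_bvec: "X (bvec u) t = 0" if "\<bar>u - (y - 1 + int t)\<bar> < k" "u \<noteq> y - 1 + int t" for u t
  proof -
    have "\<not> k dvd (y - 1 + int t) - u"
      using that zdvd_not_zless[of "\<bar>y - 1 + int t - u\<bar>" k] by auto
    then show ?thesis by (simp add: X_def coord_bvec mod_eq_dvd_iff)
  qed
  \<comment> \<open>The first basis vector to the right of the factor string is killed, so \<open>d = 0\<close>; the leftmost
    one of the string is not.\<close>
  have "X (bvec (y + int m)) t = 0" if "t < Suc m" for t
    using short that by (intro X_bvec) auto
  then have "g (bvec (y + int m)) = 0" unfolding g_def by (intro sum.neutral) simp
  then have "d = 0" using d[of "y + int m"] bvec_nonzero VS.scale_eq_0_iff by metis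
  then have "g (bvec (y - 1)) = 0" using d[of "y - 1"] VS.scale_zero_left by metis
  moreover have "g (bvec (y - 1)) = W 0"
  proof -
    have "X (bvec (y - 1)) (Suc t) = 0" if "t < m" for t using short that by (intro X_bvec) auto
    moreover have "X (bvec (y - 1)) 0 = 1" by (simp add: X_def coord_bvec)
    ultimately show ?thesis unfolding g_def sum.lessThan_Suc_shift by simp
  qed
  ultimately show False using V_nonzero by (simp add: W_def)
qed

text \<open>If \<open>line\<close> also has the period \<open>z - y\<close>, it has the period \<open>gcd k (z - y)\<close>, so that
  \<open>b\<close> is a power of its initial part of that length; since \<open>b\<close> is not a proper power, the length
  is \<open>k\<close>.\<close>
lemma line_shift_dvd:
  assumes "\<And>x. line (y + x) = line (z + x)"
  shows "k dvd z - y"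
proof -
  define d where "d = z - y"
  define h where "h = nat (gcd k d)"
  have h: "int h = gcd k d" "0 < h" using k_pos by (simp_all add: h_def)
  have shift1: "line (x + d) = line x" for x using assms[of "x - y"] by (simp add: d_def algebra_simps)
  have shift: "line (x + v * d) = line x" for x v
  proof (induction v rule: int_induct[where k = 0])
    case (step1 v)
    then show ?case using shift1[of "x + v * d"] by (simp add: algebra_simps)
  next
    case (step2 v)
    then show ?case using shift1[of "x + (v - 1) * d"] by (simp add: algebra_simps)
  qed simp
  obtain u v where "u * k + v * d = gcd k d" using bezout_int by blast
  then have shift_h: "line (x + int h) = line x" for x
    using shift[of "x + u * k" v] line_mod[of "x + u * k" x] by (simp add: h(1) algebra_simps)
  have line_h: "line (int i) = line (int (i mod h))" for i
  proof (induction i rule: less_induct)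
    case (less i)
    show ?case
    proof (cases "i < h")
      case False
      then have "line (int i) = line (int (i - h))" using shift_h[of "int (i - h)"] by (simp add: of_nat_diff)
      also have "\<dots> = line (int ((i - h) mod h))" using False h(2) by (intro less.IH) auto
      finally show ?thesis using False by (simp add: le_mod_geq)
    qed simp
  qed
  obtain m where m: "length b = h * m"
  proof -
    have "int h dvd int (length b)" using h(1) by simp
    then show thesis using that unfolding of_nat_dvd_iff by blast
  qed
  have nth_power: "concat (replicate m u) ! i = u ! (i mod length u)" if "i < m * length u"
    for m i and u :: "'a letter list"
    using that
  proof (induction m arbitrary: i)
    case (Suc m)
    then show ?case by (cases "i < length u") (auto simp: nth_append le_mod_geq)
  qed simp
  have m_pos: "0 < m" using m b_nonempty by (cases m) auto
  then have "h \<le> length b" using m by simp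
  then have len: "length (take h b) = h" by simp
  have "b = concat (replicate m (take h b))"
  proof (rule nth_equalityI)
    show "length b = length (concat (replicate m (take h b)))"
      using len m by (simp add: length_concat sum_list_replicate)
    fix i assume i: "i < length b"
    have "i mod h < h" using h(2) by simp
    then have "b ! i = take h b ! (i mod h)"
      using line_h[of i] i line_nth[of i] line_nth[of "i mod h"] \<open>h \<le> length b\<close> by simp
    then show "b ! i = concat (replicate m (take h b)) ! i"
      using nth_power[of i m "take h b"] i m len by (simp add: mult.commute)
  qed
  moreover have "\<not> (\<exists>u m. m \<ge> 2 \<and> b = concat (replicate m u))"
    using band_b by (simp add: band_def)
  ultimately have "\<not> m \<ge> 2" by blast
  with m_pos have "m = 1" by simp
  then have "k = gcd k d" using m h(1) by simp
  then show ?thesis unfolding d_def by (metis gcd_dvd2)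
qed

text \<open>A string that is its own inverse would have to turn back at the centre of the reflection.\<close>
lemma line_not_self_inverse: "\<exists>x. line (y + x) \<noteq> reflect line (z + x)"
proof (rule ccontr)
  assume "\<not> ?thesis"
  then have *: "line (y + x) = reflect line (z + x)" for x by blast
  define e where "e = 1 - z + y"
  have eq: "line u = linv (line (e - u))" for u
    using *[of "u - y"] by (simp add: reflect_def e_def algebra_simps)
  show False
  proof (cases "even e")
    case True
    then have "e - e div 2 = e div 2" by (auto elim: evenE)
    then show False using eq[of "e div 2"] linv_neq by metis
  next
    case False
    then have "e - e div 2 = e div 2 + 1" by (auto elim: oddE)
    then show False
      using eq[of "e div 2"] bi_infinite_string_no_backtrack[OF bi_infinite_line, of "e div 2"] by metis
  qed
qed

lemma one_sided_match:
  assumes period: "\<And>z z'. z mod k = z' mod k \<Longrightarrow> L' z = L' z'"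
    and "(\<forall>t. line (y + 1 + int t) = L' (z + 1 + int t)) \<or> (\<forall>t. line (y - int t) = L' (z - int t))"
  shows "line (y + x) = L' (z + x)"
  using assms(2)
proof
  assume "\<forall>t. line (y + 1 + int t) = L' (z + 1 + int t)"
  then have "line (y + 1 + int t) = L' (z + 1 + int t)" if "t < length b" for t by blast
  from periodic_match[of L' "y + 1" "z + 1" "x - 1", OF period this] show ?thesis by simp
next
  assume *: "\<forall>t. line (y - int t) = L' (z - int t)"
  have "line (y - (k - 1) + int t) = L' (z - (k - 1) + int t)" if "t < length b" for t
    using *[rule_format, of "length b - 1 - t"] that by (simp add: of_nat_diff algebra_simps)
  from periodic_match[of L' "y - (k - 1)" "z - (k - 1)" "x + k - 1", OF period this]
  show ?thesis by simp
qed

lemma reflect_line_mod: "z mod k = z' mod k \<Longrightarrow> reflect line z = reflect line z'"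
  unfolding reflect_def by (metis line_mod mod_diff_right_eq)

lemma expand_in_bvec:
  assumes "x \<in> space \<B> v"
  shows "x = (\<Sum>i \<in> {i. i < length b \<and> tgt Q (line (int i)) = v}. band_scale (coord x (int i)) (bvec (int i)))"
    (is "x = sum ?h ?S")
proof (rule coord_inj)
  show "i < length b \<and> j = 0" if "x i j \<noteq> 0" for i j using assms that by (auto simp: space_iff)
  have "sum ?h A i j = (\<Sum>l\<in>A. ?h l i j)" for A i j
    by (induction A rule: infinite_finite_induct) auto
  then show "i < length b \<and> j = 0" if "sum ?h ?S i j \<noteq> 0" for i j
    using that bvec_support by (metis (no_types, lifting) band_scale_def mult_zero_right sum.neutral)
  fix z
  define l where "l = nat (z mod k)"
  have l: "int l = z mod k" "l < length b" using mod_k[of z] by (auto simp: l_def)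
  have "coord (sum ?h ?S) z = (\<Sum>i\<in>?S. if i = l then coord x z else 0)"
    unfolding coord_sum
  proof (intro sum.cong refl)
    fix i assume "i \<in> ?S"
    then have "z mod k = int i mod k \<longleftrightarrow> i = l" using l by auto
    then show "coord (?h i) z = (if i = l then coord x z else 0)"
      using coord_shift[of z "int i" x] by (auto simp: coord_scale coord_bvec)
  qed
  also have "\<dots> = coord x z"
  proof (cases "coord x z = 0")
    case False
    then have "tgt Q (line (int l)) = v"
      using coord_nonzero_tgt[OF assms] line_mod[of "int l" z] l by simp
    then show ?thesis using l(2) by simp
  qed simp
  finally show "coord x z = coord (sum ?h ?S) z" by simp
qed

lemma no_admissible_pair_brick:
  assumes no_pair: "\<not> admissible_pair line line" "\<not> admissible_pair line (reflect line)"
  shows "brick band_scale Q \<rho> \<B>"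
proof (rule brickI[OF is_rep])
  show "tail Q \<alpha> \<in> verts Q \<and> head Q \<alpha> \<in> verts Q" if "\<alpha> \<in> arcs Q" for \<alpha> using that by simp
  show "tgt Q (line 0) \<in> verts Q" "bvec 0 \<in> space \<B> (tgt Q (line 0))" "bvec 0 \<noteq> 0"
    by (rule tgt_line_verts bvec_in_space bvec_nonzero)+
next
  fix f assume f: "f \<in> rep_endos band_scale Q \<B>"
  note line = bi_infinite_line
  note refl_line = bi_infinite_string_reflect[OF line]
  have lin: "linear_map_on band_scale (space \<B> v) (space \<B> v) (f v)" if "v \<in> verts Q" for v
    using f that by (simp add: rep_endos_def)
  have comm: "f (head Q \<alpha>) (act \<B> \<alpha> x) = act \<B> \<alpha> (f (tail Q \<alpha>) x)"
    if "\<alpha> \<in> arcs Q" "x \<in> space \<B> (tail Q \<alpha>)" for \<alpha> x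
    using f that by (simp add: rep_endos_def)
  define F where "F y = f (tgt Q (line y)) (bvec y)" for y
  define G where "G z y = coord (F y) z" for z y
  have F_in: "F y \<in> space \<B> (tgt Q (line y))" for y
    using lin[OF tgt_line_verts] bvec_in_space unfolding F_def linear_map_on_def by blast
  have step: "tgt Q (line z) = src Q (line (z + 1))" for z
    using after_eq_before_next[OF line, of z] by (simp add: after_def before_def)
  have G: "intertwines line line G"
    unfolding intertwines_def
  proof (intro allI ballI impI)
    fix y z \<beta> assume \<beta>: "\<beta> \<in> arcs Q" and tgt: "tgt Q (line y) = tail Q \<beta>"
    have V: "head Q \<beta> \<in> verts Q" using \<beta> by simp
    note sub = space_subspace[OF V]
    interpret VS: vector_space "band_scale :: 'k \<Rightarrow> _" by (rule vector_space_band_scale)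
    let ?d = "if line (y + 1) = Dir \<beta> then bvec (y + 1) else 0"
    let ?i = "if line y = Inv \<beta> then bvec (y - 1) else 0"
    have dir: "tgt Q (line (y + 1)) = head Q \<beta>" if "line (y + 1) = Dir \<beta>" using that by simp
    have inv: "tgt Q (line (y - 1)) = head Q \<beta>" if "line y = Inv \<beta>" using that step[of "y - 1"] by simp
    have in_space: "?d \<in> space \<B> (head Q \<beta>)" "?i \<in> space \<B> (head Q \<beta>)"
      using dir inv bvec_in_space[of "y + 1"] bvec_in_space[of "y - 1"] VS.subspace_0[OF sub] by auto
    have f0: "f (head Q \<beta>) 0 = 0"
      using linear_map_on_sum[OF vector_space_band_scale sub lin[OF V], of "{}"] by simp
    have "act \<B> \<beta> (F y) = f (head Q \<beta>) (act \<B> \<beta> (bvec y))"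
      using comm[OF \<beta>, of "bvec y"] bvec_in_space[of y] by (simp add: F_def tgt)
    also have "\<dots> = f (head Q \<beta>) ?d + f (head Q \<beta>) ?i"
      unfolding act_bvec using lin[OF V] in_space unfolding linear_map_on_def by blast
    also have "f (head Q \<beta>) ?d = (if line (y + 1) = Dir \<beta> then F (y + 1) else 0)"
      using dir f0 by (auto simp: F_def)
    also have "f (head Q \<beta>) ?i = (if line y = Inv \<beta> then F (y - 1) else 0)"
      using inv f0 by (auto simp: F_def)
    finally have "coord (act \<B> \<beta> (F y)) z = coord (if line (y + 1) = Dir \<beta> then F (y + 1) else 0) z +
      coord (if line y = Inv \<beta> then F (y - 1) else 0) z" by (simp only: coord_add)
    then show "(if line (y + 1) = Dir \<beta> then G z (y + 1) else 0) + (if line y = Inv \<beta> then G z (y - 1) else 0) =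
      (if line z = Dir \<beta> then G (z - 1) y else 0) + (if line (z + 1) = Inv \<beta> then G (z + 1) y else 0)"
      unfolding coord_act G_def by (auto split: if_splits)
  qed
  have G_reflect: "intertwines line (reflect line) (\<lambda>z y. G (- z) y)"
    unfolding intertwines_def
  proof (intro allI ballI impI)
    fix y z \<beta> assume "\<beta> \<in> arcs Q" "tgt Q (line y) = tail Q \<beta>"
    then have eq: "(if line (y + 1) = Dir \<beta> then G (- z) (y + 1) else 0) +
        (if line y = Inv \<beta> then G (- z) (y - 1) else 0) =
      (if line (- z) = Dir \<beta> then G (- z - 1) y else 0) +
        (if line (- z + 1) = Inv \<beta> then G (- z + 1) y else 0)"
      using G unfolding intertwines_def by blast
    have "reflect line z = Dir \<beta> \<longleftrightarrow> line (- z + 1) = Inv \<beta>"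
      "reflect line (z + 1) = Inv \<beta> \<longleftrightarrow> line (- z) = Dir \<beta>"
      "- (z - 1) = - z + 1" "- (z + 1) = - z - 1"
      by (auto simp: reflect_def linv_eq_iff)
    then show "(if line (y + 1) = Dir \<beta> then G (- z) (y + 1) else 0) +
        (if line y = Inv \<beta> then G (- z) (y - 1) else 0) =
      (if reflect line z = Dir \<beta> then G (- (z - 1)) y else 0) +
        (if reflect line (z + 1) = Inv \<beta> then G (- (z + 1)) y else 0)"
      using eq by (simp only: add.commute)
  qed
  \<comment> \<open>At a common vertex the signs of \<open>y\<close> and \<open>z\<close> either agree, so that right is compared with
    right, or are opposite, so that right is compared with left.\<close>
  have diagonal: "k dvd z - y" if nz: "G z y \<noteq> 0" for z y
  proof -
    have tgt: "tgt Q (line z) = tgt Q (line y)"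
      using coord_nonzero_tgt[OF F_in] nz by (simp add: G_def)
    have "tsign \<sigma> \<epsilon> (line u) \<in> {- 1, 1}" for u
      using syllable_ends(4) bi_infinite_string_syllable[OF line] by blast
    from this[of z] this[of y] consider "after (line y) = after (line z)" |
      "after (line y) = after (reflect line (- z))"
      using tgt by (auto simp: after_reflect[OF line]) (auto simp: after_def)
    then show ?thesis
    proof cases
      case 1
      from one_sided_match[OF line_mod intertwines_zero_or_match[OF line line G 1 nz no_pair(1)]]
      show ?thesis by (rule line_shift_dvd)
    next
      case 2
      have "G (- (- z)) y \<noteq> 0" using nz by simp
      from one_sided_match[OF reflect_line_mod
          intertwines_zero_or_match[OF line refl_line G_reflect 2 this no_pair(2)]]
      show ?thesis using line_not_self_inverse by blast
    qed
  qed
  have "G (y + 1) (y + 1) = G y y" for y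
    using intertwines_step(1)[OF line line G] by blast
  then have const: "G y y = G 0 0" for y
  proof (induction y rule: int_induct[where k = 0])
    case (step2 i)
    from step2.prems[of "i - 1"] step2 show ?case by simp
  qed simp_all
  have F_eq: "F y = band_scale (G 0 0) (bvec y)" for y
  proof (rule coord_inj)
    show "i < length b \<and> j = 0" if "F y i j \<noteq> 0" for i j
      using F_in[of y] that by (auto simp: space_iff)
    show "i < length b \<and> j = 0" if "band_scale (G 0 0) (bvec y) i j \<noteq> 0" for i j
      using that bvec_support[of y i j] by (simp add: band_scale_def)
    fix z
    have "coord (F y) z = (if z mod k = y mod k then c powi ((y - z) div k) * G 0 0 else 0)"
      using coord_shift[of z y "F y"] const[of y] diagonal[of z y] by (auto simp: G_def mod_eq_dvd_iff)
    then show "coord (F y) z = coord (band_scale (G 0 0) (bvec y)) z"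
      by (simp add: coord_scale coord_bvec)
  qed
  have "f v x = band_scale (G 0 0) x" if v: "v \<in> verts Q" and x: "x \<in> space \<B> v" for v x
  proof -
    interpret VS: vector_space "band_scale :: 'k \<Rightarrow> _" by (rule vector_space_band_scale)
    let ?S = "{i. i < length b \<and> tgt Q (line (int i)) = v}"
    note expand = expand_in_bvec[OF x]
    have "f v x = (\<Sum>i\<in>?S. band_scale (coord x (int i)) (f v (bvec (int i))))"
      by (subst expand, rule linear_map_on_sum[OF vector_space_band_scale space_subspace[OF v] lin[OF v]])
        (use bvec_in_space in auto)
    also have "\<dots> = (\<Sum>i\<in>?S. band_scale (coord x (int i)) (band_scale (G 0 0) (bvec (int i))))"
      using F_eq by (intro sum.cong) (auto simp: F_def)
    also have "\<dots> = band_scale (G 0 0) (\<Sum>i\<in>?S. band_scale (coord x (int i)) (bvec (int i)))"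
      unfolding VS.scale_sum_right VS.scale_left_commute[of _ "G 0 0"] ..
    also have "\<dots> = band_scale (G 0 0) x" using expand by simp
    finally show ?thesis .
  qed
  then show "\<exists>d. \<forall>v\<in>verts Q. \<forall>x\<in>space \<B> v. f v x = band_scale d x" by blast
qed

theorem brick_iff_no_admissible_pair:
  "brick band_scale Q \<rho> \<B> \<longleftrightarrow> \<not> admissible_pair line line \<and> \<not> admissible_pair line (reflect line)"
proof (intro iffI conjI notI)
  assume brick: "brick band_scale Q \<rho> \<B>" and "admissible_pair line line"
  then show False
    using admissible_pair_not_brick[of line bvec] bi_infinite_line line_mod act_bvec bvec_in_space
      bvec_nonzero by blast
next
  assume brick: "brick band_scale Q \<rho> \<B>" and pair: "admissible_pair line (reflect line)"
  have "\<not> brick band_scale Q \<rho> \<B>"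
  proof (rule admissible_pair_not_brick[OF pair bi_infinite_string_reflect[OF bi_infinite_line] reflect_line_mod])
    fix \<beta> z
    have "reflect line z = Inv \<beta> \<longleftrightarrow> line (- z + 1) = Dir \<beta>"
      "reflect line (z + 1) = Dir \<beta> \<longleftrightarrow> line (- z) = Inv \<beta>"
      "- (z - 1) = - z + 1" "- (z + 1) = - z - 1"
      by (auto simp: reflect_def linv_eq_iff)
    then show "act \<B> \<beta> (bvec (- z)) = (if reflect line (z + 1) = Dir \<beta> then bvec (- (z + 1)) else 0) +
      (if reflect line z = Inv \<beta> then bvec (- (z - 1)) else 0)"
      unfolding act_bvec by (simp only: add.commute)
    show "bvec (- z) \<in> space \<B> (tgt Q (reflect line z))"
      using bvec_in_space[of "- z"] tgt_reflect[OF bi_infinite_line] by simp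
    show "bvec (- z) \<noteq> 0" by (rule bvec_nonzero)
  qed
  with brick show False by contradiction
qed (use no_admissible_pair_brick in blast)

end

section \<open>The brick criterion\<close>

theorem theorem1p4:
  fixes Q :: "('v, 'a) pre_digraph" and \<rho> :: "'a list set" and \<sigma> \<epsilon> :: "'a \<Rightarrow> int"
    and b :: "'a letter list" and n :: nat and c :: "'k::alg_closed_field"
  assumes "signed_string_algebra Q \<rho> \<sigma> \<epsilon>"
    and "band Q \<rho> b"
    and "n \<ge> 1"
    and "c \<noteq> 0"
  shows "brick band_scale Q \<rho> (band_module Q b n c) \<longleftrightarrow>
    n = 1 \<and>
    (\<forall>w \<in> Phi ` word_class Q \<rho> \<sigma> \<epsilon> (Syl (bi_power b)).
       weak_brick_word (mia_string_delta Q \<rho> \<sigma> \<epsilon>) w)"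
proof -
  interpret signed_string_algebra Q \<rho> \<sigma> \<epsilon> by fact
  show ?thesis
  proof (cases "n = 1")
    case True
    interpret string_band Q \<rho> \<sigma> \<epsilon> b c
      using assms by unfold_locales
    show ?thesis
      unfolding True bi_power_b class_weak_brick_iff[OF bi_infinite_line]
      using brick_iff_no_admissible_pair unfolding \<B>_def by blast
  next
    case False
    then show ?thesis using band_module_not_brick[OF assms(2), of n c] assms(3) by auto
  qed
qed

end
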